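(* Let $A$ be a $(\mathbb{Z}_2)^n$-graded commutative algebra over $\mathbb{R}$, $n\ge1$, $p=2^n$, $\mathbf{r}\in\mathbb{N}^p$. If $\varepsilon$ denotes a formal nilpotent parameter of degree $0$ and $X\in\mathsf{M}^0(\mathbf{r};A)$ is a graded matrix of degree $0$, then $$\Gamma\mathrm{Ber}(\exp(\varepsilon X))=\exp\bigl(\Gamma\mathrm{tr}(\varepsilon X)\bigr).$$
   Context: The group $(\mathbb{Z}_2)^n$ carries the $\mathbb{Z}_2$-valued scalar product $\langle\gamma,\gamma'\rangle=\sum_i\gamma_i\gamma'_i$; $\gamma$ is even if $\langle\gamma,\gamma\rangle=0$ and odd otherwise. The elements are listed as $\gamma_1,\dots,\gamma_p$, $p=2^n$: first the $q=2^{n-1}$ even ones, then the $q$ odd ones, each group ordered lexicographically. A $(\mathbb{Z}_2)^n$-graded commutative algebra is an associative unital algebra $A=\bigoplus_\gamma A^\gamma$ with $A^\gamma A^\delta\subset A^{\gamma+\delta}$ and $ba=(-1)^{\langle\tilde a,\tilde b\rangle}ab$ for homogeneous $a,b$ of degrees $\tilde a,\tilde b$. $A[\varepsilon]$ is the algebra of formal polynomials in $\varepsilon$ with coefficients in $A$, where $\varepsilon$ is central of degree $0$ and nilpotent ($\varepsilon^N=0$ for some $N$); it is again $(\mathbb{Z}_2)^n$-graded commutative. For such an algebra $B$ (here $B=A$ or $A[\varepsilon]$), $\mathsf{M}^0(\mathbf{r};B)$ is the algebra of $p\times p$ block matrices $X=(X_{ku})$ with $X_{ku}$ of size $r_k\times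 r_u$ and entries in $B^{\gamma_k+\gamma_u}$; $\mathsf{GL}^0(\mathbf{r};B)$ is its group of invertible elements. For $M\in\mathsf{M}^0(\mathbf{s};A)$, $\exp(\varepsilon M)=\sum_k\varepsilon^k M^k/k!\in\mathsf{M}^0(\mathbf{s};A[\varepsilon])$ (a finite sum); the exponential of an element of $\varepsilon A^0[\varepsilon]$ is the case of $1\times1$ matrices. Graded trace of a degree $0$ matrix: $\Gamma\mathrm{tr}(X)=\sum_k(-1)^{\langle\gamma_k,\gamma_k\rangle}\mathrm{tr}(X_{kk})$. Graded determinant: let $\delta_1,\dots,\delta_q$ be the list of even elements or the list of odd elements, and let $Z=(Z_{ku})$ be a $q\times q$ block matrix with square diagonal blocks and $Z_{ku}$ having entries in $B^{\delta_k+\delta_u}$. $\Gamma\!\det$ is the unique map from such matrices to $B^0$ that is multiplicative, equals $\prod_k\det Z_{kk}$ on block-diagonal matrices, and equals $1$ on block-unitriangular matrices (block triangular with identity diagonal blocks). Explicitly it is the polynomial in the entries which coincides with $\prod_{k=0}^{q-1}\det|Z^{1\ldots k,1\ldots k}|_{k+1\,k+1}$ whenever the inverses involved exist; here $Z^{1\ldots k,1\ldots k}$ is $Z$ with its first $k$ block rows and block columns deleted, and $|Z^{1\ldots k,1\ldots k}|_{k+1\,k+1}=Z_{k+1,k+1}-(Z_{k+1,b})_{b>k+1}(Z^{1\ldots k+1,1\ldots k+1})^{-1}(Z_{a,k+1})_{a>k+1}$. Graded Berezinian: write $X\in\mathsf{GL}^0(\mathbf{r};B)$ as a $2\times2$ block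 matrix $\mathcal{X}$ by splitting block indices into even ($1,\dots,q$) and odd ($q+1,\dots,p$). $\Gamma\mathrm{Ber}:\mathsf{GL}^0(\mathbf{r};B)\to(B^0)^\times$ is the unique group homomorphism equal to $\Gamma\!\det(\mathcal{X}_{11})\,\Gamma\!\det(\mathcal{X}_{22})^{-1}$ on $2\times2$ block-diagonal matrices and to $1$ on $2\times 2$ block-unitriangular ones; explicitly $\Gamma\mathrm{Ber}(X)=\Gamma\!\det(\mathcal{X}_{11}-\mathcal{X}_{12}\mathcal{X}_{22}^{-1}\mathcal{X}_{21})\cdot\Gamma\!\det(\mathcal{X}_{22})^{-1}$. *)

theory Defs
  imports
    "HOL-Library.Z2"
    "HOL-Library.Cardinality"
    "HOL-Library.Poly_Mapping"
    "HOL-Combinatorics.Permutations"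
    "HOL-Computational_Algebra.Formal_Power_Series"
    "Jordan_Normal_Form.Matrix"
begin

section \<open>The grading group\<close>

text \<open>Elements of $(Z_2)^n$ are the lists of length \<open>n\<close> over the two-element field.\<close>

definition vec_add :: "bit list \<Rightarrow> bit list \<Rightarrow> bit list" where
  "vec_add \<gamma> \<delta> = map2 (+) \<gamma> \<delta>"

definition ip :: "bit list \<Rightarrow> bit list \<Rightarrow> bit" where
  "ip \<gamma> \<delta> = sum_list (map2 (*) \<gamma> \<delta>)"

definition sgn_pow :: "bit \<Rightarrow> real" where  \<comment> \<open>\<open>(-1)\<close> to the power \<open>b\<close>\<close>
  "sgn_pow b = (if b = 0 then 1 else - 1)"

primrec lex_vectors :: "nat \<Rightarrow> bit list list" where
  "lex_vectors 0 = [[]]"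
| "lex_vectors (Suc n) = map ((#) 0) (lex_vectors n) @ map ((#) 1) (lex_vectors n)"

definition evens :: "nat \<Rightarrow> bit list list" where
  "evens n = filter (\<lambda>\<gamma>. ip \<gamma> \<gamma> = 0) (lex_vectors n)"

definition odds :: "nat \<Rightarrow> bit list list" where
  "odds n = filter (\<lambda>\<gamma>. ip \<gamma> \<gamma> \<noteq> 0) (lex_vectors n)"

definition gammas :: "nat \<Rightarrow> bit list list" where
  "gammas n = evens n @ odds n"


section \<open>Graded commutative algebras\<close>

text \<open>The sort \<open>{real_algebra, monoid_mult}\<close> is that of associative unital real algebras, without
  the requirement \<open>0 \<noteq> 1\<close> that \<open>real_algebra_1\<close> would add.\<close>

locale graded_commutative_algebra =
  fixes n :: nat and A :: "bit list \<Rightarrow> 'a::{real_algebra,monoid_mult} set"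
  assumes component_subspace: "\<gamma> \<in> set (lex_vectors n) \<Longrightarrow> subspace (A \<gamma>)"
    and direct_sum: "\<exists>!f. (\<forall>\<gamma>\<in>set (lex_vectors n). f \<gamma> \<in> A \<gamma>) \<and>
          (\<forall>\<gamma>. \<gamma> \<notin> set (lex_vectors n) \<longrightarrow> f \<gamma> = 0) \<and> x = (\<Sum>\<gamma>\<in>set (lex_vectors n). f \<gamma>)"
    and mult_closed: "\<lbrakk>\<gamma> \<in> set (lex_vectors n); \<delta> \<in> set (lex_vectors n); a \<in> A \<gamma>; b \<in> A \<delta>\<rbrakk>
          \<Longrightarrow> a * b \<in> A (vec_add \<gamma> \<delta>)"
    and graded_commute: "\<lbrakk>\<gamma> \<in> set (lex_vectors n); \<delta> \<in> set (lex_vectors n); a \<in> A \<gamma>; b \<in> A \<delta>\<rbrakk>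
          \<Longrightarrow> b * a = sgn_pow (ip \<gamma> \<delta>) *\<^sub>R (a * b)"


section \<open>Polynomials in a nilpotent parameter\<close>

text \<open>\<open>('a, 'N) nilpoly\<close> is the algebra of polynomials over \<open>'a\<close> in a central \<open>\<epsilon>\<close>
  modulo \<open>\<epsilon> ^ N = 0\<close>, where \<open>N = CARD('N)\<close>; an element is its sequence of coefficients.\<close>

typedef (overloaded) ('a::zero, 'N::finite) nilpoly =
  "{f :: nat \<Rightarrow> 'a. \<forall>k\<ge>CARD('N). f k = 0}"
  morphisms ncoeff Abs_nilpoly
  by (rule exI[of _ "\<lambda>_. 0"]) simp

setup_lifting type_definition_nilpoly

lemma nilpoly_eqI: "(\<And>k. k < CARD('N) \<Longrightarrow> ncoeff a k = ncoeff b k) \<Longrightarrow> a = b"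
  for a b :: "('a::zero, 'N::finite) nilpoly"
  by transfer (metis ext linorder_not_less)

lemma card_pos: "0 < CARD('N::finite)"
  by (simp add: card_gt_0_iff)

instantiation nilpoly :: (zero, finite) zero
begin
lift_definition zero_nilpoly :: "('a, 'b) nilpoly" is "\<lambda>_. 0" by simp
instance ..
end

instantiation nilpoly :: ("{zero,one}", finite) one
begin
lift_definition one_nilpoly :: "('a, 'b) nilpoly" is "\<lambda>k. if k = 0 then 1 else 0"
  using card_pos[where 'N = 'b] by auto
instance ..
end

instantiation nilpoly :: (ab_group_add, finite) ab_group_add
begin
lift_definition plus_nilpoly :: "('a, 'b) nilpoly \<Rightarrow> ('a, 'b) nilpoly \<Rightarrow> ('a, 'b) nilpoly"
  is "\<lambda>f g k. f k + g k" by simp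
lift_definition uminus_nilpoly :: "('a, 'b) nilpoly \<Rightarrow> ('a, 'b) nilpoly"
  is "\<lambda>f k. - f k" by simp
lift_definition minus_nilpoly :: "('a, 'b) nilpoly \<Rightarrow> ('a, 'b) nilpoly \<Rightarrow> ('a, 'b) nilpoly"
  is "\<lambda>f g k. f k - g k" by simp
instance by standard (transfer; simp add: algebra_simps)+
end

instantiation nilpoly :: (real_vector, finite) real_vector
begin
lift_definition scaleR_nilpoly :: "real \<Rightarrow> ('a, 'b) nilpoly \<Rightarrow> ('a, 'b) nilpoly"
  is "\<lambda>c f k. c *\<^sub>R f k" by simp
instance by standard (transfer; simp add: algebra_simps)+
end

instantiation nilpoly :: (semiring_0, finite) times
begin
lift_definition times_nilpoly :: "('a, 'b) nilpoly \<Rightarrow> ('a, 'b) nilpoly \<Rightarrow> ('a, 'b) nilpoly"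
  is "\<lambda>f g k. if k < CARD('b) then \<Sum>i=0..k. f i * g (k - i) else 0" by simp
instance ..
end

lemma ncoeff_mult:
  "ncoeff (a * b) k = (if k < CARD('N) then \<Sum>i=0..k. ncoeff a i * ncoeff b (k - i) else 0)"
  for a b :: "('a::semiring_0, 'N::finite) nilpoly"
  by transfer simp

lemma nilpoly_mult_assoc: "(a * b) * c = a * (b * c)"
  for a b c :: "('a::semiring_0, 'N::finite) nilpoly"
proof (rule nilpoly_eqI)
  fix k assume k: "k < CARD('N)"
  let ?F = "\<lambda>x :: ('a, 'N) nilpoly. Abs_fps (ncoeff x)"
  have "ncoeff ((a * b) * c) k = fps_nth (?F a * ?F b * ?F c) k"
    using k by (simp add: ncoeff_mult fps_mult_nth)
  also have "\<dots> = fps_nth (?F a * (?F b * ?F c)) k"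
    by (simp add: mult.assoc)
  also have "\<dots> = ncoeff (a * (b * c)) k"
    using k by (auto simp: ncoeff_mult fps_mult_nth intro!: sum.cong)
  finally show "ncoeff ((a * b) * c) k = ncoeff (a * (b * c)) k" .
qed

instance nilpoly :: (real_algebra, finite) real_algebra
proof
  fix a b c :: "('a, 'b) nilpoly" and r :: real
  show "a * b * c = a * (b * c)" by (rule nilpoly_mult_assoc)
  show "(a + b) * c = a * c + b * c"
    by (rule nilpoly_eqI) (simp add: ncoeff_mult plus_nilpoly.rep_eq algebra_simps sum.distrib)
  show "a * (b + c) = a * b + a * c"
    by (rule nilpoly_eqI) (simp add: ncoeff_mult plus_nilpoly.rep_eq algebra_simps sum.distrib)
  show "r *\<^sub>R a * b = r *\<^sub>R (a * b)"
    by (rule nilpoly_eqI) (simp add: ncoeff_mult scaleR_nilpoly.rep_eq scaleR_sum_right)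
  show "a * r *\<^sub>R b = r *\<^sub>R (a * b)"
    by (rule nilpoly_eqI) (simp add: ncoeff_mult scaleR_nilpoly.rep_eq scaleR_sum_right)
qed

instance nilpoly :: ("{real_algebra,monoid_mult}", finite) monoid_mult
proof
  fix a :: "('a, 'b) nilpoly"
  show "1 * a = a"
  proof (rule nilpoly_eqI)
    fix k assume k: "k < CARD('b)"
    have "(\<Sum>i=0..k. ncoeff 1 i * ncoeff a (k - i)) = (\<Sum>i=0..k. if i = 0 then ncoeff a k else 0)"
      by (rule sum.cong) (auto simp: one_nilpoly.rep_eq)
    then show "ncoeff (1 * a) k = ncoeff a k" using k by (simp add: ncoeff_mult)
  qed
  show "a * 1 = a"
  proof (rule nilpoly_eqI)
    fix k assume k: "k < CARD('b)"
    have "(\<Sum>i=0..k. ncoeff a i * ncoeff 1 (k - i)) = (\<Sum>i=0..k. if i = k then ncoeff a k else 0)"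
      by (rule sum.cong) (auto simp: one_nilpoly.rep_eq)
    then show "ncoeff (a * 1) k = ncoeff a k" using k by (simp add: ncoeff_mult)
  qed
qed

lift_definition nconst :: "'a::zero \<Rightarrow> ('a, 'N::finite) nilpoly"
  is "\<lambda>a k. if k = 0 then a else 0"
  using card_pos[where 'N = 'N] by auto

lift_definition eps :: "('a::{zero,one}, 'N::finite) nilpoly"
  is "\<lambda>k. if k = 1 \<and> k < CARD('N) then 1 else 0" by simp

definition nilpoly_grading ::
    "(bit list \<Rightarrow> 'a::zero set) \<Rightarrow> bit list \<Rightarrow> ('a, 'N::finite) nilpoly set" where
  "nilpoly_grading A \<gamma> = {f. \<forall>k. ncoeff f k \<in> A \<gamma>}"


section \<open>Block matrices of degree zero\<close>

text \<open>A block matrix with block sizes \<open>s\<close> is stored as one square matrix of size \<open>sum_list s\<close>;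
  block indices start from 0.\<close>

definition block :: "nat list \<Rightarrow> 'a mat \<Rightarrow> nat \<Rightarrow> nat \<Rightarrow> 'a mat" where
  "block s Z k u = mat (s ! k) (s ! u)
     (\<lambda>(i, j). Z $$ (sum_list (take k s) + i, sum_list (take u s) + j))"

definition graded_matrices ::
    "(bit list \<Rightarrow> 'b set) \<Rightarrow> bit list list \<Rightarrow> nat list \<Rightarrow> 'b mat set" where
  "graded_matrices B \<delta>s s = {Z \<in> carrier_mat (sum_list s) (sum_list s).
     \<forall>k<length s. \<forall>u<length s. elements_mat (block s Z k u) \<subseteq> B (vec_add (\<delta>s ! k) (\<delta>s ! u))}"

definition M0 :: "nat \<Rightarrow> (bit list \<Rightarrow> 'b set) \<Rightarrow> nat list \<Rightarrow> 'b mat set" where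
  "M0 n B r = graded_matrices B (gammas n) r"

definition is_mat_inverse :: "'b::{real_algebra,monoid_mult} mat \<Rightarrow> 'b mat \<Rightarrow> bool" where
  "is_mat_inverse Z W \<longleftrightarrow> W \<in> carrier_mat (dim_row Z) (dim_row Z) \<and>
     Z * W = 1\<^sub>m (dim_row Z) \<and> W * Z = 1\<^sub>m (dim_row Z)"

definition mat_inverse :: "'b::{real_algebra,monoid_mult} mat \<Rightarrow> 'b mat" where
  "mat_inverse Z = (THE W. is_mat_inverse Z W)"

definition ring_inverse :: "'b::{real_algebra,monoid_mult} \<Rightarrow> 'b" where
  "ring_inverse x = (THE y. x * y = 1 \<and> y * x = 1)"

text \<open>The library determinant needs a commutative ring type, whereas here only the entries
  (of degree zero) commute.\<close>

definition leibniz_det :: "'b::{real_algebra,monoid_mult} mat \<Rightarrow> 'b" where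
  "leibniz_det Z = (\<Sum>\<pi> | \<pi> permutes {..<dim_row Z}.
     real_of_int (sign \<pi>) *\<^sub>R prod_list (map (\<lambda>i. Z $$ (i, \<pi> i)) [0..<dim_row Z]))"

definition mat_trace :: "'b::comm_monoid_add mat \<Rightarrow> 'b" where
  "mat_trace Z = (\<Sum>i<dim_row Z. Z $$ (i, i))"

definition graded_trace :: "nat \<Rightarrow> nat list \<Rightarrow> 'b::real_vector mat \<Rightarrow> 'b" where
  "graded_trace n r Z =
     (\<Sum>k<2 ^ n. sgn_pow (ip (gammas n ! k) (gammas n ! k)) *\<^sub>R mat_trace (block r Z k k))"


section \<open>Graded determinant\<close>

text \<open>The product of the determinants of the quasideterminants: each step splits off the first
  block row and column, and \<open>Z22\<close> is the matrix with these deleted.\<close>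

primrec quasidet_prod :: "nat list \<Rightarrow> 'b::{real_algebra,monoid_mult} mat \<Rightarrow> 'b" where
  "quasidet_prod [] Z = 1"
| "quasidet_prod (m # s) Z = (case split_block Z m m of (Z11, Z12, Z21, Z22) \<Rightarrow>
     leibniz_det (Z11 - Z12 * mat_inverse Z22 * Z21) * quasidet_prod s Z22)"

primrec quasidet_defined :: "nat list \<Rightarrow> 'b::{real_algebra,monoid_mult} mat \<Rightarrow> bool" where
  "quasidet_defined [] Z \<longleftrightarrow> True"
| "quasidet_defined (m # s) Z \<longleftrightarrow> (case split_block Z m m of (Z11, Z12, Z21, Z22) \<Rightarrow>
     (\<exists>W. is_mat_inverse Z22 W) \<and> quasidet_defined s Z22)"

text \<open>A polynomial in the noncommuting matrix entries is a finitely supported family of real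
  coefficients on words of index pairs.\<close>

definition eval_poly ::
    "((nat \<times> nat) list \<Rightarrow>\<^sub>0 real) \<Rightarrow> 'b::{real_algebra,monoid_mult} mat \<Rightarrow> 'b" where
  "eval_poly P Z = (\<Sum>w\<in>Poly_Mapping.keys P. Poly_Mapping.lookup P w *\<^sub>R prod_list (map (\<lambda>ij. Z $$ ij) w))"

text \<open>As the coefficients are real, the condition determines the values of \<open>P\<close> on all of
  \<open>graded_matrices B \<delta>s s\<close> (for \<open>\<delta>s\<close> all even or all odd), although not \<open>P\<close> itself.\<close>

definition graded_det ::
    "(bit list \<Rightarrow> 'b::{real_algebra,monoid_mult} set) \<Rightarrow> bit list list \<Rightarrow> nat list \<Rightarrow> 'b mat \<Rightarrow> 'b" where
  "graded_det B \<delta>s s Z = eval_poly (SOME P. \<forall>W\<in>graded_matrices B \<delta>s s.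
     quasidet_defined s W \<longrightarrow> eval_poly P W = quasidet_prod s W) Z"


section \<open>Graded Berezinian\<close>

text \<open>Intended for invertible \<open>Z \<in> M0 n B r\<close>; then the odd-odd block \<open>Z22\<close> is invertible.\<close>

definition graded_ber ::
    "nat \<Rightarrow> (bit list \<Rightarrow> 'b::{real_algebra,monoid_mult} set) \<Rightarrow> nat list \<Rightarrow> 'b mat \<Rightarrow> 'b" where
  "graded_ber n B r Z = (let q = 2 ^ (n - 1); re = take q r; ro = drop q r; m = sum_list re in
     case split_block Z m m of (Z11, Z12, Z21, Z22) \<Rightarrow>
       graded_det B (evens n) re (Z11 - Z12 * mat_inverse Z22 * Z21) *
       ring_inverse (graded_det B (odds n) ro Z22))"


section \<open>Exponentials\<close>

text \<open>For arguments divisible by \<open>\<epsilon>\<close> all further terms of the exponential series vanish.\<close>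

definition exp_nil ::
    "('a::{real_algebra,monoid_mult}, 'N::finite) nilpoly \<Rightarrow> ('a, 'N) nilpoly" where
  "exp_nil x = (\<Sum>k<CARD('N). (1 / fact k) *\<^sub>R x ^ k)"

primrec mat_power :: "'b::{real_algebra,monoid_mult} mat \<Rightarrow> nat \<Rightarrow> 'b mat" where
  "mat_power Z 0 = 1\<^sub>m (dim_row Z)"
| "mat_power Z (Suc k) = mat_power Z k * Z"

definition exp_mat ::
    "('a::{real_algebra,monoid_mult}, 'N::finite) nilpoly mat \<Rightarrow> ('a, 'N) nilpoly mat" where
  "exp_mat Z = mat (dim_row Z) (dim_row Z)
     (\<lambda>ij. \<Sum>k<CARD('N). (1 / fact k) *\<^sub>R (mat_power Z k $$ ij))"

definition eps_mat :: "'a::{real_algebra,monoid_mult} mat \<Rightarrow> ('a, 'N::finite) nilpoly mat" where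
  "eps_mat X = eps \<cdot>\<^sub>m map_mat nconst X"

end

theory Submission
  imports Defs "Jordan_Normal_Form.Determinant"
begin

text \<open>Let \<open>D = \<epsilon> d/d\<epsilon>\<close>, a derivation of \<open>A[\<epsilon>]\<close> that multiplies the coefficient of \<open>\<epsilon>\<^sup>k\<close> by \<open>k\<close>. A solution of
\<open>D f = h f\<close> with \<open>h\<close> divisible by \<open>\<epsilon>\<close> is determined by its constant coefficient
(\<open>nilpoly_ode_unique\<close>), so it suffices that both sides of the identity have constant coefficient 1
and satisfy this equation for \<open>h = \<Gamma>tr(\<epsilon> X)\<close>. For the exponential of a scalar this is immediate.

For the Berezinian put \<open>Y = \<epsilon> X\<close> and \<open>E = exp Y\<close>, so that \<open>D E = Y E\<close>. With respect to the splitting into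
even and odd indices let \<open>F = E12 E22\<^sup>-\<^sup>1\<close> and \<open>S = E11 - F E21\<close>; the Berezinian is
\<open>\<Gamma>det S / \<Gamma>det E22\<close>. The matrix equation for \<open>E\<close> decouples (\<open>schur_complement_ode\<close>):
\<open>D S = (Y11 - F Y21) S\<close> and \<open>D E22 = (Y21 F + Y22) E22\<close>. Liouville's formula
\<open>D (\<Gamma>det Z) = tr U \<Gamma>det Z\<close> for \<open>D Z = U Z\<close> (\<open>liouville_twisted_det\<close>) then shows that the Berezinian
satisfies the scalar equation with \<open>h = tr Y11 - tr (F Y21) - tr (Y21 F) - tr Y22\<close>. The entries of \<open>F\<close>
and \<open>Y21\<close> have odd degree and anticommute, so the two middle traces cancel (\<open>supertrace_commute\<close>) and
\<open>h\<close> is the graded trace of \<open>Y\<close>.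

This needs a multiplicative \<open>\<Gamma>det\<close>. It is defined by choosing a polynomial that agrees with the product of
quasideterminants wherever the latter is defined, so it means something only because such a
polynomial exists. One is obtained by a change of signs: there is a bilinear form \<open>twist\<close> on \<open>(Z\<^sub>2)\<^sup>n\<close>
such that multiplying the product of elements of degrees \<open>\<gamma>\<close> and \<open>\<delta>\<close> by \<open>(-1)\<close> to the power \<open>twist \<gamma> \<delta>\<close>
makes the even part of the algebra commutative. If all row and column degrees are even, or all are
odd, then the entries of a matrix of degree 0 lie in the even part, and suitable signs turn
these matrices into ordinary matrices over a commutative ring, compatibly with products
(\<open>twist_rep_mult\<close>). The ordinary determinant, read back, is a signed Leibniz sum \<open>twisted_det\<close>; it is
multiplicative, and the usual factorisation of a block matrix through a Schur complement
(\<open>twisted_det_schur\<close>) identifies it with the product of quasideterminants (\<open>graded_det_eq_twisted_det\<close>).\<close>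

section \<open>Degree vectors and the twist\<close>

notation vec_add (infixl \<open>\<boxplus>\<close> 65)

lemma bit_add_self: "x + x = (0::bit)"
  by (cases x) auto

lemma bit_mult_self: "x * x = (x::bit)"
  by (cases x) auto

lemma length_vec_add [simp]: "length (\<gamma> \<boxplus> \<delta>) = min (length \<gamma>) (length \<delta>)"
  by (simp add: vec_add_def)

lemma nth_vec_add [simp]: "k < length \<gamma> \<Longrightarrow> k < length \<delta> \<Longrightarrow> (\<gamma> \<boxplus> \<delta>) ! k = \<gamma> ! k + \<delta> ! k"
  by (simp add: vec_add_def)

lemma vec_add_commute: "\<gamma> \<boxplus> \<delta> = \<delta> \<boxplus> \<gamma>"
  by (rule nth_equalityI) (auto simp: add.commute)

lemma vec_add_assoc: "(\<gamma> \<boxplus> \<delta>) \<boxplus> \<eta> = \<gamma> \<boxplus> (\<delta> \<boxplus> \<eta>)"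
  by (rule nth_equalityI) (auto simp: add.assoc)

abbreviation zvec :: "nat \<Rightarrow> bit list" where
  "zvec n \<equiv> replicate n 0"

lemma vec_add_zero [simp]: "length \<gamma> = n \<Longrightarrow> zvec n \<boxplus> \<gamma> = \<gamma>" "length \<gamma> = n \<Longrightarrow> \<gamma> \<boxplus> zvec n = \<gamma>"
  by (rule nth_equalityI; simp)+

lemma vec_add_self: "length \<gamma> = n \<Longrightarrow> \<gamma> \<boxplus> \<gamma> = zvec n"
  by (rule nth_equalityI) (auto simp: bit_add_self)

lemma vec_add_cancel [simp]: "length \<gamma> = length \<delta> \<Longrightarrow> \<gamma> \<boxplus> (\<gamma> \<boxplus> \<delta>) = \<delta>"
  by (simp add: vec_add_self flip: vec_add_assoc)

lemma vec_add_cancel_middle: "length \<gamma> = n \<Longrightarrow> length \<delta> = n \<Longrightarrow> length \<eta> = n \<Longrightarrow>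
    (\<gamma> \<boxplus> \<delta>) \<boxplus> (\<delta> \<boxplus> \<eta>) = \<gamma> \<boxplus> \<eta>"
  by (simp add: vec_add_assoc)

lemma set_lex_vectors [simp]: "set (lex_vectors n) = {\<gamma>. length \<gamma> = n}"
proof (induction n)
  case (Suc n)
  have *: "\<gamma> \<in> (#) 0 ` {\<gamma>. length \<gamma> = n} \<union> (#) 1 ` {\<gamma>. length \<gamma> = n} \<longleftrightarrow> length \<gamma> = Suc n" for \<gamma> :: "bit list"
    by (cases \<gamma>; cases "hd \<gamma>") auto
  show ?case
    by (intro Set.set_eqI) (simp only: lex_vectors.simps set_append set_map Suc mem_Collect_eq *)
qed auto

lemma finite_vectors [simp]: "finite {\<gamma> :: bit list. length \<gamma> = n}"
  by (metis List.finite_set set_lex_vectors)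

lemma sum_list_vec_add: "length \<gamma> = length \<delta> \<Longrightarrow> sum_list (\<gamma> \<boxplus> \<delta>) = sum_list \<gamma> + sum_list \<delta>"
  unfolding vec_add_def by (induction \<gamma> \<delta> rule: list_induct2) (auto simp: algebra_simps)

lemma ip_self: "ip \<gamma> \<gamma> = sum_list \<gamma>"
  unfolding ip_def by (induction \<gamma>) (auto simp: bit_mult_self)

lemma ip_zero_left [simp]: "ip (zvec n) \<delta> = 0"
proof -
  have "sum_list (map2 (*) (replicate n 0) \<delta>) = 0" for n
    by (induction n arbitrary: \<delta>) (simp, case_tac \<delta>, auto)
  then show ?thesis by (simp add: ip_def)
qed

lemma sgn_pow_add: "sgn_pow (a + b) = sgn_pow a * sgn_pow b"
  by (cases a; cases b) (auto simp: sgn_pow_def)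

lemma sgn_pow_0 [simp]: "sgn_pow 0 = 1"
  by (simp add: sgn_pow_def)

text \<open>The form \<open>\<Sum>i<j. \<gamma>\<^sub>i \<delta>\<^sub>j\<close>. Together with the same form of the exchanged arguments it gives \<open>\<Sum>i\<noteq>j. \<gamma>\<^sub>i \<delta>\<^sub>j\<close>,
which differs from the scalar product only by the product of the two coordinate sums.\<close>
fun twist :: "bit list \<Rightarrow> bit list \<Rightarrow> bit" where
  "twist (a # \<gamma>) (b # \<delta>) = a * sum_list \<delta> + twist \<gamma> \<delta>"
| "twist _ _ = 0"

lemma twist_add_left:
  "length \<gamma> = length \<delta> \<Longrightarrow> length \<delta> = length \<eta> \<Longrightarrow> twist (\<gamma> \<boxplus> \<delta>) \<eta> = twist \<gamma> \<eta> + twist \<delta> \<eta>"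
  by (induction \<gamma> \<delta> \<eta> rule: list_induct3) (auto simp: vec_add_def algebra_simps)

lemma twist_add_right:
  "length \<gamma> = length \<delta> \<Longrightarrow> length \<delta> = length \<eta> \<Longrightarrow> twist \<gamma> (\<delta> \<boxplus> \<eta>) = twist \<gamma> \<delta> + twist \<gamma> \<eta>"
proof (induction \<gamma> \<delta> \<eta> rule: list_induct3)
  case (Cons x xs y ys z zs)
  then show ?case
    using sum_list_vec_add[of ys zs] by (auto simp: vec_add_def algebra_simps)
qed (simp add: vec_add_def)

lemma twist_zero_left [simp]: "twist (zvec n) \<delta> = 0"
  by (induction n arbitrary: \<delta>) (simp, case_tac \<delta>, auto)

lemma twist_zero_right [simp]: "twist \<gamma> (zvec n) = 0"
  by (induction n arbitrary: \<gamma>) (case_tac \<gamma>, simp, simp, case_tac \<gamma>, auto simp: sum_list_replicate)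

text \<open>On even vectors the last summand vanishes, so there the exchange of two arguments of \<open>twist\<close> produces exactly the
sign in the graded commutation rule.\<close>
lemma twist_commute:
  "length \<gamma> = length \<delta> \<Longrightarrow> twist \<delta> \<gamma> = twist \<gamma> \<delta> + ip \<gamma> \<delta> + sum_list \<gamma> * sum_list \<delta>"
proof (induction \<gamma> \<delta> rule: list_induct2)
  case (Cons x xs y ys)
  have *: "ip (x # xs) (y # ys) = x * y + ip xs ys"
    by (simp add: ip_def)
  have **: "twist ys xs = twist xs ys + ip xs ys + sum_list xs * sum_list ys" by fact
  show ?case
    unfolding * by (cases x; cases y) (auto simp: ** algebra_simps bit_add_self)
qed (simp add: ip_def)

section \<open>Even and odd degree vectors\<close>

lemma set_evens: "set (evens n) = {\<gamma>. length \<gamma> = n \<and> sum_list \<gamma> = 0}"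
  by (auto simp: evens_def ip_self)

lemma set_odds: "set (odds n) = {\<gamma>. length \<gamma> = n \<and> sum_list \<gamma> = 1}"
  by (auto simp: odds_def ip_self)

lemma length_evens_odds: "length (evens n) + length (odds n) = 2 ^ n"
proof -
  have "length (lex_vectors n) = 2 ^ n" by (induction n) auto
  moreover have "length (evens n) + length (odds n) = length (lex_vectors n)"
    unfolding evens_def odds_def by (rule sum_length_filter_compl)
  ultimately show ?thesis by simp
qed

text \<open>Prepending 0 preserves and prepending 1 changes the parity, so both kinds of vectors of length \<open>n + 1\<close>
are counted by all the vectors of length \<open>n\<close>.\<close>
lemma length_evens: "n \<ge> 1 \<Longrightarrow> length (evens n) = 2 ^ (n - 1)"
proof (cases n)
  case (Suc m)
  have "length (evens (Suc m)) = length (evens m) + length (odds m)"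
    by (simp add: evens_def odds_def filter_map o_def ip_self)
  then show ?thesis using Suc length_evens_odds by simp
qed simp

lemma length_odds: "n \<ge> 1 \<Longrightarrow> length (odds n) = 2 ^ (n - 1)"
  using length_evens_odds[of n] length_evens[of n] by (cases n) auto

section \<open>Twisted multiplication of families of components\<close>

definition concentrated :: "bit list \<Rightarrow> 'b \<Rightarrow> bit list \<Rightarrow> 'b::zero" where
  "concentrated \<gamma> b = (\<lambda>\<delta>. if \<delta> = \<gamma> then b else 0)"

text \<open>An element of the even part is recorded as the family of its homogeneous components. This makes the
twisted product below a convolution.\<close>
definition even_part :: "nat \<Rightarrow> (bit list \<Rightarrow> 'b::zero set) \<Rightarrow> (bit list \<Rightarrow> 'b) set" where
  "even_part n B = {f. \<forall>\<gamma>. if \<gamma> \<in> set (evens n) then f \<gamma> \<in> B \<gamma> else f \<gamma> = 0}"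

text \<open>The component of degree \<open>\<gamma>\<close> collects the products of degrees \<open>\<delta>\<close> and \<open>\<gamma> - \<delta>\<close>; in characteristic 2 the
latter is \<open>\<delta> + \<gamma>\<close>.\<close>
definition twisted_mult :: "nat \<Rightarrow> (bit list \<Rightarrow> 'b) \<Rightarrow> (bit list \<Rightarrow> 'b) \<Rightarrow> bit list \<Rightarrow> 'b::real_algebra" where
  "twisted_mult n f g = (\<lambda>\<gamma>. if \<gamma> \<in> set (evens n)
     then \<Sum>\<delta>\<in>set (evens n). sgn_pow (twist \<delta> (\<delta> \<boxplus> \<gamma>)) *\<^sub>R (f \<delta> * g (\<delta> \<boxplus> \<gamma>)) else 0)"

lemma evens_add: "\<gamma> \<in> set (evens n) \<Longrightarrow> \<delta> \<in> set (evens n) \<Longrightarrow> \<gamma> \<boxplus> \<delta> \<in> set (evens n)"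
  by (auto simp: set_evens sum_list_vec_add)

lemma zvec_even [simp]: "zvec n \<in> set (evens n)"
  by (auto simp: set_evens sum_list_replicate)

lemma evens_length: "\<gamma> \<in> set (evens n) \<Longrightarrow> length \<gamma> = n"
  by (auto simp: set_evens)

text \<open>The sign is a 2-cocycle because \<open>twist\<close> is bilinear.\<close>
lemma twisted_mult_assoc: "twisted_mult n (twisted_mult n f g) h = twisted_mult n f (twisted_mult n g h)"
proof
  fix \<gamma>
  let ?E = "set (evens n)"
  let ?s = "\<lambda>\<alpha> \<beta>. sgn_pow (twist \<alpha> \<beta>)"
  show "twisted_mult n (twisted_mult n f g) h \<gamma> = twisted_mult n f (twisted_mult n g h) \<gamma>"
  proof (cases "\<gamma> \<in> ?E")
    case True
    have "twisted_mult n (twisted_mult n f g) h \<gamma> = (\<Sum>\<delta>\<in>?E. \<Sum>\<alpha>\<in>?E.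
        (?s \<delta> (\<delta> \<boxplus> \<gamma>) * ?s \<alpha> (\<alpha> \<boxplus> \<delta>)) *\<^sub>R (f \<alpha> * g (\<alpha> \<boxplus> \<delta>) * h (\<delta> \<boxplus> \<gamma>)))"
      using True by (simp add: twisted_mult_def sum_distrib_right scaleR_sum_right)
    also have "\<dots> = (\<Sum>\<alpha>\<in>?E. \<Sum>\<delta>\<in>?E.
        (?s \<delta> (\<delta> \<boxplus> \<gamma>) * ?s \<alpha> (\<alpha> \<boxplus> \<delta>)) *\<^sub>R (f \<alpha> * g (\<alpha> \<boxplus> \<delta>) * h (\<delta> \<boxplus> \<gamma>)))"
      by (rule sum.swap)
    also have "\<dots> = (\<Sum>\<alpha>\<in>?E. \<Sum>\<beta>\<in>?E.
        (?s \<alpha> (\<alpha> \<boxplus> \<gamma>) * ?s \<beta> (\<beta> \<boxplus> (\<alpha> \<boxplus> \<gamma>))) *\<^sub>R (f \<alpha> * (g \<beta> * h (\<beta> \<boxplus> (\<alpha> \<boxplus> \<gamma>)))))"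
    proof (rule sum.cong[OF refl])
      fix \<alpha> assume \<alpha>: "\<alpha> \<in> ?E"
      show "(\<Sum>\<delta>\<in>?E.
          (?s \<delta> (\<delta> \<boxplus> \<gamma>) * ?s \<alpha> (\<alpha> \<boxplus> \<delta>)) *\<^sub>R (f \<alpha> * g (\<alpha> \<boxplus> \<delta>) * h (\<delta> \<boxplus> \<gamma>))) =
        (\<Sum>\<beta>\<in>?E.
          (?s \<alpha> (\<alpha> \<boxplus> \<gamma>) * ?s \<beta> (\<beta> \<boxplus> (\<alpha> \<boxplus> \<gamma>))) *\<^sub>R (f \<alpha> * (g \<beta> * h (\<beta> \<boxplus> (\<alpha> \<boxplus> \<gamma>)))))"
      proof (rule sum.reindex_bij_witness[of _ "\<lambda>\<beta>. \<alpha> \<boxplus> \<beta>" "\<lambda>\<beta>. \<alpha> \<boxplus> \<beta>"])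
        fix \<delta> assume \<delta>: "\<delta> \<in> ?E"
        have len: "length \<alpha> = n" "length \<delta> = n" "length \<gamma> = n"
          using \<alpha> \<delta> True evens_length by auto
        have e: "(\<alpha> \<boxplus> \<delta>) \<boxplus> (\<alpha> \<boxplus> \<gamma>) = \<delta> \<boxplus> \<gamma>"
          using vec_add_cancel_middle[of \<delta> n \<alpha> \<gamma>] len by (simp only: vec_add_commute[of \<alpha> \<delta>])
        have "twist \<alpha> (\<alpha> \<boxplus> \<gamma>) + twist (\<alpha> \<boxplus> \<delta>) (\<delta> \<boxplus> \<gamma>) = twist \<delta> (\<delta> \<boxplus> \<gamma>) + twist \<alpha> (\<alpha> \<boxplus> \<delta>)"
          using len by (cases "twist \<alpha> \<alpha>"; cases "twist \<alpha> \<gamma>"; cases "twist \<alpha> \<delta>"; cases "twist \<delta> \<delta>";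
              cases "twist \<delta> \<gamma>"; simp add: twist_add_left twist_add_right)
        then have "?s \<alpha> (\<alpha> \<boxplus> \<gamma>) * ?s (\<alpha> \<boxplus> \<delta>) (\<delta> \<boxplus> \<gamma>) = ?s \<delta> (\<delta> \<boxplus> \<gamma>) * ?s \<alpha> (\<alpha> \<boxplus> \<delta>)"
          by (simp flip: sgn_pow_add)
        then show "(?s \<alpha> (\<alpha> \<boxplus> \<gamma>) * ?s (\<alpha> \<boxplus> \<delta>) ((\<alpha> \<boxplus> \<delta>) \<boxplus> (\<alpha> \<boxplus> \<gamma>))) *\<^sub>R
            (f \<alpha> * (g (\<alpha> \<boxplus> \<delta>) * h ((\<alpha> \<boxplus> \<delta>) \<boxplus> (\<alpha> \<boxplus> \<gamma>)))) =
          (?s \<delta> (\<delta> \<boxplus> \<gamma>) * ?s \<alpha> (\<alpha> \<boxplus> \<delta>)) *\<^sub>R (f \<alpha> * g (\<alpha> \<boxplus> \<delta>) * h (\<delta> \<boxplus> \<gamma>))"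
          unfolding e by (simp add: mult.assoc)
      qed (use \<alpha> in \<open>auto simp: evens_add evens_length\<close>)
    qed
    also have "\<dots> = twisted_mult n f (twisted_mult n g h) \<gamma>"
      using True by (simp add: twisted_mult_def evens_add sum_distrib_left scaleR_sum_right)
    finally show ?thesis .
  qed (simp add: twisted_mult_def)
qed

lemma twisted_mult_concentrated:
  assumes "\<gamma> \<in> set (evens n)" "\<delta> \<in> set (evens n)"
  shows "twisted_mult n (concentrated \<gamma> a) (concentrated \<delta> b) = concentrated (\<gamma> \<boxplus> \<delta>) (sgn_pow (twist \<gamma> \<delta>) *\<^sub>R (a * b))"
proof
  fix \<eta>
  have "(\<Sum>\<alpha>\<in>set (evens n). sgn_pow (twist \<alpha> (\<alpha> \<boxplus> \<eta>)) *\<^sub>R (concentrated \<gamma> a \<alpha> * concentrated \<delta> b (\<alpha> \<boxplus> \<eta>))) =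
    (\<Sum>\<alpha>\<in>set (evens n). if \<alpha> = \<gamma> then sgn_pow (twist \<gamma> (\<gamma> \<boxplus> \<eta>)) *\<^sub>R (a * concentrated \<delta> b (\<gamma> \<boxplus> \<eta>)) else 0)"
    by (rule sum.cong) (auto simp: concentrated_def)
  also have "\<dots> = sgn_pow (twist \<gamma> (\<gamma> \<boxplus> \<eta>)) *\<^sub>R (a * concentrated \<delta> b (\<gamma> \<boxplus> \<eta>))"
    using assms by simp
  finally have *: "twisted_mult n (concentrated \<gamma> a) (concentrated \<delta> b) \<eta> =
    (if \<eta> \<in> set (evens n) then sgn_pow (twist \<gamma> (\<gamma> \<boxplus> \<eta>)) *\<^sub>R (a * concentrated \<delta> b (\<gamma> \<boxplus> \<eta>)) else 0)"
    by (simp add: twisted_mult_def)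
  show "twisted_mult n (concentrated \<gamma> a) (concentrated \<delta> b) \<eta> = concentrated (\<gamma> \<boxplus> \<delta>) (sgn_pow (twist \<gamma> \<delta>) *\<^sub>R (a * b)) \<eta>"
    unfolding * using assms evens_add[OF assms]
    by (auto simp: concentrated_def evens_length)
qed

lemma twisted_mult_one_left:
  fixes f :: "bit list \<Rightarrow> 'b::{real_algebra,monoid_mult}"
  assumes "\<And>\<gamma>. \<gamma> \<notin> set (evens n) \<Longrightarrow> f \<gamma> = 0"
  shows "twisted_mult n (concentrated (zvec n) 1) f = f"
proof
  fix \<eta>
  have "(\<Sum>\<alpha>\<in>set (evens n). sgn_pow (twist \<alpha> (\<alpha> \<boxplus> \<eta>)) *\<^sub>R (concentrated (zvec n) 1 \<alpha> * f (\<alpha> \<boxplus> \<eta>))) =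
    (\<Sum>\<alpha>\<in>set (evens n). if \<alpha> = zvec n then f (zvec n \<boxplus> \<eta>) else 0)"
    by (rule sum.cong) (auto simp: concentrated_def)
  also have "\<dots> = f (zvec n \<boxplus> \<eta>)"
    by simp
  finally show "twisted_mult n (concentrated (zvec n) 1) f \<eta> = f \<eta>"
    using assms evens_length[of \<eta> n] by (auto simp: twisted_mult_def)
qed

lemma twisted_mult_add_left: "twisted_mult n (\<lambda>\<gamma>. f \<gamma> + g \<gamma>) h = (\<lambda>\<gamma>. twisted_mult n f h \<gamma> + twisted_mult n g h \<gamma>)"
  by (auto simp: twisted_mult_def fun_eq_iff algebra_simps sum.distrib)

section \<open>Components of a graded commutative algebra\<close>

context graded_commutative_algebra
begin

lemma component_0 [simp]: "length \<gamma> = n \<Longrightarrow> 0 \<in> A \<gamma>"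
  using component_subspace[of \<gamma>] by (simp add: subspace_def)

lemma component_add: "length \<gamma> = n \<Longrightarrow> a \<in> A \<gamma> \<Longrightarrow> b \<in> A \<gamma> \<Longrightarrow> a + b \<in> A \<gamma>"
  using component_subspace[of \<gamma>] by (simp add: subspace_def)

lemma component_scaleR: "length \<gamma> = n \<Longrightarrow> a \<in> A \<gamma> \<Longrightarrow> c *\<^sub>R a \<in> A \<gamma>"
  using component_subspace[of \<gamma>] by (simp add: subspace_def)

lemma component_uminus: "length \<gamma> = n \<Longrightarrow> a \<in> A \<gamma> \<Longrightarrow> - a \<in> A \<gamma>"
  using component_scaleR[of \<gamma> a "-1"] by simp

lemma component_diff: "length \<gamma> = n \<Longrightarrow> a \<in> A \<gamma> \<Longrightarrow> b \<in> A \<gamma> \<Longrightarrow> a - b \<in> A \<gamma>"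
  using component_add[of \<gamma> a "-b"] component_uminus[of \<gamma> b] by simp

lemma component_sum: "length \<gamma> = n \<Longrightarrow> (\<And>i. i \<in> I \<Longrightarrow> f i \<in> A \<gamma>) \<Longrightarrow> sum f I \<in> A \<gamma>"
  by (induction I rule: infinite_finite_induct) (auto intro: component_add)

lemma component_mult: "length \<gamma> = n \<Longrightarrow> length \<delta> = n \<Longrightarrow> a \<in> A \<gamma> \<Longrightarrow> b \<in> A \<delta> \<Longrightarrow> a * b \<in> A (\<gamma> \<boxplus> \<delta>)"
  using mult_closed by simp

definition proj :: "'a \<Rightarrow> bit list \<Rightarrow> 'a" where
  "proj x = (THE f. (\<forall>\<gamma>\<in>set (lex_vectors n). f \<gamma> \<in> A \<gamma>) \<and>
          (\<forall>\<gamma>. \<gamma> \<notin> set (lex_vectors n) \<longrightarrow> f \<gamma> = 0) \<and> x = (\<Sum>\<gamma>\<in>set (lex_vectors n). f \<gamma>))"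

lemma proj_props:
  shows proj_component: "length \<gamma> = n \<Longrightarrow> proj x \<gamma> \<in> A \<gamma>"
    and proj_outside: "length \<gamma> \<noteq> n \<Longrightarrow> proj x \<gamma> = 0"
    and sum_proj: "(\<Sum>\<gamma> | length \<gamma> = n. proj x \<gamma>) = x"
  using theI'[OF direct_sum[of x], folded proj_def] by auto

lemma proj_eqI:
  assumes "\<And>\<gamma>. length \<gamma> = n \<Longrightarrow> f \<gamma> \<in> A \<gamma>" "(\<Sum>\<gamma> | length \<gamma> = n. f \<gamma>) = x" "length \<gamma> = n"
  shows "proj x \<gamma> = f \<gamma>"
proof -
  define g where "g = (\<lambda>\<gamma>. if length \<gamma> = n then f \<gamma> else 0)"
  have "(\<Sum>\<gamma> | length \<gamma> = n. g \<gamma>) = x"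
    unfolding assms(2)[symmetric] by (rule sum.cong) (auto simp: g_def)
  then have "proj x = g"
    using assms(1) unfolding proj_def
    by (intro the1_equality direct_sum) (auto simp: g_def)
  then show ?thesis using assms(3) by (simp add: g_def)
qed

lemma proj_concentrated:
  assumes "a \<in> A \<gamma>" "length \<gamma> = n" "length \<delta> = n"
  shows "proj a \<delta> = concentrated \<gamma> a \<delta>"
  using assms by (intro proj_eqI) (auto simp: concentrated_def)

lemma proj_add: "length \<gamma> = n \<Longrightarrow> proj (x + y) \<gamma> = proj x \<gamma> + proj y \<gamma>"
  by (rule proj_eqI) (simp_all add: sum.distrib sum_proj component_add proj_component)

lemma proj_0: "length \<gamma> = n \<Longrightarrow> proj 0 \<gamma> = 0"
  using proj_concentrated[of 0 \<gamma> \<gamma>] by (simp add: concentrated_def)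

lemma proj_sum: "length \<gamma> = n \<Longrightarrow> proj (sum f I) \<gamma> = (\<Sum>i\<in>I. proj (f i) \<gamma>)"
  by (induction I rule: infinite_finite_induct) (auto simp: proj_add proj_0)

text \<open>Left multiplication by a homogeneous element permutes the components, and the decomposition of a
product is unique.\<close>
lemma proj_mult_concentrated:
  assumes "a \<in> A \<gamma>" "length \<gamma> = n" "length \<delta> = n"
  shows "proj (a * x) (\<gamma> \<boxplus> \<delta>) = a * proj x \<delta>"
proof -
  have "proj (a * x) (\<gamma> \<boxplus> \<delta>) = a * proj x (\<gamma> \<boxplus> (\<gamma> \<boxplus> \<delta>))"
  proof (rule proj_eqI)
    show "a * proj x (\<gamma> \<boxplus> \<eta>) \<in> A \<eta>" if "length \<eta> = n" for \<eta>
      using component_mult[of \<gamma> "\<gamma> \<boxplus> \<eta>" a "proj x (\<gamma> \<boxplus> \<eta>)"] assms that by (simp add: proj_component)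
    have "(\<Sum>\<eta> | length \<eta> = n. a * proj x (\<gamma> \<boxplus> \<eta>)) = (\<Sum>\<eta> | length \<eta> = n. a * proj x \<eta>)"
      by (rule sum.reindex_bij_witness[of _ "\<lambda>\<eta>. \<gamma> \<boxplus> \<eta>" "\<lambda>\<eta>. \<gamma> \<boxplus> \<eta>"]) (use assms in auto)
    then show "(\<Sum>\<eta> | length \<eta> = n. a * proj x (\<gamma> \<boxplus> \<eta>)) = a * x"
      by (simp add: sum_proj flip: sum_distrib_left)
  qed (use assms in auto)
  then show ?thesis using assms by simp
qed

text \<open>The component of degree 0 of the unit is a right unit for all homogeneous elements, hence for 1
itself.\<close>
lemma one_component: "1 \<in> A (zvec n)"
proof -
  define e where "e = proj 1 (zvec n)"
  have *: "a * e = a" if "a \<in> A \<gamma>" "length \<gamma> = n" for a \<gamma>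
    using proj_mult_concentrated[OF that, of "zvec n" 1] that
    by (simp add: e_def proj_concentrated concentrated_def)
  have "1 * e = (\<Sum>\<gamma> | length \<gamma> = n. proj 1 \<gamma> * e)"
    by (simp add: sum_proj flip: sum_distrib_right)
  also have "\<dots> = (\<Sum>\<gamma> | length \<gamma> = n. proj 1 \<gamma>)"
    by (rule sum.cong) (simp_all add: *[OF proj_component])
  also have "\<dots> = 1"
    by (rule sum_proj)
  finally show ?thesis
    using proj_component[of "zvec n" 1] by (simp add: e_def)
qed

lemma even_part_0: "(\<lambda>_. 0) \<in> even_part n A"
  by (auto simp: even_part_def evens_length)

lemma even_part_one: "concentrated (zvec n) 1 \<in> even_part n A"
  by (auto simp: even_part_def concentrated_def one_component evens_length)

lemma even_part_add: "f \<in> even_part n A \<Longrightarrow> g \<in> even_part n A \<Longrightarrow> (\<lambda>\<gamma>. f \<gamma> + g \<gamma>) \<in> even_part n A"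
  unfolding even_part_def by (auto intro!: component_add simp: evens_length)

lemma even_part_uminus: "f \<in> even_part n A \<Longrightarrow> (\<lambda>\<gamma>. - f \<gamma>) \<in> even_part n A"
  unfolding even_part_def by (auto intro!: component_uminus simp: evens_length)

lemma even_part_twisted_mult:
  assumes "f \<in> even_part n A" "g \<in> even_part n A" 
  shows "twisted_mult n f g \<in> even_part n A"
proof -
  have "f \<delta> * g (\<delta> \<boxplus> \<gamma>) \<in> A \<gamma>" if "\<gamma> \<in> set (evens n)" "\<delta> \<in> set (evens n)" for \<gamma> \<delta>
    using component_mult[of \<delta> "\<delta> \<boxplus> \<gamma>" "f \<delta>" "g (\<delta> \<boxplus> \<gamma>)"] assms that evens_add[OF that(2,1)]
    by (auto simp: even_part_def evens_length split: if_splits)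
  then show ?thesis
    unfolding even_part_def twisted_mult_def
    by (auto intro!: component_sum component_scaleR simp: evens_length)
qed

text \<open>Exchanging the factors costs the sign of the graded commutation rule, which \<open>twist_commute\<close>
compensates.\<close>
lemma twisted_mult_commute:
  assumes f: "f \<in> even_part n A" and g: "g \<in> even_part n A" 
  shows "twisted_mult n f g = twisted_mult n g f"
proof
  fix \<gamma>
  let ?E = "set (evens n)"
  let ?s = "\<lambda>\<alpha> \<beta>. sgn_pow (twist \<alpha> \<beta>)"
  have "(\<Sum>\<delta>\<in>?E. ?s \<delta> (\<delta> \<boxplus> \<gamma>) *\<^sub>R (f \<delta> * g (\<delta> \<boxplus> \<gamma>))) = (\<Sum>\<delta>\<in>?E. ?s \<delta> (\<delta> \<boxplus> \<gamma>) *\<^sub>R (g \<delta> * f (\<delta> \<boxplus> \<gamma>)))"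
    if "\<gamma> \<in> ?E"
  proof (rule sum.reindex_bij_witness[of _ "\<lambda>\<delta>. \<gamma> \<boxplus> \<delta>" "\<lambda>\<delta>. \<gamma> \<boxplus> \<delta>"])
    fix \<delta> assume \<delta>: "\<delta> \<in> ?E"
    define \<eta> where "\<eta> = \<gamma> \<boxplus> \<delta>"
    have len: "length \<gamma> = n" "length \<delta> = n"
      using that \<delta> by (simp_all add: evens_length)
    have \<eta>: "\<eta> \<in> ?E" "\<delta> \<boxplus> \<gamma> = \<eta>"
      using that \<delta> by (simp_all add: \<eta>_def evens_add vec_add_commute)
    have \<eta>': "\<eta> \<boxplus> \<gamma> = \<delta>"
      using len by (simp add: \<eta>_def vec_add_commute[of _ \<gamma>])
    have A: "f \<delta> \<in> A \<delta>" "g \<eta> \<in> A \<eta>"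
      using f g \<delta> \<eta>(1) by (auto simp: even_part_def split: if_splits)
    have "g \<eta> * f \<delta> = sgn_pow (ip \<delta> \<eta>) *\<^sub>R (f \<delta> * g \<eta>)"
      by (rule graded_commute) (use A len \<open>\<eta> \<in> ?E\<close> in \<open>simp_all add: evens_length\<close>)
    moreover have "twist \<eta> \<delta> = twist \<delta> \<eta> + ip \<delta> \<eta>"
      using \<delta> \<eta>(1) twist_commute[of \<delta> \<eta>] by (simp add: set_evens)
    moreover have "?s \<eta> \<delta> * sgn_pow (ip \<delta> \<eta>) = ?s \<delta> \<eta>"
      unfolding calculation(2) sgn_pow_add by (cases "ip \<delta> \<eta>") (auto simp: sgn_pow_def)
    ultimately show "?s (\<gamma> \<boxplus> \<delta>) (\<gamma> \<boxplus> \<delta> \<boxplus> \<gamma>) *\<^sub>R (g (\<gamma> \<boxplus> \<delta>) * f (\<gamma> \<boxplus> \<delta> \<boxplus> \<gamma>)) = ?s \<delta> (\<delta> \<boxplus> \<gamma>) *\<^sub>R (f \<delta> * g (\<delta> \<boxplus> \<gamma>))"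
      by (simp add: \<eta> \<eta>' flip: \<eta>_def)
  qed (use that in \<open>simp_all add: evens_add evens_length\<close>)
  then show "twisted_mult n f g \<gamma> = twisted_mult n g f \<gamma>"
    by (simp add: twisted_mult_def)
qed

end

section \<open>A commutative ring of twisted even parts\<close>

text \<open>A commutative ring type containing the twisted even part of every graded commutative algebra: as a type cannot
depend on \<open>n\<close> and on the grading, it is the product of these rings over all gradings of \<open>'b\<close>. The
integer factor guarantees \<open>0 \<noteq> 1\<close> also if \<open>'b\<close> is the zero algebra.\<close>
typedef (overloaded) 'b twisted =
  "{x :: int \<times> (nat \<Rightarrow> (bit list \<Rightarrow> 'b::{real_algebra,monoid_mult} set) \<Rightarrow> bit list \<Rightarrow> 'b).
     \<forall>n B. if graded_commutative_algebra n B then snd x n B \<in> even_part n B else snd x n B = (\<lambda>_. 0)}"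
  by (rule exI[of _ "(0, \<lambda>_ _ _. 0)"]) (simp add: graded_commutative_algebra.even_part_0)

setup_lifting type_definition_twisted

lemma twisted_mult_zero [simp]: "twisted_mult n (\<lambda>_. 0) f = (\<lambda>_. 0)" "twisted_mult n f (\<lambda>_. 0) = (\<lambda>_. 0)"
  by (auto simp: twisted_mult_def)

lemma even_part_outside: "f \<in> even_part n B \<Longrightarrow> \<gamma> \<notin> set (evens n) \<Longrightarrow> f \<gamma> = 0"
  by (auto simp: even_part_def)

instantiation twisted :: ("{real_algebra,monoid_mult}") comm_ring_1
begin

lift_definition zero_twisted :: "'a twisted" is "(0, \<lambda>_ _ _. 0)"
  by (simp add: graded_commutative_algebra.even_part_0)

lift_definition one_twisted :: "'a twisted"
  is "(1, \<lambda>n B. if graded_commutative_algebra n B then concentrated (zvec n) 1 else (\<lambda>_. 0))"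
  by (simp add: graded_commutative_algebra.even_part_one)

lift_definition plus_twisted :: "'a twisted \<Rightarrow> 'a twisted \<Rightarrow> 'a twisted"
  is "\<lambda>x y. (fst x + fst y, \<lambda>n B \<gamma>. snd x n B \<gamma> + snd y n B \<gamma>)"
  by (auto simp: graded_commutative_algebra.even_part_add)

lift_definition uminus_twisted :: "'a twisted \<Rightarrow> 'a twisted"
  is "\<lambda>x. (- fst x, \<lambda>n B \<gamma>. - snd x n B \<gamma>)"
  by (auto simp: graded_commutative_algebra.even_part_uminus)

lift_definition times_twisted :: "'a twisted \<Rightarrow> 'a twisted \<Rightarrow> 'a twisted"
  is "\<lambda>x y. (fst x * fst y, \<lambda>n B. twisted_mult n (snd x n B) (snd y n B))"
  by (auto simp: graded_commutative_algebra.even_part_twisted_mult)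

definition minus_twisted :: "'a twisted \<Rightarrow> 'a twisted \<Rightarrow> 'a twisted"
  where "minus_twisted x y = x + (- y)"

instance
proof
  fix x y z :: "'a twisted"
  show "x + y + z = x + (y + z)" by transfer (simp add: add.assoc)
  show "x + y = y + x" by transfer (simp add: add.commute)
  show "0 + x = x" by transfer simp
  show "- x + x = 0" by transfer simp
  show "x - y = x + - y" by (simp add: minus_twisted_def)
  show "x * y * z = x * (y * z)" by transfer (simp add: twisted_mult_assoc mult.assoc)
  show "x * y = y * x"
  proof transfer
    fix x y :: "int \<times> (nat \<Rightarrow> (bit list \<Rightarrow> 'a set) \<Rightarrow> bit list \<Rightarrow> 'a)"
    assume *: "\<forall>n B. if graded_commutative_algebra n B then snd x n B \<in> even_part n B else snd x n B = (\<lambda>_. 0)"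
      "\<forall>n B. if graded_commutative_algebra n B then snd y n B \<in> even_part n B else snd y n B = (\<lambda>_. 0)"
    have "twisted_mult n (snd x n B) (snd y n B) = twisted_mult n (snd y n B) (snd x n B)" for n B
      using *[rule_format, of n B] graded_commutative_algebra.twisted_mult_commute[of n B "snd x n B" "snd y n B"]
      by (cases "graded_commutative_algebra n B") simp_all
    then show "(fst x * fst y, \<lambda>n B. twisted_mult n (snd x n B) (snd y n B)) =
        (fst y * fst x, \<lambda>n B. twisted_mult n (snd y n B) (snd x n B))"
      by (simp add: mult.commute)
  qed
  show "1 * x = x"
  proof transfer
    fix x :: "int \<times> (nat \<Rightarrow> (bit list \<Rightarrow> 'a set) \<Rightarrow> bit list \<Rightarrow> 'a)"
    assume *: "\<forall>n B. if graded_commutative_algebra n B then snd x n B \<in> even_part n B else snd x n B = (\<lambda>_. 0)"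
    have "twisted_mult n (if graded_commutative_algebra n B then concentrated (zvec n) 1 else (\<lambda>_. 0)) (snd x n B) = snd x n B" for n B
      using *[rule_format, of n B] twisted_mult_one_left[of n "snd x n B"] even_part_outside[of "snd x n B" n B]
      by (cases "graded_commutative_algebra n B") simp_all
    then show "(fst (1, \<lambda>n B. if graded_commutative_algebra n B then concentrated (zvec n) 1 else (\<lambda>_. 0)) * fst x,
         \<lambda>n B. twisted_mult n (snd (1, \<lambda>n B. if graded_commutative_algebra n B then concentrated (zvec n) 1 else (\<lambda>_. 0)) n B)
                   (snd x n B)) = x"
      by (simp add: prod_eq_iff)
  qed
  show "(x + y) * z = x * z + y * z" by transfer (simp add: twisted_mult_add_left algebra_simps)
  show "(0 :: 'a twisted) \<noteq> 1" by transfer simp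
qed

end

text \<open>The projection to the factor that belongs to the grading \<open>B\<close>.\<close>
lift_definition component_at :: "nat \<Rightarrow> (bit list \<Rightarrow> 'a set) \<Rightarrow> 'a::{real_algebra,monoid_mult} twisted \<Rightarrow> bit list \<Rightarrow> 'a"
  is "\<lambda>n B x. snd x n B" .

lemma component_at_0 [simp]: "component_at n B 0 = (\<lambda>_. 0)" by transfer simp
lemma component_at_add [simp]: "component_at n B (x + y) = (\<lambda>\<gamma>. component_at n B x \<gamma> + component_at n B y \<gamma>)" by transfer simp
lemma component_at_uminus [simp]: "component_at n B (- x) = (\<lambda>\<gamma>. - component_at n B x \<gamma>)" by transfer simp
lemma component_at_mult [simp]: "component_at n B (x * y) = twisted_mult n (component_at n B x) (component_at n B y)" by transfer simp

lemma component_at_sum [simp]: "component_at n B (sum f I) = (\<lambda>\<gamma>. \<Sum>i\<in>I. component_at n B (f i) \<gamma>)"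
  by (induction I rule: infinite_finite_induct) auto

context graded_commutative_algebra
begin

lemma component_at_one [simp]: "component_at n A 1 = concentrated (zvec n) 1"
  using graded_commutative_algebra_axioms by transfer simp

lemma ex_component_at_concentrated:
  assumes "\<gamma> \<in> set (evens n)" "b \<in> A \<gamma>"
  shows "\<exists>x. component_at n A x = concentrated \<gamma> b"
proof -
  have "concentrated \<gamma> b \<in> even_part n A"
    using assms by (auto simp: even_part_def concentrated_def evens_length)
  then show ?thesis
    using graded_commutative_algebra_axioms
    by (intro exI[of _ "Abs_twisted (0, \<lambda>m B. if m = n \<and> B = A then concentrated \<gamma> b else (\<lambda>_. 0))"])
      (auto simp: component_at.rep_eq Abs_twisted_inverse graded_commutative_algebra.even_part_0)
qed

end

section \<open>Matrices over possibly trivial rings, and triangular determinants\<close>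

lemma mult_mat_entry:
  assumes "M \<in> carrier_mat a m" "W \<in> carrier_mat m b" "i < a" "j < b"
  shows "(M * W) $$ (i, j) = (\<Sum>k<m. M $$ (i, k) * W $$ (k, j))"
  using assms by (auto simp: scalar_prod_def atLeast0LessThan)

lemma one_mult_mat_left:
  fixes M :: "'b::{real_algebra,monoid_mult} mat"
  assumes "M \<in> carrier_mat a b" 
  shows "1\<^sub>m a * M = M"
proof (rule eq_matI)
  fix i j assume ij: "i < dim_row M" "j < dim_col M"
  have "(1\<^sub>m a * M) $$ (i, j) = (\<Sum>k<a. (1\<^sub>m a $$ (i, k)) * M $$ (k, j))"
    using assms ij by (intro mult_mat_entry[of _ a a _ b]) auto
  also have "\<dots> = (\<Sum>k<a. if k = i then M $$ (i, j) else 0)"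
    using assms ij by (intro sum.cong) auto
  finally show "(1\<^sub>m a * M) $$ (i, j) = M $$ (i, j)" using assms ij by simp
qed (use assms in auto)

lemma one_mult_mat_right:
  fixes M :: "'b::{real_algebra,monoid_mult} mat"
  assumes "M \<in> carrier_mat a b" 
  shows "M * 1\<^sub>m b = M"
proof (rule eq_matI)
  fix i j assume ij: "i < dim_row M" "j < dim_col M"
  have "(M * 1\<^sub>m b) $$ (i, j) = (\<Sum>k<b. M $$ (i, k) * (1\<^sub>m b $$ (k, j)))"
    using assms ij by (intro mult_mat_entry[of _ a b _ b]) auto
  also have "\<dots> = (\<Sum>k<b. if k = j then M $$ (i, j) else 0)"
    using assms ij by (intro sum.cong) auto
  finally show "(M * 1\<^sub>m b) $$ (i, j) = M $$ (i, j)" using assms ij by simp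
qed (use assms in auto)

lemma det_block_lower_one:
  fixes S :: "'b::comm_ring_1 mat"
  assumes "S \<in> carrier_mat m m" "C \<in> carrier_mat k m"
  shows "det (four_block_mat S (0\<^sub>m m k) C (1\<^sub>m k)) = det S"
  using assms(2)
proof (induction k arbitrary: C)
  case 0
  then have "four_block_mat S (0\<^sub>m m 0) C (1\<^sub>m 0) = S"
    using assms(1) by (intro eq_matI) auto
  then show ?case by simp
next
  case (Suc k)
  let ?C' = "mat k m (\<lambda>(i, j). C $$ (i, j))"
  let ?c = "mat 1 (m + k) (\<lambda>(i, j). if j < m then C $$ (k, j) else 0)"
  have "four_block_mat S (0\<^sub>m m (Suc k)) C (1\<^sub>m (Suc k)) =
    four_block_mat (four_block_mat S (0\<^sub>m m k) ?C' (1\<^sub>m k)) (0\<^sub>m (m + k) 1) ?c (1\<^sub>m 1)"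
    using assms(1) Suc.prems by (intro eq_matI) (auto simp: less_Suc_eq, (subst index_one_mat index_zero_mat; simp)+)
  also have "det \<dots> = det (four_block_mat S (0\<^sub>m m k) ?C' (1\<^sub>m k)) * det (1\<^sub>m 1)"
    using assms(1) by (intro det_four_block_mat_upper_right_zero_col) auto
  also have "\<dots> = det S"
    using Suc.IH[of ?C'] by simp
  finally show ?case .
qed

lemma det_block_upper_one:
  fixes S :: "'b::comm_ring_1 mat"
  assumes "S \<in> carrier_mat m m" "B \<in> carrier_mat m k"
  shows "det (four_block_mat S B (0\<^sub>m k m) (1\<^sub>m k)) = det S"
proof -
  have "det (four_block_mat S B (0\<^sub>m k m) (1\<^sub>m k)) =
      det (transpose_mat (four_block_mat S B (0\<^sub>m k m) (1\<^sub>m k)))"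
    using assms by (intro det_transpose[symmetric, of _ "m + k"]) auto
  also have "\<dots> = det (four_block_mat (transpose_mat S) (0\<^sub>m m k) (transpose_mat B) (1\<^sub>m k))"
    using assms by (subst transpose_four_block_mat) auto
  also have "\<dots> = det S"
    using assms by (subst det_block_lower_one) (auto intro: det_transpose)
  finally show ?thesis .
qed

lemma det_block_one_upper:
  fixes D :: "'b::comm_ring_1 mat"
  assumes "D \<in> carrier_mat k k" "B \<in> carrier_mat m k"
  shows "det (four_block_mat (1\<^sub>m m) B (0\<^sub>m k m) D) = det D"
  using assms(2)
proof (induction m arbitrary: B)
  case 0
  then have "four_block_mat (1\<^sub>m 0) B (0\<^sub>m k 0) D = D"
    using assms(1) by (intro eq_matI) auto
  then show ?case by simp
next
  case (Suc m)
  let ?B' = "mat m k (\<lambda>(i, j). B $$ (Suc i, j))"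
  let ?b = "mat 1 (m + k) (\<lambda>(i, j). if j < m then 0 else B $$ (0, j - m))"
  have "four_block_mat (1\<^sub>m (Suc m)) B (0\<^sub>m k (Suc m)) D =
    four_block_mat (1\<^sub>m 1) ?b (0\<^sub>m (m + k) 1) (four_block_mat (1\<^sub>m m) ?B' (0\<^sub>m k m) D)"
    using assms(1) Suc.prems by (intro eq_matI) (auto simp: Suc_diff_Suc)
  also have "det \<dots> = det (1\<^sub>m 1) * det (four_block_mat (1\<^sub>m m) ?B' (0\<^sub>m k m) D)"
    using assms(1) by (intro det_four_block_mat_lower_left_zero_col) auto
  also have "\<dots> = det D"
    using Suc.IH[of ?B'] by simp
  finally show ?case .
qed

lemma det_block_one_lower:
  fixes D :: "'b::comm_ring_1 mat"
  assumes "D \<in> carrier_mat k k" "C \<in> carrier_mat k m"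
  shows "det (four_block_mat (1\<^sub>m m) (0\<^sub>m m k) C D) = det D"
proof -
  have "det (four_block_mat (1\<^sub>m m) (0\<^sub>m m k) C D) =
      det (transpose_mat (four_block_mat (1\<^sub>m m) (0\<^sub>m m k) C D))"
    using assms by (intro det_transpose[symmetric, of _ "m + k"]) auto
  also have "\<dots> = det (four_block_mat (1\<^sub>m m) (transpose_mat C) (0\<^sub>m k m) (transpose_mat D))"
    using assms by (subst transpose_four_block_mat) auto
  also have "\<dots> = det D"
    using assms by (subst det_block_one_upper) (auto intro: det_transpose)
  finally show ?thesis .
qed

section \<open>The twisted determinant\<close>

text \<open>A product of homogeneous elements of degrees \<open>w\<close> has degree \<open>vec_sum n w\<close>; the product in the
twisted ring differs from it by the sign with exponent \<open>word_twist n w\<close>.\<close>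
definition vec_sum :: "nat \<Rightarrow> bit list list \<Rightarrow> bit list" where
  "vec_sum n w = foldr (\<boxplus>) w (zvec n)"

primrec word_twist :: "nat \<Rightarrow> bit list list \<Rightarrow> bit" where
  "word_twist n [] = 0"
| "word_twist n (\<gamma> # w) = twist \<gamma> (vec_sum n w) + word_twist n w"

text \<open>The exponent of the sign attached to \<open>\<pi>\<close> in the signed Leibniz formula: the first sum comes from the signs
put on the matrix entries, the second from the twisted product of these entries.\<close>
definition perm_twist :: "nat \<Rightarrow> bit list list \<Rightarrow> (nat \<Rightarrow> nat) \<Rightarrow> bit" where
  "perm_twist n ds \<pi> =
     sum_list (map (\<lambda>i. twist (ds ! i \<boxplus> ds ! \<pi> i) (ds ! \<pi> i)) [0..<length ds]) +
     word_twist n (map (\<lambda>i. ds ! i \<boxplus> ds ! \<pi> i) [0..<length ds])"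

definition twisted_det :: "nat \<Rightarrow> bit list list \<Rightarrow> 'b::{real_algebra,monoid_mult} mat \<Rightarrow> 'b" where
  "twisted_det n ds Z = (\<Sum>\<pi> | \<pi> permutes {..<length ds}. (real_of_int (sign \<pi>) * sgn_pow (perm_twist n ds \<pi>)) *\<^sub>R
     prod_list (map (\<lambda>i. Z $$ (i, \<pi> i)) [0..<length ds]))"

lemma length_vec_sum: "(\<And>\<gamma>. \<gamma> \<in> set w \<Longrightarrow> length \<gamma> = n) \<Longrightarrow> length (vec_sum n w) = n"
  by (induction w) (auto simp: vec_sum_def)

lemma nth_vec_sum:
  "(\<And>\<gamma>. \<gamma> \<in> set w \<Longrightarrow> length \<gamma> = n) \<Longrightarrow> k < n \<Longrightarrow> vec_sum n w ! k = sum_list (map (\<lambda>\<gamma>. \<gamma> ! k) w)"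
proof (induction w)
  case (Cons \<gamma> w)
  have "length (vec_sum n w) = n" using Cons.prems by (intro length_vec_sum) auto
  then show ?case using Cons by (simp add: vec_sum_def)
qed (simp add: vec_sum_def)

lemma vec_sum_even: "(\<And>\<gamma>. \<gamma> \<in> set w \<Longrightarrow> \<gamma> \<in> set (evens n)) \<Longrightarrow> vec_sum n w \<in> set (evens n)"
proof (induction w)
  case Nil
  then show ?case using zvec_even[of n] by (simp add: vec_sum_def)
next
  case (Cons \<gamma> w)
  then show ?case using evens_add[of \<gamma> n "vec_sum n w"] by (simp add: vec_sum_def)
qed

text \<open>Every \<open>ds ! i\<close> occurs twice, as a row and as a column degree.\<close>
lemma vec_sum_permutation:
  assumes \<pi>: "\<pi> permutes {..<length ds}" and len: "\<And>\<gamma>. \<gamma> \<in> set ds \<Longrightarrow> length \<gamma> = n"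
  shows "vec_sum n (map (\<lambda>i. ds ! i \<boxplus> ds ! \<pi> i) [0..<length ds]) = zvec n"
proof -
  let ?w = "map (\<lambda>i. ds ! i \<boxplus> ds ! \<pi> i) [0..<length ds]"
  have bound: "\<pi> i < length ds" if "i < length ds" for i
    using permutes_in_image[OF \<pi>, of i] that by simp
  have lw: "length \<gamma> = n" if "\<gamma> \<in> set ?w" for \<gamma>
    using that bound len by auto
  have lsum: "length (vec_sum n ?w) = n"
    by (intro length_vec_sum lw)
  show ?thesis
  proof (rule nth_equalityI)
    show "length (vec_sum n ?w) = length (zvec n)" using lsum by simp
    fix k assume "k < length (vec_sum n ?w)"
    then have k: "k < n" using lsum by simp
    have "vec_sum n ?w ! k = sum_list (map (\<lambda>\<gamma>. \<gamma> ! k) ?w)"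
      using k by (intro nth_vec_sum lw)
    also have "\<dots> = (\<Sum>i<length ds. ds ! i ! k + ds ! \<pi> i ! k)"
      using k bound len by (simp add: interv_sum_list_conv_sum_set_nat atLeast0LessThan o_def)
    also have "\<dots> = (\<Sum>i<length ds. ds ! i ! k) + (\<Sum>i<length ds. ds ! \<pi> i ! k)"
      by (rule sum.distrib)
    also have "(\<Sum>i<length ds. ds ! \<pi> i ! k) = (\<Sum>i<length ds. ds ! i ! k)"
      using sum.permute[OF \<pi>, of "\<lambda>i. ds ! i ! k"] by (simp add: o_def)
    finally show "vec_sum n ?w ! k = zvec n ! k" using k by (simp add: bit_add_self)
  qed
qed

definition parity_list :: "nat \<Rightarrow> bit \<Rightarrow> bit list list \<Rightarrow> bool" where
  "parity_list n b ds \<longleftrightarrow> (\<forall>\<delta>\<in>set ds. length \<delta> = n \<and> sum_list \<delta> = b)"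

lemma parity_list_length: "parity_list n b ds \<Longrightarrow> i < length ds \<Longrightarrow> length (ds ! i) = n"
  by (auto simp: parity_list_def)

lemma parity_list_even:
  "parity_list n b ds \<Longrightarrow> parity_list n b es \<Longrightarrow> i < length ds \<Longrightarrow> j < length es \<Longrightarrow> ds ! i \<boxplus> es ! j \<in> set (evens n)"
  by (auto simp: parity_list_def set_evens sum_list_vec_add bit_add_self)

lemma parity_list_append [simp]: "parity_list n b (ds @ es) \<longleftrightarrow> parity_list n b ds \<and> parity_list n b es"
  by (auto simp: parity_list_def)

text \<open>Matrices of degree 0 with row degrees \<open>ds\<close> and column degrees \<open>es\<close>, one for each row and column rather than one for
each block. Keeping the two lists apart covers the off-diagonal blocks.\<close>
definition degree0 :: "(bit list \<Rightarrow> 'b set) \<Rightarrow> bit list list \<Rightarrow> bit list list \<Rightarrow> 'b mat set" where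
  "degree0 B ds es = {Z \<in> carrier_mat (length ds) (length es).
     \<forall>i<length ds. \<forall>j<length es. Z $$ (i, j) \<in> B (ds ! i \<boxplus> es ! j)}"

lemma degree0_carrier: "Z \<in> degree0 B ds es \<Longrightarrow> Z \<in> carrier_mat (length ds) (length es)"
  by (simp add: degree0_def)

lemma degree0_entry: "Z \<in> degree0 B ds es \<Longrightarrow> i < length ds \<Longrightarrow> j < length es \<Longrightarrow> Z $$ (i, j) \<in> B (ds ! i \<boxplus> es ! j)"
  by (simp add: degree0_def)

text \<open>\<open>M\<close> represents \<open>Z\<close> if it has the entries of \<open>Z\<close>, up to sign, as homogeneous elements of the twisted ring. The
sign is chosen so that products and unit matrices are respected. A relation is used instead of a function because
only one factor of the product ring \<open>'b twisted\<close> is prescribed.\<close>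
definition twist_rep :: "nat \<Rightarrow> (bit list \<Rightarrow> 'b::{real_algebra,monoid_mult} set) \<Rightarrow> bit list list \<Rightarrow> bit list list
    \<Rightarrow> 'b twisted mat \<Rightarrow> 'b mat \<Rightarrow> bool" where
  "twist_rep n B ds es M Z \<longleftrightarrow> M \<in> carrier_mat (length ds) (length es) \<and> Z \<in> carrier_mat (length ds) (length es) \<and>
     (\<forall>i<length ds. \<forall>j<length es. component_at n B (M $$ (i, j)) =
        concentrated (ds ! i \<boxplus> es ! j) (sgn_pow (twist (ds ! i \<boxplus> es ! j) (es ! j)) *\<^sub>R Z $$ (i, j)))"

lemma concentrated_0 [simp]: "concentrated \<gamma> 0 = (\<lambda>_. 0)"
  by (auto simp: concentrated_def)

lemma concentrated_sum: "(\<lambda>\<delta>. \<Sum>i\<in>I. concentrated \<gamma> (f i) \<delta>) = concentrated \<gamma> (sum f I)"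
  by (auto simp: concentrated_def)

text \<open>By bilinearity of \<open>twist\<close> the signs of two entries with a common index \<open>j\<close> and the sign of their
twisted product combine to a sign that no longer depends on \<open>j\<close>.\<close>
lemma twist_rep_mult:
  assumes par: "parity_list n b ds" "parity_list n b es" "parity_list n b fs"
    and M: "twist_rep n B ds es M Z" and M': "twist_rep n B es fs M' Z'"
  shows "twist_rep n B ds fs (M * M') (Z * Z')"
  unfolding twist_rep_def
proof (intro conjI allI impI)
  note carr = M[unfolded twist_rep_def] M'[unfolded twist_rep_def]
  show "M * M' \<in> carrier_mat (length ds) (length fs)" "Z * Z' \<in> carrier_mat (length ds) (length fs)"
    using carr by auto
  fix i k assume i: "i < length ds" and k: "k < length fs"
  have "component_at n B ((M * M') $$ (i, k)) =
      (\<lambda>\<gamma>. \<Sum>j<length es. twisted_mult n (component_at n B (M $$ (i, j))) (component_at n B (M' $$ (j, k))) \<gamma>)"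
    using carr i k by (simp add: mult_mat_entry[of M "length ds" "length es" M' "length fs"] del: index_mult_mat)
  also have "\<dots> = (\<lambda>\<gamma>. \<Sum>j<length es. concentrated (ds ! i \<boxplus> fs ! k)
      (sgn_pow (twist (ds ! i \<boxplus> fs ! k) (fs ! k)) *\<^sub>R (Z $$ (i, j) * Z' $$ (j, k))) \<gamma>)"
  proof (intro ext sum.cong refl)
    fix \<gamma> j assume "j \<in> {..<length es}"
    then have j: "j < length es" by simp
    let ?d = "ds ! i" and ?e = "es ! j" and ?f = "fs ! k"
    have len: "length ?d = n" "length ?e = n" "length ?f = n"
      using par i j k by (auto intro: parity_list_length)
    have "twist (?d \<boxplus> ?e) (?e \<boxplus> ?f) + (twist (?d \<boxplus> ?e) ?e + twist (?e \<boxplus> ?f) ?f) = twist (?d \<boxplus> ?f) ?f"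
      using len by (cases "twist ?d ?e"; cases "twist ?d ?f"; cases "twist ?e ?e"; cases "twist ?e ?f";
          simp add: twist_add_left twist_add_right)
    then have s: "sgn_pow (twist (?d \<boxplus> ?e) (?e \<boxplus> ?f)) * (sgn_pow (twist (?d \<boxplus> ?e) ?e) * sgn_pow (twist (?e \<boxplus> ?f) ?f)) =
        sgn_pow (twist (?d \<boxplus> ?f) ?f)"
      by (simp flip: sgn_pow_add)
    have "twisted_mult n (component_at n B (M $$ (i, j))) (component_at n B (M' $$ (j, k))) =
      twisted_mult n (concentrated (?d \<boxplus> ?e) (sgn_pow (twist (?d \<boxplus> ?e) ?e) *\<^sub>R Z $$ (i, j)))
        (concentrated (?e \<boxplus> ?f) (sgn_pow (twist (?e \<boxplus> ?f) ?f) *\<^sub>R Z' $$ (j, k)))"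
      using carr i j k by simp
    also have "\<dots> = concentrated ((?d \<boxplus> ?e) \<boxplus> (?e \<boxplus> ?f)) (sgn_pow (twist (?d \<boxplus> ?e) (?e \<boxplus> ?f)) *\<^sub>R
        (sgn_pow (twist (?d \<boxplus> ?e) ?e) *\<^sub>R Z $$ (i, j) * sgn_pow (twist (?e \<boxplus> ?f) ?f) *\<^sub>R Z' $$ (j, k)))"
      using par i j k by (intro twisted_mult_concentrated parity_list_even) auto
    also have "\<dots> = concentrated (?d \<boxplus> ?f) (sgn_pow (twist (?d \<boxplus> ?f) ?f) *\<^sub>R (Z $$ (i, j) * Z' $$ (j, k)))"
      using len s[symmetric] by (simp add: vec_add_cancel_middle mult_ac)
    finally show "twisted_mult n (component_at n B (M $$ (i, j))) (component_at n B (M' $$ (j, k))) \<gamma> =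
      concentrated (?d \<boxplus> ?f) (sgn_pow (twist (?d \<boxplus> ?f) ?f) *\<^sub>R (Z $$ (i, j) * Z' $$ (j, k))) \<gamma>" by simp
  qed
  also have "\<dots> = concentrated (ds ! i \<boxplus> fs ! k)
      (sgn_pow (twist (ds ! i \<boxplus> fs ! k) (fs ! k)) *\<^sub>R (Z * Z') $$ (i, k))"
    using carr i k
    by (simp add: concentrated_sum mult_mat_entry[of Z "length ds" "length es" Z' "length fs"] scaleR_sum_right
        del: index_mult_mat)
  finally show "component_at n B ((M * M') $$ (i, k)) = concentrated (ds ! i \<boxplus> fs ! k)
      (sgn_pow (twist (ds ! i \<boxplus> fs ! k) (fs ! k)) *\<^sub>R (Z * Z') $$ (i, k))" .
qed

lemma twist_rep_zero: "twist_rep n B ds es (0\<^sub>m (length ds) (length es)) (0\<^sub>m (length ds) (length es))"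
  by (auto simp: twist_rep_def)

lemma twist_rep_four_block:
  assumes "twist_rep n B ds ds' M11 Z11" "twist_rep n B ds es' M12 Z12"
    "twist_rep n B es ds' M21 Z21" "twist_rep n B es es' M22 Z22"
  shows "twist_rep n B (ds @ es) (ds' @ es') (four_block_mat M11 M12 M21 M22) (four_block_mat Z11 Z12 Z21 Z22)"
  using assms unfolding twist_rep_def by (auto simp: nth_append)

context graded_commutative_algebra
begin

lemma twist_rep_one:
  assumes "parity_list n b ds"
  shows "twist_rep n A ds ds (1\<^sub>m (length ds)) (1\<^sub>m (length ds))"
proof -
  have "twist_rep n A ds ds (1\<^sub>m (length ds)) (1\<^sub>m (length ds)) \<longleftrightarrow>
    (\<forall>i<length ds. concentrated (zvec n) (1::'a) = concentrated (ds ! i \<boxplus> ds ! i) (sgn_pow (twist (ds ! i \<boxplus> ds ! i) (ds ! i)) *\<^sub>R 1))"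
    unfolding twist_rep_def by (auto simp: all_conj_distrib)
  also have \<dots>
    using assms by (auto simp: vec_add_self[OF parity_list_length])
  finally show ?thesis .
qed

lemma ex_twist_rep:
  assumes par: "parity_list n b ds" "parity_list n b es" and Z: "Z \<in> degree0 A ds es"
  obtains M where "twist_rep n A ds es M Z"
proof -
  let ?z = "\<lambda>i j. concentrated (ds ! i \<boxplus> es ! j) (sgn_pow (twist (ds ! i \<boxplus> es ! j) (es ! j)) *\<^sub>R Z $$ (i, j))"
  have "\<exists>x. component_at n A x = ?z i j" if "i < length ds" "j < length es" for i j
    using parity_list_even[OF par that] degree0_entry[OF Z that]
    by (intro ex_component_at_concentrated component_scaleR evens_length)
  then have "\<forall>i j. \<exists>x. i < length ds \<longrightarrow> j < length es \<longrightarrow> component_at n A x = ?z i j"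
    by blast
  then obtain f where f: "\<And>i j. i < length ds \<Longrightarrow> j < length es \<Longrightarrow> component_at n A (f i j) = ?z i j"
    by metis
  have "twist_rep n A ds es (mat (length ds) (length es) (\<lambda>(i, j). f i j)) Z"
    using Z f by (auto simp: twist_rep_def degree0_def)
  then show thesis by (rule that)
qed

lemma component_at_prod_list:
  assumes "\<And>i. i \<in> set js \<Longrightarrow> \<gamma> i \<in> set (evens n)"
    and "\<And>i. i \<in> set js \<Longrightarrow> component_at n A (x i) = concentrated (\<gamma> i) (sgn_pow (t i) *\<^sub>R z i)"
  shows "component_at n A (prod_list (map x js)) = concentrated (vec_sum n (map \<gamma> js))
    (sgn_pow (sum_list (map t js) + word_twist n (map \<gamma> js)) *\<^sub>R prod_list (map z js))"
  using assms
proof (induction js)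
  case Nil
  then show ?case by (simp add: vec_sum_def)
next
  case (Cons i js)
  let ?v = "vec_sum n (map \<gamma> js)"
  have v: "?v \<in> set (evens n)" "\<gamma> i \<in> set (evens n)"
    using Cons.prems by (auto intro!: vec_sum_even)
  have "component_at n A (prod_list (map x (i # js))) = twisted_mult n (concentrated (\<gamma> i) (sgn_pow (t i) *\<^sub>R z i))
     (concentrated ?v (sgn_pow (sum_list (map t js) + word_twist n (map \<gamma> js)) *\<^sub>R prod_list (map z js)))"
    using Cons by simp
  also have "\<dots> = concentrated (\<gamma> i \<boxplus> ?v) ((sgn_pow (twist (\<gamma> i) ?v) * sgn_pow (t i) *
      sgn_pow (sum_list (map t js) + word_twist n (map \<gamma> js))) *\<^sub>R (z i * prod_list (map z js)))"
    by (subst twisted_mult_concentrated) (use v in \<open>simp_all add: mult_ac\<close>)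
  also have "sgn_pow (twist (\<gamma> i) ?v) * sgn_pow (t i) * sgn_pow (sum_list (map t js) + word_twist n (map \<gamma> js)) =
      sgn_pow (sum_list (map t (i # js)) + word_twist n (map \<gamma> (i # js)))"
    by (simp only: list.map sum_list.Cons word_twist.simps sgn_pow_add mult_ac)
  finally show ?case by (simp add: vec_sum_def)
qed

text \<open>Each term of the Leibniz formula has degree 0 by \<open>vec_sum_permutation\<close>.\<close>
lemma component_at_det:
  assumes par: "parity_list n b ds" and rep: "twist_rep n A ds ds M Z"
  shows "component_at n A (det M) = concentrated (zvec n) (twisted_det n ds Z)"
proof -
  let ?N = "length ds"
  have "component_at n A (of_int (sign \<pi>) * (\<Prod>i = 0..<?N. M $$ (i, \<pi> i))) =
    concentrated (zvec n) ((real_of_int (sign \<pi>) * sgn_pow (perm_twist n ds \<pi>)) *\<^sub>R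
     prod_list (map (\<lambda>i. Z $$ (i, \<pi> i)) [0..<?N]))" if \<pi>: "\<pi> permutes {..<?N}" for \<pi>
  proof -
    have bound: "\<pi> i < ?N" if "i < ?N" for i
      using permutes_in_image[OF \<pi>, of i] that by simp
    have "(\<Prod>i = 0..<?N. M $$ (i, \<pi> i)) = prod_list (map (\<lambda>i. M $$ (i, \<pi> i)) [0..<?N])"
      using prod.distinct_set_conv_list[of "[0..<?N]" "\<lambda>i. M $$ (i, \<pi> i)"] by simp
    also have "component_at n A \<dots> = concentrated (vec_sum n (map (\<lambda>i. ds ! i \<boxplus> ds ! \<pi> i) [0..<?N]))
      (sgn_pow (perm_twist n ds \<pi>) *\<^sub>R prod_list (map (\<lambda>i. Z $$ (i, \<pi> i)) [0..<?N]))"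
      unfolding perm_twist_def
      using rep bound par by (intro component_at_prod_list) (auto simp: twist_rep_def intro: parity_list_even)
    also have "vec_sum n (map (\<lambda>i. ds ! i \<boxplus> ds ! \<pi> i) [0..<?N]) = zvec n"
      using par by (intro vec_sum_permutation[OF \<pi>]) (auto simp: parity_list_def)
    finally have *: "component_at n A (\<Prod>i = 0..<?N. M $$ (i, \<pi> i)) = concentrated (zvec n)
      (sgn_pow (perm_twist n ds \<pi>) *\<^sub>R prod_list (map (\<lambda>i. Z $$ (i, \<pi> i)) [0..<?N]))" .
    have "sign \<pi> = 1 \<or> sign \<pi> = -1" by (simp add: sign_def)
    then show ?thesis
      using * by (elim disjE) (auto simp: concentrated_def fun_eq_iff simp del: component_at_mult)
  qed
  then show ?thesis
    using rep unfolding twisted_det_def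
    by (simp add: det_def'[of M ?N] twist_rep_def concentrated_sum[symmetric] atLeast0LessThan del: component_at_mult)
qed

lemma twisted_det_eq_component_at: "parity_list n b ds \<Longrightarrow> twist_rep n A ds ds M Z \<Longrightarrow> twisted_det n ds Z = component_at n A (det M) (zvec n)"
  by (simp add: component_at_det concentrated_def)

lemma twisted_det_mult:
  assumes par: "parity_list n b ds" and Z: "Z \<in> degree0 A ds ds" and W: "W \<in> degree0 A ds ds"
  shows "twisted_det n ds (Z * W) = twisted_det n ds Z * twisted_det n ds W"
proof -
  obtain M where M: "twist_rep n A ds ds M Z" by (rule ex_twist_rep[OF par par Z])
  obtain M' where M': "twist_rep n A ds ds M' W" by (rule ex_twist_rep[OF par par W])
  have "det (M * M') = det M * det M'"
    using M M' by (intro det_mult[of _ "length ds"]) (auto simp: twist_rep_def)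
  then have "twisted_det n ds (Z * W) = twisted_mult n (component_at n A (det M)) (component_at n A (det M')) (zvec n)"
    using twisted_det_eq_component_at[OF par twist_rep_mult[OF par par par M M']] by simp
  also have "\<dots> = twisted_det n ds Z * twisted_det n ds W"
    using twisted_mult_concentrated[OF zvec_even zvec_even, of n "twisted_det n ds Z" "twisted_det n ds W"]
    by (simp add: component_at_det[OF par M] component_at_det[OF par M'] concentrated_def)
  finally show ?thesis .
qed

lemma twisted_det_block_upper_one:
  assumes par: "parity_list n b ds" "parity_list n b es"
    and S: "S \<in> degree0 A ds ds" and P: "P \<in> degree0 A ds es"
  shows "twisted_det n (ds @ es) (four_block_mat S P (0\<^sub>m (length es) (length ds)) (1\<^sub>m (length es))) = twisted_det n ds S"
proof -
  obtain M where M: "twist_rep n A ds ds M S" by (rule ex_twist_rep[OF par(1,1) S])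
  obtain M' where M': "twist_rep n A ds es M' P" by (rule ex_twist_rep[OF par P])
  have "det (four_block_mat M M' (0\<^sub>m (length es) (length ds)) (1\<^sub>m (length es))) = det M"
    using M M' by (intro det_block_upper_one) (auto simp: twist_rep_def)
  then show ?thesis
    using twisted_det_eq_component_at[OF _ twist_rep_four_block[OF M M' twist_rep_zero twist_rep_one[OF par(2)]], of b]
      twisted_det_eq_component_at[OF par(1) M] par by simp
qed

lemma twisted_det_block_one_lower:
  assumes par: "parity_list n b ds" "parity_list n b es"
    and C: "C \<in> degree0 A es ds" and D: "D \<in> degree0 A es es"
  shows "twisted_det n (ds @ es) (four_block_mat (1\<^sub>m (length ds)) (0\<^sub>m (length ds) (length es)) C D) = twisted_det n es D"
proof -
  obtain M where M: "twist_rep n A es ds M C" by (rule ex_twist_rep[OF par(2,1) C])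
  obtain M' where M': "twist_rep n A es es M' D" by (rule ex_twist_rep[OF par(2,2) D])
  have "det (four_block_mat (1\<^sub>m (length ds)) (0\<^sub>m (length ds) (length es)) M M') = det M'"
    using M M' by (intro det_block_one_lower) (auto simp: twist_rep_def)
  then show ?thesis
    using twisted_det_eq_component_at[OF _ twist_rep_four_block[OF twist_rep_one[OF par(1)] twist_rep_zero M M'], of b]
      twisted_det_eq_component_at[OF par(2) M'] par by simp
qed

end

section \<open>Matrices of degree zero\<close>

definition index_degrees :: "bit list list \<Rightarrow> nat list \<Rightarrow> bit list list" where
  "index_degrees \<delta>s s = concat (map2 (\<lambda>\<delta> m. replicate m \<delta>) \<delta>s s)"

lemma index_degrees_simps [simp]:
  "index_degrees [] s = []"
  "index_degrees \<delta>s [] = []"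
  "index_degrees (\<delta> # \<delta>s) (m # s) = replicate m \<delta> @ index_degrees \<delta>s s"
  by (simp_all add: index_degrees_def)

lemma length_index_degrees: "length \<delta>s = length s \<Longrightarrow> length (index_degrees \<delta>s s) = sum_list s"
  by (induction \<delta>s s rule: list_induct2) auto

lemma index_degrees_append: "length \<delta>s = length s \<Longrightarrow>
    index_degrees (\<delta>s @ \<delta>s') (s @ s') = index_degrees \<delta>s s @ index_degrees \<delta>s' s'"
  by (induction \<delta>s s rule: list_induct2) auto

lemma set_index_degrees: "set (index_degrees \<delta>s s) \<subseteq> set \<delta>s"
  by (auto simp: index_degrees_def set_zip)

lemma nth_index_degrees:
  "length \<delta>s = length s \<Longrightarrow> k < length s \<Longrightarrow> i < s ! k \<Longrightarrow> index_degrees \<delta>s s ! (sum_list (take k s) + i) = \<delta>s ! k"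
proof (induction \<delta>s s arbitrary: k rule: list_induct2)
  case (Cons \<delta> \<delta>s m s)
  then show ?case by (cases k) (auto simp: nth_append)
qed simp

lemma block_index_bound:
  "k < length s \<Longrightarrow> i < s ! k \<Longrightarrow> sum_list (take k s) + i < sum_list (s :: nat list)"
proof (induction s arbitrary: k)
  case (Cons m s)
  then show ?case by (cases k) auto
qed simp

lemma ex_block_index:
  "x < sum_list (s :: nat list) \<Longrightarrow> \<exists>k i. k < length s \<and> i < s ! k \<and> x = sum_list (take k s) + i"
proof (induction s arbitrary: x)
  case (Cons m s)
  show ?case
  proof (cases "x < m")
    case True
    then show ?thesis by (intro exI[of _ 0] exI[of _ x]) simp
  next
    case False
    with Cons.prems have "x - m < sum_list s" by simp
    from Cons.IH[OF this] obtain k i where "k < length s" "i < s ! k" "x - m = sum_list (take k s) + i"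
      by blast
    with False show ?thesis by (intro exI[of _ "Suc k"] exI[of _ i]) simp
  qed
qed simp

lemma sum_lessThan_add:
  "(\<Sum>x<m + k. f x) = (\<Sum>x<m. f x) + (\<Sum>x<k. f (m + x) :: 'b::comm_monoid_add)" for m k :: nat
  by (induction k) (simp_all add: add.assoc)

lemma sum_block_index:
  "(\<Sum>k<length s. \<Sum>i<s ! k. f (sum_list (take k s) + i)) = (\<Sum>x<sum_list (s :: nat list). f x :: 'b::comm_monoid_add)"
proof (induction s arbitrary: f)
  case (Cons m s)
  have "(\<Sum>k<length (m # s). \<Sum>i<(m # s) ! k. f (sum_list (take k (m # s)) + i)) =
    (\<Sum>i<m. f i) + (\<Sum>k<length s. \<Sum>i<s ! k. f (m + (sum_list (take k s) + i)))"
    unfolding length_Cons sum.lessThan_Suc_shift by (simp add: add.assoc)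
  also have "\<dots> = (\<Sum>i<m. f i) + (\<Sum>x<sum_list s. f (m + x))"
    using Cons.IH[of "\<lambda>x. f (m + x)"] by simp
  also have "\<dots> = (\<Sum>x<m + sum_list s. f x)"
    by (rule sum_lessThan_add[symmetric])
  finally show ?case by simp
qed simp

lemma graded_matrices_eq_degree0:
  assumes "length \<delta>s = length s"
  shows "graded_matrices B \<delta>s s = degree0 B (index_degrees \<delta>s s) (index_degrees \<delta>s s)"
proof -
  let ?ds = "index_degrees \<delta>s s"
  have "(\<forall>k<length s. \<forall>u<length s. elements_mat (block s Z k u) \<subseteq> B (\<delta>s ! k \<boxplus> \<delta>s ! u)) \<longleftrightarrow>
    (\<forall>x<length ?ds. \<forall>y<length ?ds. Z $$ (x, y) \<in> B (?ds ! x \<boxplus> ?ds ! y))" (is "?L \<longleftrightarrow> ?R") for Z :: "'a mat"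
  proof
    assume L: ?L
    show ?R
    proof (intro allI impI)
      fix x y assume "x < length ?ds" "y < length ?ds"
      then obtain k i u j where *: "k < length s" "i < s ! k" "x = sum_list (take k s) + i"
        "u < length s" "j < s ! u" "y = sum_list (take u s) + j"
        using ex_block_index[of x s] ex_block_index[of y s] assms by (auto simp: length_index_degrees)
      have "Z $$ (x, y) = block s Z k u $$ (i, j)"
        using * by (simp add: block_def)
      also have "\<dots> \<in> elements_mat (block s Z k u)"
        using * by (intro elements_matI[of _ "s ! k" "s ! u"]) (auto simp: block_def)
      finally show "Z $$ (x, y) \<in> B (?ds ! x \<boxplus> ?ds ! y)"
        using L * assms by (auto simp: nth_index_degrees)
    qed
  next
    assume R: ?R
    show ?L
    proof (intro allI impI subsetI)
      fix k u z assume ku: "k < length s" "u < length s" and "z \<in> elements_mat (block s Z k u)"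
      then obtain i j where ij: "i < s ! k" "j < s ! u" "z = block s Z k u $$ (i, j)"
        by (auto simp: elements_mat_def block_def)
      show "z \<in> B (\<delta>s ! k \<boxplus> \<delta>s ! u)"
        using R[rule_format, of "sum_list (take k s) + i" "sum_list (take u s) + j"] ku ij assms
        by (simp add: block_def nth_index_degrees length_index_degrees block_index_bound)
    qed
  qed
  then show ?thesis
    using assms unfolding graded_matrices_def degree0_def by (simp add: length_index_degrees)
qed

lemma degree0_four_block_iff:
  assumes "Z11 \<in> carrier_mat (length ds) (length ds')" "Z12 \<in> carrier_mat (length ds) (length es')"
    "Z21 \<in> carrier_mat (length es) (length ds')" "Z22 \<in> carrier_mat (length es) (length es')"
  shows "four_block_mat Z11 Z12 Z21 Z22 \<in> degree0 B (ds @ es) (ds' @ es') \<longleftrightarrow>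
    Z11 \<in> degree0 B ds ds' \<and> Z12 \<in> degree0 B ds es' \<and> Z21 \<in> degree0 B es ds' \<and> Z22 \<in> degree0 B es es'"
    (is "?L \<longleftrightarrow> ?R")
proof
  assume L: ?L
  have *: "four_block_mat Z11 Z12 Z21 Z22 $$ (i, j) \<in> B ((ds @ es) ! i \<boxplus> (ds' @ es') ! j)"
    if "i < length ds + length es" "j < length ds' + length es'" for i j
    using degree0_entry[OF L] that by simp
  have "Z11 $$ (i, j) \<in> B (ds ! i \<boxplus> ds' ! j)" if "i < length ds" "j < length ds'" for i j
    using *[of i j] that assms by (simp add: nth_append)
  moreover have "Z12 $$ (i, j) \<in> B (ds ! i \<boxplus> es' ! j)" if "i < length ds" "j < length es'" for i j
    using *[of i "length ds' + j"] that assms by (simp add: nth_append)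
  moreover have "Z21 $$ (i, j) \<in> B (es ! i \<boxplus> ds' ! j)" if "i < length es" "j < length ds'" for i j
    using *[of "length ds + i" j] that assms by (simp add: nth_append)
  moreover have "Z22 $$ (i, j) \<in> B (es ! i \<boxplus> es' ! j)" if "i < length es" "j < length es'" for i j
    using *[of "length ds + i" "length ds' + j"] that assms by (simp add: nth_append)
  ultimately show ?R using assms by (simp add: degree0_def)
next
  assume ?R
  then show ?L unfolding degree0_def by (auto simp: nth_append)
qed

lemma is_mat_inverse_unique:
  assumes "is_mat_inverse Z W" "is_mat_inverse Z W'" "Z \<in> carrier_mat N N"
  shows "W = W'"
proof -
  have c: "W \<in> carrier_mat N N" "W' \<in> carrier_mat N N" "Z * W' = 1\<^sub>m N" "W * Z = 1\<^sub>m N"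
    using assms by (auto simp: is_mat_inverse_def)
  have "W = W * (Z * W')" using c by (simp add: one_mult_mat_right)
  also have "\<dots> = W * Z * W'" using assoc_mult_mat[OF c(1) assms(3) c(2)] by simp
  also have "\<dots> = W'" using c by (simp add: one_mult_mat_left)
  finally show ?thesis .
qed

lemma mat_inverse_eqI:
  assumes "is_mat_inverse Z W" "Z \<in> carrier_mat N N"
  shows "Defs.mat_inverse Z = W"
  unfolding Defs.mat_inverse_def using assms by (intro the_equality) (auto intro: is_mat_inverse_unique)

definition vectors :: "nat \<Rightarrow> bit list list \<Rightarrow> bool" where
  "vectors n ds \<longleftrightarrow> (\<forall>\<delta>\<in>set ds. length \<delta> = n)"

lemma vectors_nth: "vectors n ds \<Longrightarrow> i < length ds \<Longrightarrow> length (ds ! i) = n"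
  by (simp add: vectors_def)

lemma parity_list_vectors: "parity_list n b ds \<Longrightarrow> vectors n ds"
  by (simp add: vectors_def parity_list_def)

lemma vectors_append [simp]: "vectors n (ds @ es) \<longleftrightarrow> vectors n ds \<and> vectors n es"
  by (auto simp: vectors_def)

context graded_commutative_algebra
begin

lemma component_mult_middle:
  "length \<gamma> = n \<Longrightarrow> length \<delta> = n \<Longrightarrow> length \<eta> = n \<Longrightarrow> a \<in> A (\<gamma> \<boxplus> \<delta>) \<Longrightarrow> b \<in> A (\<delta> \<boxplus> \<eta>) \<Longrightarrow> a * b \<in> A (\<gamma> \<boxplus> \<eta>)"
  using component_mult[of "\<gamma> \<boxplus> \<delta>" "\<delta> \<boxplus> \<eta>" a b] by (simp add: vec_add_cancel_middle)

lemma degree0_mult: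
  assumes "vectors n ds" "vectors n es" "vectors n fs" and Z: "Z \<in> degree0 A ds es" and W: "W \<in> degree0 A es fs"
  shows "Z * W \<in> degree0 A ds fs"
proof -
  note c = degree0_carrier[OF Z] degree0_carrier[OF W]
  have "(Z * W) $$ (i, j) \<in> A (ds ! i \<boxplus> fs ! j)" if "i < length ds" "j < length fs" for i j
    unfolding mult_mat_entry[OF c that]
  proof (rule component_sum)
    fix k assume "k \<in> {..<length es}"
    then show "Z $$ (i, k) * W $$ (k, j) \<in> A (ds ! i \<boxplus> fs ! j)"
      using assms that by (intro component_mult_middle[of "ds ! i" "es ! k"] degree0_entry[OF Z] degree0_entry[OF W])
        (auto simp: vectors_nth)
  qed (use assms that in \<open>simp add: vectors_nth\<close>)
  then show ?thesis using c by (auto simp: degree0_def)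
qed

lemma degree0_diff:
  assumes "vectors n ds" "vectors n es" "Z \<in> degree0 A ds es" "W \<in> degree0 A ds es"
  shows "Z - W \<in> degree0 A ds es"
  using assms unfolding degree0_def by (auto intro!: component_diff simp: vectors_nth)

lemma degree0_add:
  assumes "vectors n ds" "vectors n es" "Z \<in> degree0 A ds es" "W \<in> degree0 A ds es"
  shows "Z + W \<in> degree0 A ds es"
  using assms unfolding degree0_def by (auto intro!: component_add simp: vectors_nth)

lemma degree0_zero: "vectors n ds \<Longrightarrow> vectors n es \<Longrightarrow> 0\<^sub>m (length ds) (length es) \<in> degree0 A ds es"
  unfolding degree0_def by (auto simp: vectors_nth)

lemma degree0_one: "vectors n ds \<Longrightarrow> 1\<^sub>m (length ds) \<in> degree0 A ds ds"
  unfolding degree0_def by (auto simp: vectors_nth vec_add_self one_component)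

text \<open>Taking the component of the appropriate degree of each entry of \<open>W\<close> gives another right inverse of
\<open>Z\<close>, which must be \<open>W\<close>.\<close>
lemma degree0_inverse:
  assumes vs: "vectors n ds" and Z: "Z \<in> degree0 A ds ds" and W: "is_mat_inverse Z W"
  shows "W \<in> degree0 A ds ds"
proof -
  let ?N = "length ds"
  have cZ: "Z \<in> carrier_mat ?N ?N" using degree0_carrier[OF Z] .
  then have cW: "W \<in> carrier_mat ?N ?N" and ZW: "Z * W = 1\<^sub>m ?N" and WZ: "W * Z = 1\<^sub>m ?N"
    using W by (auto simp: is_mat_inverse_def)
  \<comment> \<open>the part of \<open>W\<close> that is a matrix of degree 0\<close>
  define W' where "W' = mat ?N ?N (\<lambda>(i, j). proj (W $$ (i, j)) (ds ! i \<boxplus> ds ! j))"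
  have cW': "W' \<in> carrier_mat ?N ?N" by (simp add: W'_def)
  have "Z * W' = 1\<^sub>m ?N"
  proof (rule eq_matI)
    fix i j assume "i < dim_row (1\<^sub>m ?N :: 'a mat)" "j < dim_col (1\<^sub>m ?N :: 'a mat)"
    then have ij: "i < ?N" "j < ?N" by simp_all
    have "(Z * W') $$ (i, j) = (\<Sum>k<?N. proj (Z $$ (i, k) * W $$ (k, j)) (ds ! i \<boxplus> ds ! j))"
      unfolding mult_mat_entry[OF cZ cW' ij]
    proof (rule sum.cong)
      fix k assume "k \<in> {..<?N}"
      then show "Z $$ (i, k) * W' $$ (k, j) = proj (Z $$ (i, k) * W $$ (k, j)) (ds ! i \<boxplus> ds ! j)"
        using proj_mult_concentrated[of "Z $$ (i, k)" "ds ! i \<boxplus> ds ! k" "ds ! k \<boxplus> ds ! j" "W $$ (k, j)"]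
          degree0_entry[OF Z, of i k] vs ij
        by (simp add: W'_def vectors_nth vec_add_cancel_middle)
    qed simp
    also have "\<dots> = proj ((Z * W) $$ (i, j)) (ds ! i \<boxplus> ds ! j)"
      unfolding mult_mat_entry[OF cZ cW ij] using vs ij by (intro proj_sum[symmetric]) (simp add: vectors_nth)
    also have "\<dots> = (1\<^sub>m ?N :: 'a mat) $$ (i, j)"
      unfolding ZW using ij vs one_component
      by (auto simp: proj_0 vectors_nth vec_add_self proj_concentrated[of _ "zvec n"] concentrated_def)
    finally show "(Z * W') $$ (i, j) = (1\<^sub>m ?N :: 'a mat) $$ (i, j)" .
  qed (use cZ cW' in auto)
  then have "W = W * (Z * W')" using cW by (simp add: one_mult_mat_right)
  also have "\<dots> = W * Z * W'" using assoc_mult_mat[OF cW cZ cW'] by simp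
  also have "\<dots> = W'" using cW' by (simp add: one_mult_mat_left WZ)
  finally have "W = W'" .
  moreover have "W' \<in> degree0 A ds ds"
    using vs by (auto simp: degree0_def W'_def vectors_nth intro!: proj_component)
  ultimately show ?thesis by simp
qed

text \<open>With \<open>S\<close> the Schur complement, the matrix is the product of the block triangular matrices
with rows \<open>(S, Z12 W)\<close>, \<open>(0, 1)\<close> and \<open>(1, 0)\<close>, \<open>(Z21, Z22)\<close>.\<close>
lemma twisted_det_schur:
  assumes par: "parity_list n b ds" "parity_list n b es"
    and Z: "Z11 \<in> degree0 A ds ds" "Z12 \<in> degree0 A ds es" "Z21 \<in> degree0 A es ds" "Z22 \<in> degree0 A es es"
    and W: "is_mat_inverse Z22 W"
  shows "twisted_det n (ds @ es) (four_block_mat Z11 Z12 Z21 Z22) = twisted_det n ds (Z11 - Z12 * W * Z21) * twisted_det n es Z22"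
proof -
  let ?p = "length ds" and ?q = "length es"
  let ?S = "Z11 - Z12 * W * Z21"
  note vs = par[THEN parity_list_vectors]
  have W0: "W \<in> degree0 A es es" using degree0_inverse[OF vs(2) Z(4) W] .
  have P: "Z12 * W \<in> degree0 A ds es" using degree0_mult[OF vs vs(2) Z(2) W0] .
  have PZ: "Z12 * W * Z21 \<in> degree0 A ds ds" using degree0_mult[OF vs(1) vs(2) vs(1) P Z(3)] .
  have S: "?S \<in> degree0 A ds ds" using degree0_diff[OF vs(1) vs(1) Z(1) PZ] .
  note c = Z[THEN degree0_carrier] W0[THEN degree0_carrier] P[THEN degree0_carrier] S[THEN degree0_carrier] PZ[THEN degree0_carrier]
  have WZ: "W * Z22 = 1\<^sub>m ?q" using W c by (simp add: is_mat_inverse_def)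
  have "four_block_mat ?S (Z12 * W) (0\<^sub>m ?q ?p) (1\<^sub>m ?q) * four_block_mat (1\<^sub>m ?p) (0\<^sub>m ?p ?q) Z21 Z22 =
    four_block_mat (?S * 1\<^sub>m ?p + Z12 * W * Z21) (?S * 0\<^sub>m ?p ?q + Z12 * W * Z22)
      (0\<^sub>m ?q ?p * 1\<^sub>m ?p + 1\<^sub>m ?q * Z21) (0\<^sub>m ?q ?p * 0\<^sub>m ?p ?q + 1\<^sub>m ?q * Z22)"
    using c by (intro mult_four_block_mat) auto
  also have "Z12 * W * Z22 = Z12"
    using assoc_mult_mat[OF c(2) c(5) c(4)] c WZ by (simp add: one_mult_mat_right)
  also have "?S * 1\<^sub>m ?p + Z12 * W * Z21 = Z11"
    unfolding one_mult_mat_right[OF c(7)] using c by (intro eq_matI) auto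
  also have "?S * 0\<^sub>m ?p ?q + Z12 = Z12"
    using c by (subst right_mult_zero_mat[OF c(7)]) auto
  also have "0\<^sub>m ?q ?p * 1\<^sub>m ?p + 1\<^sub>m ?q * Z21 = Z21"
    using c by (simp add: one_mult_mat_left[OF c(3)] one_mult_mat_right[of "0\<^sub>m ?q ?p" ?q ?p])
  also have "0\<^sub>m ?q ?p * 0\<^sub>m ?p ?q + 1\<^sub>m ?q * Z22 = Z22"
    using c by (simp add: one_mult_mat_left[OF c(4)])
  finally have fact: "four_block_mat Z11 Z12 Z21 Z22 =
    four_block_mat ?S (Z12 * W) (0\<^sub>m ?q ?p) (1\<^sub>m ?q) * four_block_mat (1\<^sub>m ?p) (0\<^sub>m ?p ?q) Z21 Z22" by simp
  show ?thesis
    unfolding fact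
    by (subst twisted_det_mult[of b])
      (use par vs c S P Z in \<open>simp_all add: degree0_four_block_iff degree0_one degree0_zero
        twisted_det_block_upper_one[OF par] twisted_det_block_one_lower[OF par]\<close>)
qed

end

section \<open>Identification of the graded determinant\<close>

lemma word_twist_zero: "(\<And>\<gamma>. \<gamma> \<in> set w \<Longrightarrow> \<gamma> = zvec n) \<Longrightarrow> word_twist n w = 0"
proof (induction w)
  case (Cons \<gamma> w)
  have "word_twist n w = 0" by (intro Cons.IH Cons.prems) simp
  moreover have "\<gamma> = zvec n" by (intro Cons.prems) simp
  ultimately show ?case by simp
qed simp

text \<open>For a single degree all entries have degree 0, and no signs arise.\<close>
lemma twisted_det_replicate:
  assumes "length \<delta> = n" "Z \<in> carrier_mat m m"
  shows "twisted_det n (replicate m \<delta>) Z = leibniz_det Z"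
proof -
  have tw: "perm_twist n (replicate m \<delta>) \<pi> = 0" if \<pi>: "\<pi> permutes {..<m}" for \<pi>
  proof -
    have bound: "\<pi> i < m" if "i < m" for i
      using permutes_in_image[OF \<pi>, of i] that by simp
    have "map (\<lambda>i. twist (replicate m \<delta> ! i \<boxplus> replicate m \<delta> ! \<pi> i) (replicate m \<delta> ! \<pi> i)) [0..<m] = map (\<lambda>_. 0) [0..<m]"
      using bound assms(1) by (intro map_cong) (simp_all add: vec_add_self)
    then have "sum_list (map (\<lambda>i. twist (replicate m \<delta> ! i \<boxplus> replicate m \<delta> ! \<pi> i) (replicate m \<delta> ! \<pi> i)) [0..<m]) = 0"
      by (simp only: sum_list_0)
    moreover have "word_twist n (map (\<lambda>i. replicate m \<delta> ! i \<boxplus> replicate m \<delta> ! \<pi> i) [0..<m]) = 0"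
      using bound assms(1) by (intro word_twist_zero) (auto simp: vec_add_self)
    ultimately show ?thesis unfolding perm_twist_def length_replicate by simp
  qed
  have "dim_row Z = m" using assms by simp
  show ?thesis
    unfolding twisted_det_def leibniz_det_def length_replicate \<open>dim_row Z = m\<close>
    by (rule sum.cong) (simp_all add: tw)
qed

lemma eval_poly_superset:
  assumes "finite K" "Poly_Mapping.keys P \<subseteq> K"
  shows "eval_poly P Z = (\<Sum>w\<in>K. Poly_Mapping.lookup P w *\<^sub>R prod_list (map (\<lambda>ij. Z $$ ij) w))"
  unfolding eval_poly_def using assms by (intro sum.mono_neutral_left) (auto simp: in_keys_iff)

lemma eval_poly_add: "eval_poly (P + Q) Z = eval_poly P Z + eval_poly Q Z"
proof -
  let ?K = "Poly_Mapping.keys P \<union> Poly_Mapping.keys Q"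
  have "Poly_Mapping.keys (P + Q) \<subseteq> ?K" by (rule Poly_Mapping.keys_add)
  then show ?thesis
    by (simp add: eval_poly_superset[of ?K] lookup_add scaleR_add_left sum.distrib)
qed

lemma eval_poly_single:
  "eval_poly (Poly_Mapping.single w c) Z = c *\<^sub>R prod_list (map (\<lambda>ij. Z $$ ij) w)"
  by (subst eval_poly_superset[of "{w}"]) auto

lemma eval_poly_sum: "eval_poly (\<Sum>i\<in>I. P i) Z = (\<Sum>i\<in>I. eval_poly (P i) Z)"
proof (induction I rule: infinite_finite_induct)
  case empty
  show ?case by (simp add: eval_poly_def)
qed (simp_all add: eval_poly_add, simp add: eval_poly_def)

lemma twisted_det_polynomial: "\<exists>P. \<forall>Z. eval_poly P Z = twisted_det n ds Z"
  by (intro exI[of _ "\<Sum>\<pi> | \<pi> permutes {..<length ds}. Poly_Mapping.single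
      (map (\<lambda>i. (i, \<pi> i)) [0..<length ds]) (real_of_int (sign \<pi>) * sgn_pow (perm_twist n ds \<pi>))"])
    (simp add: eval_poly_sum eval_poly_single twisted_det_def o_def)

context graded_commutative_algebra
begin

text \<open>The quasideterminant of the first block is its Schur complement, so each step of the recursion is an
instance of \<open>twisted_det_schur\<close>.\<close>
lemma quasidet_prod_eq_twisted_det:
  assumes "length \<delta>s = length s" "parity_list n b \<delta>s"
    "Z \<in> degree0 A (index_degrees \<delta>s s) (index_degrees \<delta>s s)" "quasidet_defined s Z"
  shows "quasidet_prod s Z = twisted_det n (index_degrees \<delta>s s) Z"
  using assms
proof (induction \<delta>s s arbitrary: Z rule: list_induct2)
  case Nil
  then show ?case by (simp add: twisted_det_def perm_twist_def)
next
  case (Cons \<delta> \<delta>s m s)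
  let ?es = "index_degrees \<delta>s s"
  obtain Z11 Z12 Z21 Z22 where split: "split_block Z m m = (Z11, Z12, Z21, Z22)"
    by (metis surj_pair)
  have "Z \<in> carrier_mat (m + length ?es) (m + length ?es)"
    using degree0_carrier[OF Cons.prems(2)] by simp
  then have "dim_row Z = m + length ?es" "dim_col Z = m + length ?es"
    by auto
  note sb = split_block[OF split this]
  have len: "length \<delta> = n" using Cons.prems(1) by (simp add: parity_list_def)
  have par: "parity_list n b (replicate m \<delta>)" "parity_list n b ?es" "parity_list n b \<delta>s"
    using Cons.prems(1) set_index_degrees[of \<delta>s s] by (auto simp: parity_list_def)
  have Zs: "Z11 \<in> degree0 A (replicate m \<delta>) (replicate m \<delta>)" "Z12 \<in> degree0 A (replicate m \<delta>) ?es"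
    "Z21 \<in> degree0 A ?es (replicate m \<delta>)" "Z22 \<in> degree0 A ?es ?es"
    using Cons.prems(2) sb(1-4) unfolding sb(5) by (simp_all add: degree0_four_block_iff)
  obtain W where W: "is_mat_inverse Z22 W" and def: "quasidet_defined s Z22"
    using Cons.prems(3) split by auto
  have "quasidet_prod (m # s) Z = leibniz_det (Z11 - Z12 * W * Z21) * twisted_det n ?es Z22"
    using split Cons.IH[OF par(3) Zs(4) def] mat_inverse_eqI[OF W sb(4)] by simp
  also have "leibniz_det (Z11 - Z12 * W * Z21) = twisted_det n (replicate m \<delta>) (Z11 - Z12 * W * Z21)"
    using sb(1-4) W by (intro twisted_det_replicate[symmetric] len) (auto simp: is_mat_inverse_def)
  also have "\<dots> * twisted_det n ?es Z22 = twisted_det n (replicate m \<delta> @ ?es) Z"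
    unfolding sb(5) by (rule twisted_det_schur[OF par(1,2) Zs W, symmetric])
  finally show ?case by simp
qed

text \<open>The polynomial of \<open>twisted_det_polynomial\<close> is a witness for the choice in the definition of \<open>graded_det\<close>; the
polynomial actually chosen agrees with it wherever the quasideterminants are defined.\<close>
lemma graded_det_eq_twisted_det:
  assumes "length \<delta>s = length s" "parity_list n b \<delta>s"
    and Z: "Z \<in> degree0 A (index_degrees \<delta>s s) (index_degrees \<delta>s s)" "quasidet_defined s Z"
  shows "graded_det A \<delta>s s Z = twisted_det n (index_degrees \<delta>s s) Z"
proof -
  let ?good = "\<lambda>P. \<forall>W\<in>graded_matrices A \<delta>s s. quasidet_defined s W \<longrightarrow> eval_poly P W = quasidet_prod s W"
  obtain P where P: "\<And>W :: 'a mat. eval_poly P W = twisted_det n (index_degrees \<delta>s s) W"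
    using twisted_det_polynomial by blast
  have "?good P"
    unfolding graded_matrices_eq_degree0[OF assms(1)] P
    by (intro ballI impI quasidet_prod_eq_twisted_det[OF assms(1,2), symmetric])
  then have "?good (SOME P. ?good P)" by (rule someI)
  moreover have "Z \<in> graded_matrices A \<delta>s s"
    using Z by (simp add: graded_matrices_eq_degree0[OF assms(1)])
  ultimately have "eval_poly (SOME P. ?good P) Z = quasidet_prod s Z"
    using Z(2) by blast
  then show ?thesis
    unfolding graded_det_def quasidet_prod_eq_twisted_det[OF assms(1,2) Z] .
qed

end

section \<open>Polynomials in a nilpotent parameter and their Euler derivation\<close>

lemmas ncoeff_simps [simp] = zero_nilpoly.rep_eq one_nilpoly.rep_eq plus_nilpoly.rep_eq uminus_nilpoly.rep_eq
  minus_nilpoly.rep_eq scaleR_nilpoly.rep_eq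

lemma ncoeff_sum [simp]: "ncoeff (sum f I) k = (\<Sum>i\<in>I. ncoeff (f i) k)"
  by (induction I rule: infinite_finite_induct) auto

lemma ncoeff_beyond: "CARD('N) \<le> k \<Longrightarrow> ncoeff (a :: ('a::zero, 'N::finite) nilpoly) k = 0"
  using ncoeff[of a] by simp

lemma ncoeff_eqI: "(\<And>k. ncoeff a k = ncoeff b k) \<Longrightarrow> a = b"
  by (simp add: ncoeff_inject fun_eq_iff flip: ncoeff_inject)

lemma ncoeff_mult_0: "ncoeff (a * b) 0 = ncoeff a 0 * ncoeff b 0"
  for a b :: "('a::real_algebra, 'N::finite) nilpoly"
  using card_pos[where 'N = 'N] by (simp add: ncoeff_mult)

lemma ncoeff_Abs_nilpoly: "(\<And>k. CARD('N) \<le> k \<Longrightarrow> f k = 0) \<Longrightarrow> ncoeff (Abs_nilpoly f :: ('a::zero, 'N::finite) nilpoly) = f"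
  by (simp add: Abs_nilpoly_inverse)

context graded_commutative_algebra
begin

text \<open>All statements on \<open>A\<close> also apply to \<open>A[\<epsilon>]\<close>, by comparing coefficients.\<close>
lemma graded_commutative_algebra_nilpoly:
  "graded_commutative_algebra n (nilpoly_grading A :: bit list \<Rightarrow> ('a, 'N::finite) nilpoly set)"
proof
  fix \<gamma> assume "\<gamma> \<in> set (lex_vectors n)"
  then show "subspace (nilpoly_grading A \<gamma> :: ('a, 'N) nilpoly set)"
    unfolding subspace_def nilpoly_grading_def by (auto intro: component_add component_scaleR)
next
  fix \<gamma> \<delta> and a b :: "('a, 'N) nilpoly"
  assume \<gamma>: "\<gamma> \<in> set (lex_vectors n)" "\<delta> \<in> set (lex_vectors n)"
    and ab: "a \<in> nilpoly_grading A \<gamma>" "b \<in> nilpoly_grading A \<delta>"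
  then have len: "length \<gamma> = n" "length \<delta> = n" and c: "ncoeff a k \<in> A \<gamma>" "ncoeff b k \<in> A \<delta>" for k
    by (auto simp: nilpoly_grading_def)
  show "a * b \<in> nilpoly_grading A (\<gamma> \<boxplus> \<delta>)"
    unfolding nilpoly_grading_def using len c
    by (auto simp: ncoeff_mult intro!: component_sum component_mult)
  show "b * a = sgn_pow (ip \<gamma> \<delta>) *\<^sub>R (a * b)"
  proof (rule nilpoly_eqI)
    fix k assume k: "k < CARD('N)"
    have "(\<Sum>i=0..k. ncoeff b i * ncoeff a (k - i)) = (\<Sum>i=0..k. sgn_pow (ip \<gamma> \<delta>) *\<^sub>R (ncoeff a i * ncoeff b (k - i)))"
    proof (rule sum.reindex_bij_witness[of _ "\<lambda>i. k - i" "\<lambda>i. k - i"])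
      fix i assume "i \<in> {0..k}"
      then show "sgn_pow (ip \<gamma> \<delta>) *\<^sub>R (ncoeff a (k - i) * ncoeff b (k - (k - i))) = ncoeff b i * ncoeff a (k - i)"
        using graded_commute[OF \<gamma> c(1)[of "k - i"] c(2)[of i]] by simp
    qed auto
    then show "ncoeff (b * a) k = ncoeff (sgn_pow (ip \<gamma> \<delta>) *\<^sub>R (a * b)) k"
      using k by (simp add: ncoeff_mult scaleR_sum_right)
  qed
next
  fix x :: "('a, 'N) nilpoly"
  let ?P = "\<lambda>f :: bit list \<Rightarrow> ('a, 'N) nilpoly. (\<forall>\<gamma>\<in>set (lex_vectors n). f \<gamma> \<in> nilpoly_grading A \<gamma>) \<and>
    (\<forall>\<gamma>. \<gamma> \<notin> set (lex_vectors n) \<longrightarrow> f \<gamma> = 0) \<and> x = (\<Sum>\<gamma>\<in>set (lex_vectors n). f \<gamma>)"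
  define f where "f = (\<lambda>\<gamma>. Abs_nilpoly (\<lambda>k. proj (ncoeff x k) \<gamma>) :: ('a, 'N) nilpoly)"
  have f: "ncoeff (f \<gamma>) k = proj (ncoeff x k) \<gamma>" for \<gamma> k
  proof -
    have "proj 0 \<gamma> = 0" for \<gamma>
      by (cases "length \<gamma> = n") (simp_all add: proj_0 proj_outside)
    then show ?thesis
      unfolding f_def by (subst ncoeff_Abs_nilpoly) (simp_all add: ncoeff_beyond)
  qed
  show "\<exists>!f. ?P f"
  proof
    show "?P f"
      by (auto simp: nilpoly_grading_def f proj_component proj_outside sum_proj intro!: ncoeff_eqI)
    fix g assume g: "?P g"
    have "ncoeff (g \<gamma>) k = ncoeff (f \<gamma>) k" for \<gamma> k
    proof (cases "length \<gamma> = n")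
      case True
      have "proj (ncoeff x k) \<gamma> = ncoeff (g \<gamma>) k"
        using g True by (intro proj_eqI) (auto simp: nilpoly_grading_def)
      then show ?thesis by (simp add: f)
    next
      case False
      then show ?thesis using g by (simp add: f proj_outside)
    qed
    then show "g = f" by (intro ext ncoeff_eqI)
  qed
qed

end

text \<open>The derivation \<open>\<epsilon> d/d\<epsilon>\<close>. Unlike \<open>d/d\<epsilon>\<close> it respects the relation \<open>\<epsilon>\<^sup>N = 0\<close>.\<close>
lift_definition euler :: "('a::real_vector, 'N::finite) nilpoly \<Rightarrow> ('a, 'N) nilpoly"
  is "\<lambda>f k. real k *\<^sub>R f k" by simp

lemma ncoeff_euler [simp]: "ncoeff (euler x) k = real k *\<^sub>R ncoeff x k"
  by transfer simp

lemma euler_simps [simp]: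
  "euler 0 = 0" "euler (x + y) = euler x + euler y" "euler (x - y) = euler x - euler y"
  "euler (c *\<^sub>R x) = c *\<^sub>R euler x"
  for x y :: "('a::real_vector, 'N::finite) nilpoly"
  by (auto intro!: ncoeff_eqI simp: algebra_simps)

lemma euler_one [simp]: "euler (1 :: ('a::{real_algebra,monoid_mult}, 'N::finite) nilpoly) = 0"
  by (rule ncoeff_eqI) auto

lemma euler_sum [simp]: "euler (sum f I) = (\<Sum>i\<in>I. euler (f i))"
  by (induction I rule: infinite_finite_induct) auto

lemma euler_mult: "euler (x * y) = euler x * y + x * euler y"
  for x y :: "('a::{real_algebra,monoid_mult}, 'N::finite) nilpoly"
proof (rule nilpoly_eqI)
  fix k assume k: "k < CARD('N)"
  have "real k *\<^sub>R (ncoeff x i * ncoeff y (k - i)) =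
      (real i *\<^sub>R ncoeff x i) * ncoeff y (k - i) + ncoeff x i * (real (k - i) *\<^sub>R ncoeff y (k - i))"
    if "i \<in> {0..k}" for i
  proof -
    have e: "real i + real (k - i) = real k" using that by simp
    show ?thesis
      unfolding e[symmetric] mult_scaleR_left mult_scaleR_right scaleR_add_left ..
  qed
  then have "(\<Sum>i=0..k. real k *\<^sub>R (ncoeff x i * ncoeff y (k - i))) =
    (\<Sum>i=0..k. (real i *\<^sub>R ncoeff x i) * ncoeff y (k - i)) + (\<Sum>i=0..k. ncoeff x i * (real (k - i) *\<^sub>R ncoeff y (k - i)))"
    by (simp only: sum.distrib[symmetric] cong: sum.cong)
  then show "ncoeff (euler (x * y)) k = ncoeff (euler x * y + x * euler y) k"
    using k by (simp only: ncoeff_euler ncoeff_mult plus_nilpoly.rep_eq if_True scaleR_sum_right)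
qed

lemma euler_prod_list:
  fixes x :: "nat \<Rightarrow> ('a::{real_algebra,monoid_mult}, 'N::finite) nilpoly"
  shows "euler (prod_list (map x [0..<N])) =
    (\<Sum>l<N. prod_list (map (\<lambda>i. if i = l then euler (x i) else x i) [0..<N]))"
proof (induction N)
  case (Suc N)
  have "prod_list (map (\<lambda>i. if i = N then euler (x i) else x i) [0..<N]) = prod_list (map x [0..<N])"
    by (intro arg_cong[of _ _ prod_list] map_cong) auto
  then show ?case
    by (simp add: euler_mult Suc.IH sum_distrib_right)
qed simp

text \<open>The equation reads \<open>k f\<^sub>k = \<Sum>i=1..k. h\<^sub>i f\<^sub>k\<^sub>-\<^sub>i\<close>, which determines the coefficients recursively.\<close>
lemma nilpoly_ode_unique:
  fixes f g h :: "('a::{real_algebra,monoid_mult}, 'N::finite) nilpoly"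
  assumes f: "euler f = h * f" and g: "euler g = h * g" and h: "ncoeff h 0 = 0"
    and init: "ncoeff f 0 = ncoeff g 0"
  shows "f = g"
proof (rule nilpoly_eqI)
  fix k assume "k < CARD('N)"
  then show "ncoeff f k = ncoeff g k"
  proof (induction k rule: less_induct)
    case (less k)
    show ?case
    proof (cases "k = 0")
      case False
      have "real k *\<^sub>R ncoeff f k = (\<Sum>i=0..k. ncoeff h i * ncoeff f (k - i))"
        using arg_cong[OF f, of "\<lambda>x. ncoeff x k"] less.prems by (simp add: ncoeff_mult)
      also have "\<dots> = (\<Sum>i=0..k. ncoeff h i * ncoeff g (k - i))"
      proof (rule sum.cong)
        fix i assume "i \<in> {0..k}"
        then show "ncoeff h i * ncoeff f (k - i) = ncoeff h i * ncoeff g (k - i)"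
          using less.IH[of "k - i"] less.prems False h by (cases "i = 0") auto
      qed simp
      also have "\<dots> = real k *\<^sub>R ncoeff g k"
        using arg_cong[OF g, of "\<lambda>x. ncoeff x k"] less.prems by (simp add: ncoeff_mult)
      finally show ?thesis using False by simp
    qed (simp add: init)
  qed
qed

section \<open>Liouville's formula\<close>

lemma prod_list_zero_factor: "(0::'b::{real_algebra,monoid_mult}) \<in> set xs \<Longrightarrow> prod_list xs = 0"
  by (induction xs) auto

text \<open>The sign attached to the identity is trivial, because the diagonal entries have degrees \<open>2 ds ! i = 0\<close>.\<close>
lemma twisted_det_only_identity:
  assumes vs: "vectors n ds"
    and zero: "\<And>\<pi>. \<pi> permutes {..<length ds} \<Longrightarrow> \<pi> \<noteq> id \<Longrightarrow> \<exists>i<length ds. Z $$ (i, \<pi> i) = 0"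
  shows "twisted_det n ds Z = prod_list (map (\<lambda>i. Z $$ (i, i)) [0..<length ds])"
proof -
  let ?N = "length ds"
  let ?t = "\<lambda>\<pi>. (real_of_int (sign \<pi>) * sgn_pow (perm_twist n ds \<pi>)) *\<^sub>R prod_list (map (\<lambda>i. Z $$ (i, \<pi> i)) [0..<?N])"
  have vanish: "?t \<pi> = 0" if \<pi>: "\<pi> permutes {..<?N}" "\<pi> \<noteq> id" for \<pi>
  proof -
    obtain i where "i < ?N" "Z $$ (i, \<pi> i) = 0" using zero[OF \<pi>] by blast
    then have "0 \<in> set (map (\<lambda>i. Z $$ (i, \<pi> i)) [0..<?N])" by force
    then show ?thesis by (simp add: prod_list_zero_factor)
  qed
  have "twisted_det n ds Z = (\<Sum>\<pi> | \<pi> permutes {..<?N}. if \<pi> = id then ?t id else 0)"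
    unfolding twisted_det_def by (rule sum.cong) (use vanish in auto)
  also have "\<dots> = ?t id"
    by (simp add: finite_permutations permutes_id)
  also have "perm_twist n ds id = 0"
  proof -
    have "map (\<lambda>i. ds ! i \<boxplus> ds ! id i) [0..<?N] = map (\<lambda>_. zvec n) [0..<?N]"
      using vs by (intro map_cong) (simp_all add: vec_add_self vectors_nth)
    moreover have "map (\<lambda>i. twist (ds ! i \<boxplus> ds ! id i) (ds ! id i)) [0..<?N] = map (\<lambda>_. 0) [0..<?N]"
      using vs by (intro map_cong) (simp_all add: vec_add_self vectors_nth)
    moreover have "word_twist n (map (\<lambda>_. zvec n) [0..<?N]) = 0"
      by (intro word_twist_zero) auto
    ultimately show ?thesis unfolding perm_twist_def by (simp only: sum_list_0 add_0)
  qed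
  finally show ?thesis by simp
qed

lemma twisted_det_one:
  assumes "vectors n ds"
  shows "twisted_det n ds (1\<^sub>m (length ds)) = 1"
proof -
  have "twisted_det n ds (1\<^sub>m (length ds) :: 'a mat) = prod_list (map (\<lambda>i. 1\<^sub>m (length ds) $$ (i, i)) [0..<length ds])"
  proof (rule twisted_det_only_identity[OF assms])
    fix \<pi> assume \<pi>: "\<pi> permutes {..<length ds}" "\<pi> \<noteq> id"
    then obtain i where i: "\<pi> i \<noteq> i" by (auto simp: fun_eq_iff)
    then have "i < length ds" using \<pi>(1) by (metis lessThan_iff permutes_not_in)
    moreover have "\<pi> i < length ds" using permutes_in_image[OF \<pi>(1), of i] calculation by simp
    ultimately show "\<exists>i<length ds. 1\<^sub>m (length ds) $$ (i, \<pi> i) = (0::'a)" using i by auto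
  qed
  also have "map (\<lambda>i. 1\<^sub>m (length ds) $$ (i, i)) [0..<length ds] = map (\<lambda>_. 1::'a) [0..<length ds]"
    by (intro map_cong) auto
  also have "prod_list \<dots> = 1" by (induction ds) auto
  finally show ?thesis .
qed

definition replace_row :: "'b mat \<Rightarrow> nat \<Rightarrow> 'b mat \<Rightarrow> 'b mat" where
  "replace_row Z l U = mat (dim_row Z) (dim_col Z) (\<lambda>(i, j). if i = l then U $$ (l, j) else Z $$ (i, j))"

lemma twisted_det_replace_row_one:
  fixes U :: "'b::{real_algebra,monoid_mult} mat"
  assumes vs: "vectors n ds" and l: "l < length ds"
  shows "twisted_det n ds (replace_row (1\<^sub>m (length ds)) l U) = U $$ (l, l)"
proof -
  let ?N = "length ds"
  have "twisted_det n ds (replace_row (1\<^sub>m ?N) l U) = prod_list (map (\<lambda>i. replace_row (1\<^sub>m ?N) l U $$ (i, i)) [0..<?N])"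
  proof (rule twisted_det_only_identity[OF vs])
    fix \<pi> assume \<pi>: "\<pi> permutes {..<?N}" "\<pi> \<noteq> id"
    obtain i where i: "\<pi> i \<noteq> i" "i \<noteq> l"
    proof (rule ccontr)
      assume "\<not> thesis"
      with that have fixed: "\<And>i. i \<noteq> l \<Longrightarrow> \<pi> i = i" by blast
      have "\<pi> (\<pi> l) = \<pi> l" if "\<pi> l \<noteq> l" using fixed[OF that] .
      then have "\<pi> l = l" using permutes_inj[OF \<pi>(1)] by (metis injD)
      with fixed \<pi>(2) show False by (metis eq_id_iff)
    qed
    have "i < ?N" using \<pi>(1) i by (metis lessThan_iff permutes_not_in)
    moreover have "\<pi> i < ?N" using permutes_in_image[OF \<pi>(1), of i] calculation by simp
    ultimately show "\<exists>i<?N. replace_row (1\<^sub>m ?N) l U $$ (i, \<pi> i) = 0"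
      using i by (intro exI[of _ i]) (simp add: replace_row_def)
  qed
  also have "map (\<lambda>i. replace_row (1\<^sub>m ?N) l U $$ (i, i)) [0..<?N] = map (\<lambda>i. if i = l then U $$ (l, l) else 1) [0..<?N]"
    by (intro map_cong) (auto simp: replace_row_def)
  also have "prod_list (map (\<lambda>i. if i = l then U $$ (l, l) else 1) [0..<N]) = (if l < N then U $$ (l, l) else 1)" for N
    by (induction N) auto
  finally show ?thesis using l by simp
qed

lemma euler_twisted_det:
  fixes Z :: "('a::{real_algebra,monoid_mult}, 'N::finite) nilpoly mat"
  assumes Z: "Z \<in> carrier_mat (length ds) (length ds)"
  shows "euler (twisted_det n ds Z) = (\<Sum>l<length ds. twisted_det n ds (replace_row Z l (map_mat euler Z)))"
proof -
  let ?N = "length ds"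
  let ?c = "\<lambda>\<pi>. real_of_int (sign \<pi>) * sgn_pow (perm_twist n ds \<pi>)"
  have "euler (twisted_det n ds Z) = (\<Sum>\<pi> | \<pi> permutes {..<?N}. \<Sum>l<?N.
      ?c \<pi> *\<^sub>R prod_list (map (\<lambda>i. if i = l then euler (Z $$ (i, \<pi> i)) else Z $$ (i, \<pi> i)) [0..<?N]))"
    by (simp add: twisted_det_def euler_prod_list scaleR_sum_right)
  also have "\<dots> = (\<Sum>\<pi> | \<pi> permutes {..<?N}. \<Sum>l<?N.
      ?c \<pi> *\<^sub>R prod_list (map (\<lambda>i. replace_row Z l (map_mat euler Z) $$ (i, \<pi> i)) [0..<?N]))"
  proof (rule sum.cong[OF refl], rule sum.cong[OF refl])
    fix \<pi> l assume "\<pi> \<in> {\<pi>. \<pi> permutes {..<?N}}" "l \<in> {..<?N}"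
    then have "\<pi> i < ?N" if "i < ?N" for i
      using permutes_in_image[of \<pi> "{..<?N}" i] that by simp
    then have "map (\<lambda>i. if i = l then euler (Z $$ (i, \<pi> i)) else Z $$ (i, \<pi> i)) [0..<?N] =
        map (\<lambda>i. replace_row Z l (map_mat euler Z) $$ (i, \<pi> i)) [0..<?N]"
      using Z by (intro map_cong) (auto simp: replace_row_def)
    then show "?c \<pi> *\<^sub>R prod_list (map (\<lambda>i. if i = l then euler (Z $$ (i, \<pi> i)) else Z $$ (i, \<pi> i)) [0..<?N]) =
      ?c \<pi> *\<^sub>R prod_list (map (\<lambda>i. replace_row Z l (map_mat euler Z) $$ (i, \<pi> i)) [0..<?N])"
      by (rule arg_cong)
  qed
  also have "\<dots> = (\<Sum>l<?N. twisted_det n ds (replace_row Z l (map_mat euler Z)))"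
    unfolding twisted_det_def by (rule sum.swap)
  finally show ?thesis .
qed

lemma replace_row_mult:
  fixes Z U :: "'b::{real_algebra,monoid_mult} mat"
  assumes Z: "Z \<in> carrier_mat N N" and U: "U \<in> carrier_mat N N" and l: "l < N"
  shows "replace_row Z l (U * Z) = replace_row (1\<^sub>m N) l U * Z"
proof (rule eq_matI)
  fix i j assume "i < dim_row (replace_row (1\<^sub>m N) l U * Z)" "j < dim_col (replace_row (1\<^sub>m N) l U * Z)"
  then have ij: "i < N" "j < N" using Z by (auto simp: replace_row_def)
  have R: "replace_row (1\<^sub>m N) l U \<in> carrier_mat N N" by (simp add: replace_row_def)
  have "(replace_row (1\<^sub>m N) l U * Z) $$ (i, j) = (\<Sum>k<N. (if i = l then U $$ (l, k) else 1\<^sub>m N $$ (i, k)) * Z $$ (k, j))"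
    unfolding mult_mat_entry[OF R Z ij] using ij by (intro sum.cong) (simp_all add: replace_row_def)
  also have "\<dots> = (if i = l then (U * Z) $$ (l, j) else (1\<^sub>m N * Z) $$ (i, j))"
    using mult_mat_entry[OF U Z l ij(2)] mult_mat_entry[OF _ Z ij, of "1\<^sub>m N"] by simp
  also have "\<dots> = replace_row Z l (U * Z) $$ (i, j)"
    using Z ij by (simp add: replace_row_def one_mult_mat_left)
  finally show "replace_row Z l (U * Z) $$ (i, j) = (replace_row (1\<^sub>m N) l U * Z) $$ (i, j)" ..
qed (use Z in \<open>auto simp: replace_row_def\<close>)

text \<open>Differentiating the signed Leibniz sum replaces one row \<open>l\<close> of \<open>Z\<close> by the row of \<open>U Z\<close>. The matrix so obtained is
the unit matrix with row \<open>l\<close> replaced by the row of \<open>U\<close>, times \<open>Z\<close>, and the determinant of the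
first factor is \<open>U\<^sub>l\<^sub>l\<close>.\<close>
lemma (in graded_commutative_algebra) liouville_twisted_det:
  fixes Z U :: "('a, 'N::finite) nilpoly mat"
  assumes par: "parity_list n b ds"
    and Z: "Z \<in> degree0 (nilpoly_grading A) ds ds" and U: "U \<in> degree0 (nilpoly_grading A) ds ds"
    and ode: "map_mat euler Z = U * Z"
  shows "euler (twisted_det n ds Z) = mat_trace U * twisted_det n ds Z"
proof -
  interpret N: graded_commutative_algebra n "nilpoly_grading A :: bit list \<Rightarrow> ('a, 'N) nilpoly set"
    by (rule graded_commutative_algebra_nilpoly)
  note vs = parity_list_vectors[OF par]
  note c = degree0_carrier[OF Z] degree0_carrier[OF U]
  have "twisted_det n ds (replace_row Z l (map_mat euler Z)) = U $$ (l, l) * twisted_det n ds Z" if l: "l < length ds" for l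
  proof -
    have "replace_row (1\<^sub>m (length ds)) l U \<in> degree0 (nilpoly_grading A) ds ds"
      using U N.degree0_one[OF vs] l by (auto simp: degree0_def replace_row_def)
    then show ?thesis
      unfolding ode replace_row_mult[OF c l] using twisted_det_replace_row_one[OF vs l, of U] 
      by (simp add: N.twisted_det_mult[OF par _ Z])
  qed
  then show ?thesis
    using c by (simp add: euler_twisted_det mat_trace_def sum_distrib_right)
qed

section \<open>Unipotent matrices\<close>

definition unipotent :: "('a::{real_algebra,monoid_mult}, 'N::finite) nilpoly mat \<Rightarrow> bool" where
  "unipotent Z \<longleftrightarrow> map_mat (\<lambda>x. ncoeff x 0) Z = 1\<^sub>m (dim_row Z)"

lemma unipotent_iff:
  "Z \<in> carrier_mat N N \<Longrightarrow> unipotent Z \<longleftrightarrow> (\<forall>i<N. \<forall>j<N. ncoeff (Z $$ (i, j)) 0 = (if i = j then 1 else 0))"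
  by (auto simp: unipotent_def mat_eq_iff)

lemma ncoeff_0_prod_list:
  "ncoeff (prod_list xs) 0 = prod_list (map (\<lambda>x. ncoeff x 0) xs)"
  for xs :: "('a::{real_algebra,monoid_mult}, 'N::finite) nilpoly list"
  by (induction xs) (auto simp: ncoeff_mult_0)

lemma ncoeff_0_twisted_det_unipotent:
  assumes vs: "vectors n ds" and Z: "Z \<in> carrier_mat (length ds) (length ds)" "unipotent Z"
  shows "ncoeff (twisted_det n ds Z) 0 = 1"
proof -
  have "ncoeff (prod_list (map (\<lambda>i. Z $$ (i, \<pi> i)) [0..<length ds])) 0 =
     prod_list (map (\<lambda>i. 1\<^sub>m (length ds) $$ (i, \<pi> i)) [0..<length ds])" if "\<pi> permutes {..<length ds}" for \<pi>
  proof -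
    have "\<pi> i < length ds" if "i < length ds" for i
      using permutes_in_image[OF \<open>\<pi> permutes _\<close>, of i] that by simp
    then show ?thesis
      unfolding ncoeff_0_prod_list map_map o_def
      using Z by (intro arg_cong[of _ _ prod_list] map_cong) (auto simp: unipotent_iff)
  qed
  then have "ncoeff (twisted_det n ds Z) 0 = twisted_det n ds (1\<^sub>m (length ds))"
    by (simp add: twisted_det_def)
  then show ?thesis using twisted_det_one[OF vs] by simp
qed

text \<open>If \<open>W\<close> is a right inverse modulo \<open>\<epsilon>\<^sup>k\<close> with error \<open>R = 1 - Z W\<close>, then \<open>W + R\<close> has the error
\<open>(1 - Z) R\<close>, which is divisible by one more power of \<open>\<epsilon>\<close>.\<close>
lemma unipotent_right_inverse:
  fixes Z :: "('a::{real_algebra,monoid_mult}, 'N::finite) nilpoly mat"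
  assumes Z: "Z \<in> carrier_mat m m" "unipotent Z"
  obtains W where "W \<in> carrier_mat m m" "Z * W = 1\<^sub>m m" "unipotent W"
proof -
  have "\<exists>W \<in> carrier_mat m m. \<forall>i<m. \<forall>j<m. \<forall>l<k. ncoeff ((1\<^sub>m m - Z * W) $$ (i, j)) l = 0" for k
  proof (induction k)
    case 0
    then show ?case by (auto intro: bexI[of _ Z] Z)
  next
    case (Suc k)
    then obtain W where W: "W \<in> carrier_mat m m"
      and ord: "\<And>i j l. i < m \<Longrightarrow> j < m \<Longrightarrow> l < k \<Longrightarrow> ncoeff ((1\<^sub>m m - Z * W) $$ (i, j)) l = 0" by blast
    define R where "R = 1\<^sub>m m - Z * W"
    have R: "R \<in> carrier_mat m m" unfolding R_def using Z W by (intro minus_carrier_mat mult_carrier_mat)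
    have D: "1\<^sub>m m - Z \<in> carrier_mat m m" using Z(1) by (rule minus_carrier_mat)
    have "1\<^sub>m m - Z * (W + R) = R - Z * R"
      using Z W R unfolding mult_add_distrib_mat[OF Z(1) W R]
      by (intro eq_matI) (auto simp: R_def)
    also have "\<dots> = (1\<^sub>m m - Z) * R"
      using minus_mult_distrib_mat[OF one_carrier_mat Z(1) R] by (simp add: one_mult_mat_left[OF R])
    finally have *: "1\<^sub>m m - Z * (W + R) = (1\<^sub>m m - Z) * R" .
    have "ncoeff ((1\<^sub>m m - Z * (W + R)) $$ (i, j)) l = 0" if ij: "i < m" "j < m" and l: "l < Suc k" for i j l
    proof -
      have "ncoeff ((1\<^sub>m m - Z) $$ (i, p) * R $$ (p, j)) l = 0" if p: "p < m" for p
      proof -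
        have "ncoeff ((1\<^sub>m m - Z) $$ (i, p)) q * ncoeff (R $$ (p, j)) (l - q) = 0" if "q \<in> {0..l}" for q
        proof (cases "q = 0")
          case True
          then show ?thesis using Z ij p by (simp add: unipotent_iff)
        next
          case False
          then show ?thesis using ord[OF p ij(2), of "l - q"] that l by (simp add: R_def)
        qed
        then show ?thesis by (simp add: ncoeff_mult)
      qed
      then show ?thesis
        unfolding * mult_mat_entry[OF D R ij] by simp
    qed
    then show ?case using W R by (intro bexI[of _ "W + R"]) auto
  qed
  from this[of "CARD('N)"] obtain W where W: "W \<in> carrier_mat m m"
    and ord: "\<And>i j l. i < m \<Longrightarrow> j < m \<Longrightarrow> l < CARD('N) \<Longrightarrow> ncoeff ((1\<^sub>m m - Z * W) $$ (i, j)) l = 0" by blast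
  have ZW: "Z * W = 1\<^sub>m m"
  proof (rule eq_matI)
    fix i j assume "i < dim_row (1\<^sub>m m :: ('a, 'N) nilpoly mat)" "j < dim_col (1\<^sub>m m :: ('a, 'N) nilpoly mat)"
    then have ij: "i < m" "j < m" by simp_all
    have "(1\<^sub>m m - Z * W) $$ (i, j) = 0"
      using ord[OF ij] by (intro nilpoly_eqI) simp
    then show "(Z * W) $$ (i, j) = 1\<^sub>m m $$ (i, j)" using ij Z W by simp
  qed (use Z W in auto)
  have "ncoeff (W $$ (i, j)) 0 = (if i = j then 1 else 0)" if ij: "i < m" "j < m" for i j
  proof -
    have "ncoeff ((Z * W) $$ (i, j)) 0 = (\<Sum>k<m. (if i = k then 1 else 0) * ncoeff (W $$ (k, j)) 0)"
      unfolding mult_mat_entry[OF Z(1) W ij] using Z ij by (simp add: ncoeff_mult_0 unipotent_iff)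
    also have "\<dots> = (\<Sum>k<m. if k = i then ncoeff (W $$ (i, j)) 0 else 0)"
      by (rule sum.cong) auto
    also have "\<dots> = ncoeff (W $$ (i, j)) 0" using ij by simp
    finally show ?thesis using ij unfolding ZW by (cases "i = j") simp_all
  qed
  then show thesis using that[OF W ZW] W by (simp add: unipotent_iff)
qed

lemma unipotent_invertible:
  fixes Z :: "('a::{real_algebra,monoid_mult}, 'N::finite) nilpoly mat"
  assumes Z: "Z \<in> carrier_mat m m" "unipotent Z"
  obtains W where "is_mat_inverse Z W" "unipotent W"
proof -
  obtain W where W: "W \<in> carrier_mat m m" "Z * W = 1\<^sub>m m" "unipotent W" by (rule unipotent_right_inverse[OF Z])
  obtain V where V: "V \<in> carrier_mat m m" "W * V = 1\<^sub>m m" by (rule unipotent_right_inverse[OF W(1,3)])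
  have "V = Z * W * V" using V W by (simp add: one_mult_mat_left)
  also have "\<dots> = Z" using assoc_mult_mat[OF Z(1) W(1) V(1)] V Z by (simp add: one_mult_mat_right)
  finally have "is_mat_inverse Z W" using Z W V by (simp add: is_mat_inverse_def)
  then show thesis using that W by blast
qed

lemma unipotent_quasidet_defined:
  fixes Z :: "('a::{real_algebra,monoid_mult}, 'N::finite) nilpoly mat"
  assumes "Z \<in> carrier_mat (sum_list s) (sum_list s)" "unipotent Z"
  shows "quasidet_defined s Z"
  using assms
proof (induction s arbitrary: Z)
  case (Cons m s)
  obtain Z11 Z12 Z21 Z22 where split: "split_block Z m m = (Z11, Z12, Z21, Z22)"
    by (metis surj_pair)
  have "dim_row Z = m + sum_list s" "dim_col Z = m + sum_list s"
    using Cons.prems(1) by auto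
  note sb = split_block[OF split this]
  have "ncoeff (Z22 $$ (i, j)) 0 = (if i = j then 1 else 0)" if "i < sum_list s" "j < sum_list s" for i j
    using Cons.prems(2)[unfolded unipotent_iff[OF Cons.prems(1)], rule_format, of "m + i" "m + j"] that sb(1-4)
    unfolding sb(5) by simp
  then have uni: "unipotent Z22" using sb(4) by (simp add: unipotent_iff)
  obtain W where "is_mat_inverse Z22 W" by (rule unipotent_invertible[OF sb(4) uni])
  then show ?case using split Cons.IH[OF sb(4) uni] by auto
qed simp

section \<open>Differential equations for matrices\<close>

abbreviation euler_mat :: "('a::{real_algebra,monoid_mult}, 'N::finite) nilpoly mat \<Rightarrow> ('a, 'N) nilpoly mat" where
  "euler_mat \<equiv> map_mat euler"

lemma euler_mat_mult:
  assumes P: "P \<in> carrier_mat a b" and Q: "Q \<in> carrier_mat b c"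
  shows "euler_mat (P * Q) = euler_mat P * Q + P * euler_mat Q"
proof (rule eq_matI)
  fix i j assume "i < dim_row (euler_mat P * Q + P * euler_mat Q)" "j < dim_col (euler_mat P * Q + P * euler_mat Q)"
  then have ij: "i < a" "j < c" using P Q by auto
  have D: "euler_mat P \<in> carrier_mat a b" "euler_mat Q \<in> carrier_mat b c" using P Q by auto
  have dim: "dim_row P = a" "dim_row (euler_mat P) = a" "dim_col Q = c" "dim_col (euler_mat Q) = c" using P Q by auto
  have "euler_mat (P * Q) $$ (i, j) = euler ((P * Q) $$ (i, j))"
    using ij dim by (intro index_map_mat) simp_all
  also have "\<dots> = (\<Sum>k<b. euler_mat P $$ (i, k) * Q $$ (k, j)) + (\<Sum>k<b. P $$ (i, k) * euler_mat Q $$ (k, j))"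
    unfolding mult_mat_entry[OF P Q ij] using P Q ij by (simp add: euler_mult sum.distrib)
  also have "\<dots> = (euler_mat P * Q) $$ (i, j) + (P * euler_mat Q) $$ (i, j)"
    by (simp only: mult_mat_entry[OF P D(2) ij] mult_mat_entry[OF D(1) Q ij])
  also have "\<dots> = (euler_mat P * Q + P * euler_mat Q) $$ (i, j)"
    using ij dim by (intro index_add_mat[symmetric]) simp_all
  finally show "euler_mat (P * Q) $$ (i, j) = (euler_mat P * Q + P * euler_mat Q) $$ (i, j)" .
qed (use P Q in auto)

lemma euler_mat_diff:
  "P \<in> carrier_mat a b \<Longrightarrow> Q \<in> carrier_mat a b \<Longrightarrow> euler_mat (P - Q) = euler_mat P - euler_mat Q"
  by (intro eq_matI) auto

lemma four_block_mat_eqD: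
  assumes "four_block_mat A B C D = four_block_mat A' B' C' D'"
    and "A \<in> carrier_mat p p'" "B \<in> carrier_mat p q'" "C \<in> carrier_mat q p'" "D \<in> carrier_mat q q'"
    and "A' \<in> carrier_mat p p'" "B' \<in> carrier_mat p q'" "C' \<in> carrier_mat q p'" "D' \<in> carrier_mat q q'"
  shows "A = A'" "B = B'" "C = C'" "D = D'"
proof -
  have *: "four_block_mat A B C D $$ (i, j) = four_block_mat A' B' C' D' $$ (i, j)" for i j
    using assms(1) by simp
  show "A = A'"
  proof (rule eq_matI)
    fix i j assume "i < dim_row A'" "j < dim_col A'"
    then show "A $$ (i, j) = A' $$ (i, j)" using assms(2-) *[of i j] by simp
  qed (use assms in auto)
  show "B = B'"
  proof (rule eq_matI)
    fix i j assume "i < dim_row B'" "j < dim_col B'"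
    then show "B $$ (i, j) = B' $$ (i, j)" using assms(2-) *[of i "p' + j"] by simp
  qed (use assms in auto)
  show "C = C'"
  proof (rule eq_matI)
    fix i j assume "i < dim_row C'" "j < dim_col C'"
    then show "C $$ (i, j) = C' $$ (i, j)" using assms(2-) *[of "p + i" j] by simp
  qed (use assms in auto)
  show "D = D'"
  proof (rule eq_matI)
    fix i j assume "i < dim_row D'" "j < dim_col D'"
    then show "D $$ (i, j) = D' $$ (i, j)" using assms(2-) *[of "p + i" "p' + j"] by simp
  qed (use assms in auto)
qed

text \<open>The cancellation at the end of \<open>schur_complement_ode\<close>: \<open>b\<close> and \<open>e\<close> are the terms containing \<open>Y12\<close>
and \<open>Y22\<close>.\<close>
lemma mat_telescope:
  fixes a :: "'b::ab_group_add mat"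
  assumes "a \<in> carrier_mat p q" "c \<in> carrier_mat p q" "f \<in> carrier_mat p q"
    "d \<in> carrier_mat p q" "e \<in> carrier_mat p q" "b \<in> carrier_mat p q"
  shows "(a - c) - (f - d) = (a + b) - (((c + b) - (d + e)) + (f + e))"
  using assms by (intro eq_matI) auto

text \<open>From \<open>F E22 = E12\<close> with \<open>F = E12 V\<close> one obtains the Riccati equation
\<open>D F = Y11 F + Y12 - F (Y21 F + Y22)\<close>; it is inserted into \<open>D (E11 - F E21)\<close>, where the terms
containing \<open>Y12\<close> and \<open>Y22\<close> cancel.\<close>
lemma schur_complement_ode:
  fixes E11 :: "('a::{real_algebra,monoid_mult}, 'N::finite) nilpoly mat"
  assumes E: "E11 \<in> carrier_mat p p" "E12 \<in> carrier_mat p q" "E21 \<in> carrier_mat q p" "E22 \<in> carrier_mat q q"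
    and Y: "Y11 \<in> carrier_mat p p" "Y12 \<in> carrier_mat p q" "Y21 \<in> carrier_mat q p" "Y22 \<in> carrier_mat q q"
    and ode: "euler_mat (four_block_mat E11 E12 E21 E22) = four_block_mat Y11 Y12 Y21 Y22 * four_block_mat E11 E12 E21 E22"
    and V: "is_mat_inverse E22 V"
  shows "euler_mat E22 = (Y21 * (E12 * V) + Y22) * E22"
    and "euler_mat (E11 - E12 * V * E21) = (Y11 - E12 * V * Y21) * (E11 - E12 * V * E21)"
proof -
  have cV: "V \<in> carrier_mat q q" and EV: "E22 * V = 1\<^sub>m q" and VE: "V * E22 = 1\<^sub>m q"
    using V E by (auto simp: is_mat_inverse_def)
  define F where "F = E12 * V"
  have F: "F \<in> carrier_mat p q" using E cV by (simp add: F_def)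
  have FE: "F * E22 = E12"
    unfolding F_def assoc_mult_mat[OF E(2) cV E(4)] VE using E(2) by (rule one_mult_mat_right)
  have "euler_mat (four_block_mat E11 E12 E21 E22) =
      four_block_mat (euler_mat E11) (euler_mat E12) (euler_mat E21) (euler_mat E22)"
    by (rule map_four_block_mat[OF E])
  then have blocks: "four_block_mat (euler_mat E11) (euler_mat E12) (euler_mat E21) (euler_mat E22) =
    four_block_mat (Y11 * E11 + Y12 * E21) (Y11 * E12 + Y12 * E22) (Y21 * E11 + Y22 * E21) (Y21 * E12 + Y22 * E22)"
    using ode mult_four_block_mat[OF Y E] by simp
  have DE: "euler_mat E11 = Y11 * E11 + Y12 * E21" "euler_mat E12 = Y11 * E12 + Y12 * E22"
    "euler_mat E21 = Y21 * E11 + Y22 * E21" "euler_mat E22 = Y21 * E12 + Y22 * E22"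
    by (rule four_block_mat_eqD[OF blocks]; use E Y in auto)+
  define K where "K = Y21 * F + Y22"
  define L where "L = Y11 * F + Y12"
  have c: "Y21 * F \<in> carrier_mat q q" "Y11 * F \<in> carrier_mat p q" "K \<in> carrier_mat q q" "L \<in> carrier_mat p q"
    using F Y by (auto simp: K_def L_def)
  have FK: "F * K \<in> carrier_mat p q" using F c by simp
  have DE22: "euler_mat E22 = K * E22"
    unfolding DE K_def add_mult_distrib_mat[OF c(1) Y(4) E(4)] assoc_mult_mat[OF Y(3) F E(4)] FE ..
  then show "euler_mat E22 = (Y21 * (E12 * V) + Y22) * E22" by (simp add: K_def F_def)
  have LE: "L * E22 = euler_mat E12"
    unfolding DE L_def add_mult_distrib_mat[OF c(2) Y(2) E(4)] assoc_mult_mat[OF Y(1) F E(4)] FE ..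
  have mF: "euler_mat F \<in> carrier_mat p q" using F by simp
  have "euler_mat E12 = euler_mat F * E22 + F * euler_mat E22"
    using euler_mat_mult[OF F E(4)] FE by simp
  also have "F * euler_mat E22 = F * K * E22"
    unfolding DE22 using assoc_mult_mat[OF F c(3) E(4)] ..
  finally have dE12: "euler_mat E12 = euler_mat F * E22 + F * K * E22" .
  have "euler_mat F * E22 = euler_mat E12 - F * K * E22"
    unfolding dE12 using mF FK E(4) by (intro eq_matI) auto
  also have "\<dots> = (L - F * K) * E22"
    unfolding minus_mult_distrib_mat[OF c(4) FK E(4)] LE ..
  finally have eq: "euler_mat F * E22 = (L - F * K) * E22" .
  have LF: "L - F * K \<in> carrier_mat p q" using FK by (rule minus_carrier_mat)
  have "euler_mat F = euler_mat F * E22 * V"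
    unfolding assoc_mult_mat[OF mF E(4) cV] EV using one_mult_mat_right[OF mF] ..
  also have "\<dots> = L - F * K"
    unfolding eq assoc_mult_mat[OF LF E(4) cV] EV using one_mult_mat_right[OF LF] .
  finally have DF: "euler_mat F = L - F * K" .
  define T where "T = F * E21"
  have T: "T \<in> carrier_mat p p" "Y22 * E21 \<in> carrier_mat q p" "Y21 * T \<in> carrier_mat q p" "Y21 * E11 \<in> carrier_mat q p"
      "K * E21 \<in> carrier_mat q p" "F * Y21 \<in> carrier_mat p p"
    using F E Y c by (auto simp: T_def)
  have "K * E21 = Y21 * T + Y22 * E21"
    unfolding K_def T_def add_mult_distrib_mat[OF c(1) Y(4) E(3)] assoc_mult_mat[OF Y(3) F E(3)] ..
  then have FKE: "F * K * E21 = F * (Y21 * T) + F * (Y22 * E21)"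
    unfolding assoc_mult_mat[OF F c(3) E(3)] using mult_add_distrib_mat[OF F T(3) T(2)] by simp
  have LE21: "L * E21 = Y11 * T + Y12 * E21"
    unfolding L_def T_def add_mult_distrib_mat[OF c(2) Y(2) E(3)] assoc_mult_mat[OF Y(1) F E(3)] ..
  have DT: "euler_mat T = (Y11 * T + Y12 * E21 - (F * (Y21 * T) + F * (Y22 * E21))) + (F * (Y21 * E11) + F * (Y22 * E21))"
    unfolding T_def euler_mat_mult[OF F E(3)] DF minus_mult_distrib_mat[OF c(4) FK E(3)] LE21[unfolded T_def] FKE[unfolded T_def]
      DE(3) mult_add_distrib_mat[OF F T(4) T(2)] ..
  have S: "E11 - T \<in> carrier_mat p p" using T(1) by (rule minus_carrier_mat)
  have "(Y11 - F * Y21) * (E11 - T) = (Y11 * E11 - Y11 * T) - (F * (Y21 * E11) - F * (Y21 * T))"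
    unfolding minus_mult_distrib_mat[OF Y(1) T(6) S] mult_minus_distrib_mat[OF Y(1) E(1) T(1)]
      mult_minus_distrib_mat[OF T(6) E(1) T(1)] assoc_mult_mat[OF F Y(3) E(1)] assoc_mult_mat[OF F Y(3) T(1)] ..
  also have "\<dots> = euler_mat E11 - euler_mat T"
  proof -
    have "Y11 * E11 \<in> carrier_mat p p" "Y11 * T \<in> carrier_mat p p" "F * (Y21 * E11) \<in> carrier_mat p p"
      "F * (Y21 * T) \<in> carrier_mat p p" "F * (Y22 * E21) \<in> carrier_mat p p" "Y12 * E21 \<in> carrier_mat p p"
      using E Y F T by auto
    then show ?thesis
      unfolding DT DE(1) by (rule mat_telescope)
  qed
  also have "\<dots> = euler_mat (E11 - T)"
    using euler_mat_diff[OF E(1) T(1)] ..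
  finally show "euler_mat (E11 - E12 * V * E21) = (Y11 - E12 * V * Y21) * (E11 - E12 * V * E21)"
    by (simp add: T_def F_def)
qed

section \<open>Exponentials\<close>

lemma ncoeff_eps_nconst_mult:
  fixes z :: "('a::{real_algebra,monoid_mult}, 'N::finite) nilpoly"
  shows "ncoeff (eps * nconst a * z) k = (if 0 < k \<and> k < CARD('N) then a * ncoeff z (k - 1) else 0)"
proof (cases "k < CARD('N)")
  case True
  have "ncoeff (nconst a * z) l = a * ncoeff z l" if "l < CARD('N)" for l
  proof -
    have "(\<Sum>i=0..l. ncoeff (nconst a) i * ncoeff z (l - i)) = (\<Sum>i=0..l. if i = 0 then a * ncoeff z l else 0)"
      by (rule sum.cong) (auto simp: nconst.rep_eq)
    then show ?thesis using that by (simp add: ncoeff_mult[of "nconst a" z])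
  qed
  moreover have "ncoeff (eps * w) k = (if 0 < k then ncoeff w (k - 1) else 0)" for w :: "('a, 'N) nilpoly"
  proof -
    have "(\<Sum>i=0..k. ncoeff (eps :: ('a, 'N) nilpoly) i * ncoeff w (k - i)) = (\<Sum>i=0..k. if i = 1 then ncoeff w (k - 1) else 0)"
      using True by (intro sum.cong) (auto simp: eps.rep_eq)
    then show ?thesis using True by (auto simp: ncoeff_mult[of eps w])
  qed
  ultimately show ?thesis using True by (simp add: mult.assoc)
qed (simp add: ncoeff_beyond)

lemma ncoeff_eps_nconst:
  "ncoeff (eps * nconst a :: ('a::{real_algebra,monoid_mult}, 'N::finite) nilpoly) k = (if k = 1 \<and> k < CARD('N) then a else 0)"
  using ncoeff_eps_nconst_mult[of a "1 :: ('a, 'N) nilpoly" k] by auto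

lemma ncoeff_eps_nconst_power:
  "ncoeff ((eps * nconst a :: ('a::{real_algebra,monoid_mult}, 'N::finite) nilpoly) ^ k) l = (if l = k \<and> k < CARD('N) then a ^ k else 0)"
proof (induction k arbitrary: l)
  case 0
  show ?case using card_pos[where 'N = 'N] by simp
next
  case (Suc k)
  show ?case by (auto simp: ncoeff_eps_nconst_mult Suc.IH)
qed

lemma ncoeff_exp_nil:
  "ncoeff (exp_nil (eps * nconst a :: ('a::{real_algebra,monoid_mult}, 'N::finite) nilpoly)) l =
    (if l < CARD('N) then (1 / fact l) *\<^sub>R a ^ l else 0)"
proof -
  have "(\<Sum>k<CARD('N). (1 / fact k) *\<^sub>R (if l = k \<and> k < CARD('N) then a ^ k else 0)) =
    (\<Sum>k<CARD('N). if k = l then (1 / fact l) *\<^sub>R a ^ l else 0)"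
    by (rule sum.cong) auto
  then show ?thesis
    by (simp add: exp_nil_def ncoeff_eps_nconst_power)
qed

lemma fact_step: "real (Suc l) *\<^sub>R ((1 / fact (Suc l)) *\<^sub>R x) = (1 / fact l) *\<^sub>R (x :: 'b::real_vector)"
  by (simp add: field_simps del: of_nat_Suc)

lemma euler_exp_nil:
  fixes a :: "'a::{real_algebra,monoid_mult}"
  defines "h \<equiv> (eps * nconst a :: ('a, 'N::finite) nilpoly)"
  shows "euler (exp_nil h) = h * exp_nil h"
proof (rule nilpoly_eqI)
  fix k assume k: "k < CARD('N)"
  show "ncoeff (euler (exp_nil h)) k = ncoeff (h * exp_nil h) k"
  proof (cases k)
    case (Suc l)
    with k show ?thesis
      unfolding h_def ncoeff_euler ncoeff_exp_nil ncoeff_eps_nconst_mult Suc by (simp only: fact_step if_True) simp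
  qed (simp add: h_def ncoeff_eps_nconst_mult)
qed

lemma mat_power_carrier [simp]: "Z \<in> carrier_mat m m \<Longrightarrow> mat_power Z k \<in> carrier_mat m m"
  by (induction k) auto

lemma mat_power_Suc_left:
  assumes Z: "Z \<in> carrier_mat m m"
  shows "mat_power Z (Suc k) = Z * mat_power Z k"
proof (induction k)
  case 0
  then show ?case using one_mult_mat_left[OF Z] one_mult_mat_right[OF Z] Z by simp
next
  case (Suc k)
  have "mat_power Z (Suc (Suc k)) = Z * mat_power Z k * Z"
    using Suc.IH by simp
  also have "\<dots> = Z * mat_power Z (Suc k)"
    using assoc_mult_mat[OF Z mat_power_carrier[OF Z] Z] by simp
  finally show ?case .
qed

lemma eps_mat_carrier [simp]: "X \<in> carrier_mat m m \<Longrightarrow> eps_mat X \<in> carrier_mat m m"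
  by (simp add: eps_mat_def)

lemma index_eps_mat [simp]: "X \<in> carrier_mat m m \<Longrightarrow> i < m \<Longrightarrow> j < m \<Longrightarrow> eps_mat X $$ (i, j) = eps * nconst (X $$ (i, j))"
  by (simp add: eps_mat_def)

lemma ncoeff_mat_power_eps_mat:
  fixes X :: "'a::{real_algebra,monoid_mult} mat"
  assumes X: "X \<in> carrier_mat m m" and ij: "i < m" "j < m"
  shows "ncoeff (mat_power (eps_mat X :: ('a, 'N::finite) nilpoly mat) k $$ (i, j)) l =
    (if l = k \<and> k < CARD('N) then mat_power X k $$ (i, j) else 0)"
  using ij
proof (induction k arbitrary: i j l)
  case 0
  have "dim_row (eps_mat X :: ('a, 'N) nilpoly mat) = m" using eps_mat_carrier[OF X] by (rule carrier_matD)
  then show ?case using 0 X card_pos[where 'N = 'N] by simp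
next
  case (Suc k)
  let ?Y = "eps_mat X :: ('a, 'N) nilpoly mat"
  have Y: "?Y \<in> carrier_mat m m" using X by simp
  have "ncoeff (mat_power ?Y (Suc k) $$ (i, j)) l = (\<Sum>p<m. ncoeff (eps * nconst (X $$ (i, p)) * mat_power ?Y k $$ (p, j)) l)"
    unfolding mat_power_Suc_left[OF Y] mult_mat_entry[OF Y mat_power_carrier[OF Y] Suc.prems] ncoeff_sum
    using X Suc.prems by (intro sum.cong) simp_all
  also have "\<dots> = (\<Sum>p<m. if l = Suc k \<and> Suc k < CARD('N) then X $$ (i, p) * mat_power X k $$ (p, j) else 0)"
    using Suc.prems by (intro sum.cong) (auto simp: ncoeff_eps_nconst_mult Suc.IH)
  also have "\<dots> = (if l = Suc k \<and> Suc k < CARD('N) then mat_power X (Suc k) $$ (i, j) else 0)"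
    unfolding mat_power_Suc_left[OF X] mult_mat_entry[OF X mat_power_carrier[OF X] Suc.prems]
    by (cases "l = Suc k \<and> Suc k < CARD('N)") (auto intro!: sum.neutral)
  finally show ?case .
qed

lemma exp_mat_carrier: "Z \<in> carrier_mat m m \<Longrightarrow> exp_mat Z \<in> carrier_mat m m"
  by (simp add: exp_mat_def)

lemma ncoeff_exp_mat:
  fixes X :: "'a::{real_algebra,monoid_mult} mat"
  assumes X: "X \<in> carrier_mat m m" and ij: "i < m" "j < m"
  shows "ncoeff (exp_mat (eps_mat X :: ('a, 'N::finite) nilpoly mat) $$ (i, j)) l =
    (if l < CARD('N) then (1 / fact l) *\<^sub>R mat_power X l $$ (i, j) else 0)"
proof -
  have d: "dim_row (eps_mat X :: ('a, 'N) nilpoly mat) = m" using eps_mat_carrier[OF X] by (rule carrier_matD)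
  have "(\<Sum>k<CARD('N). (1 / fact k) *\<^sub>R (if l = k \<and> k < CARD('N) then mat_power X k $$ (i, j) else 0)) =
    (\<Sum>k<CARD('N). if k = l then (1 / fact l) *\<^sub>R mat_power X l $$ (i, j) else 0)"
    by (rule sum.cong) auto
  then show ?thesis
    using ij by (simp add: exp_mat_def d ncoeff_mat_power_eps_mat[OF X])
qed

lemma euler_mat_exp_mat:
  fixes X :: "'a::{real_algebra,monoid_mult} mat"
  assumes X: "X \<in> carrier_mat m m"
  defines "Y \<equiv> (eps_mat X :: ('a, 'N::finite) nilpoly mat)"
  shows "euler_mat (exp_mat Y) = Y * exp_mat Y"
proof (rule eq_matI)
  have Y: "Y \<in> carrier_mat m m" using X by (simp add: Y_def)
  note E = exp_mat_carrier[OF Y]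
  fix i j assume "i < dim_row (Y * exp_mat Y)" "j < dim_col (Y * exp_mat Y)"
  then have ij: "i < m" "j < m" using Y E by auto
  have "euler (exp_mat Y $$ (i, j)) = (Y * exp_mat Y) $$ (i, j)"
  proof (rule nilpoly_eqI)
    fix k assume k: "k < CARD('N)"
    have *: "ncoeff ((Y * exp_mat Y) $$ (i, j)) k = (\<Sum>p<m. ncoeff (eps * nconst (X $$ (i, p)) * exp_mat Y $$ (p, j)) k)"
      unfolding mult_mat_entry[OF Y E ij] ncoeff_sum using X ij by (intro sum.cong) (simp_all add: Y_def)
    show "ncoeff (euler (exp_mat Y $$ (i, j))) k = ncoeff ((Y * exp_mat Y) $$ (i, j)) k"
    proof (cases k)
      case 0
      then show ?thesis unfolding * by (simp add: ncoeff_eps_nconst_mult)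
    next
      case (Suc l)
      have "ncoeff (euler (exp_mat Y $$ (i, j))) k = (1 / fact l) *\<^sub>R mat_power X (Suc l) $$ (i, j)"
        unfolding Y_def ncoeff_euler ncoeff_exp_mat[OF X ij] using k unfolding Suc by (simp only: fact_step if_True)
      also have "\<dots> = (\<Sum>p<m. X $$ (i, p) * ((1 / fact l) *\<^sub>R mat_power X l $$ (p, j)))"
        unfolding mat_power_Suc_left[OF X] mult_mat_entry[OF X mat_power_carrier[OF X] ij]
        by (simp add: scaleR_sum_right)
      also have "\<dots> = ncoeff ((Y * exp_mat Y) $$ (i, j)) k"
        unfolding * ncoeff_eps_nconst_mult using k Suc ij by (intro sum.cong) (simp_all add: Y_def ncoeff_exp_mat[OF X])
      finally show ?thesis .
    qed
  qed
  then show "euler_mat (exp_mat Y) $$ (i, j) = (Y * exp_mat Y) $$ (i, j)"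
    using ij E by simp
qed (use X in \<open>auto simp: Y_def exp_mat_def\<close>)

lemma unipotent_exp_mat:
  fixes X :: "'a::{real_algebra,monoid_mult} mat"
  assumes X: "X \<in> carrier_mat m m"
  shows "unipotent (exp_mat (eps_mat X :: ('a, 'N::finite) nilpoly mat))"
  using X card_pos[where 'N = 'N]
  by (simp add: unipotent_iff[OF exp_mat_carrier[OF eps_mat_carrier[OF X]]] ncoeff_exp_mat[OF X])

context graded_commutative_algebra
begin

lemma degree0_eps_mat:
  assumes vs: "vectors n ds" and X: "X \<in> degree0 A ds ds"
  shows "(eps_mat X :: ('a, 'N::finite) nilpoly mat) \<in> degree0 (nilpoly_grading A) ds ds"
  using degree0_carrier[OF X] degree0_entry[OF X] vs
  unfolding degree0_def nilpoly_grading_def by (auto simp: ncoeff_eps_nconst vectors_nth)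

lemma degree0_mat_power:
  assumes vs: "vectors n ds" and X: "X \<in> degree0 A ds ds"
  shows "mat_power X k \<in> degree0 A ds ds"
proof (induction k)
  case 0
  show ?case using degree0_one[OF vs] degree0_carrier[OF X] by simp
next
  case (Suc k)
  then show ?case using degree0_mult[OF vs vs vs _ X] by simp
qed

lemma degree0_exp_mat:
  assumes vs: "vectors n ds" and X: "X \<in> degree0 A ds ds"
  shows "exp_mat (eps_mat X :: ('a, 'N::finite) nilpoly mat) \<in> degree0 (nilpoly_grading A) ds ds"
  using exp_mat_carrier[OF eps_mat_carrier[OF degree0_carrier[OF X]]] degree0_entry[OF degree0_mat_power[OF vs X]] vs
  unfolding degree0_def nilpoly_grading_def
  by (auto simp: ncoeff_exp_mat[OF degree0_carrier[OF X]] vectors_nth intro!: component_scaleR)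

end

section \<open>Traces\<close>

lemma mat_trace_diff: "Z \<in> carrier_mat m m \<Longrightarrow> W \<in> carrier_mat m m \<Longrightarrow> mat_trace (Z - W) = mat_trace Z - mat_trace (W :: 'b::ab_group_add mat)"
  by (simp add: mat_trace_def sum_subtractf)

lemma mat_trace_add: "Z \<in> carrier_mat m m \<Longrightarrow> W \<in> carrier_mat m m \<Longrightarrow> mat_trace (Z + W) = mat_trace Z + mat_trace (W :: 'b::ab_group_add mat)"
  by (simp add: mat_trace_def sum.distrib)

lemma length_gammas: "length (gammas n) = 2 ^ n"
  by (simp add: gammas_def length_evens_odds)

lemma parity_list_index_degrees:
  "parity_list n b \<delta>s \<Longrightarrow> parity_list n b (index_degrees \<delta>s s)"
  using set_index_degrees[of \<delta>s s] by (auto simp: parity_list_def)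

lemma parity_list_evens: "parity_list n 0 (evens n)"
  by (auto simp: parity_list_def set_evens)

lemma parity_list_odds: "parity_list n 1 (odds n)"
  by (auto simp: parity_list_def set_odds)

lemma graded_trace_index_degrees:
  assumes r: "length r = 2 ^ n"
  defines "ds \<equiv> index_degrees (gammas n) r"
  shows "graded_trace n r Z = (\<Sum>x<sum_list r. sgn_pow (sum_list (ds ! x)) *\<^sub>R Z $$ (x, x))"
proof -
  have "graded_trace n r Z = (\<Sum>k<length r. \<Sum>i<r ! k. sgn_pow (sum_list (ds ! (sum_list (take k r) + i))) *\<^sub>R
      Z $$ (sum_list (take k r) + i, sum_list (take k r) + i))"
    unfolding graded_trace_def r[symmetric]
  proof (rule sum.cong[OF refl])
    fix k assume "k \<in> {..<length r}"
    then show "sgn_pow (ip (gammas n ! k) (gammas n ! k)) *\<^sub>R mat_trace (block r Z k k) =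
      (\<Sum>i<r ! k. sgn_pow (sum_list (ds ! (sum_list (take k r) + i))) *\<^sub>R
        Z $$ (sum_list (take k r) + i, sum_list (take k r) + i))"
      using r by (simp add: ds_def mat_trace_def block_def nth_index_degrees length_gammas ip_self scaleR_sum_right)
  qed
  also have "\<dots> = (\<Sum>x<sum_list r. sgn_pow (sum_list (ds ! x)) *\<^sub>R Z $$ (x, x))"
    by (rule sum_block_index)
  finally show ?thesis .
qed

lemma graded_trace_eps_mat:
  assumes "X \<in> carrier_mat (sum_list r) (sum_list r)" "length r = 2 ^ n"
  shows "graded_trace n r (eps_mat X :: ('a::{real_algebra,monoid_mult}, 'N::finite) nilpoly mat) =
    eps * nconst (graded_trace n r X)"
proof (rule ncoeff_eqI)
  fix k
  show "ncoeff (graded_trace n r (eps_mat X :: ('a, 'N) nilpoly mat)) k =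
    ncoeff (eps * nconst (graded_trace n r X) :: ('a, 'N) nilpoly) k"
    unfolding graded_trace_index_degrees[OF assms(2)] using assms(1)
    by (cases "k = 1 \<and> k < CARD('N)") (auto simp: ncoeff_eps_nconst intro!: sum.neutral)
qed

lemma component_at_even_part: "graded_commutative_algebra n B \<Longrightarrow> component_at n B x \<in> even_part n B"
  by transfer auto

context graded_commutative_algebra
begin

lemma twisted_det_component:
  assumes par: "parity_list n b ds" and Z: "Z \<in> degree0 A ds ds"
  shows "twisted_det n ds Z \<in> A (zvec n)"
proof -
  obtain M where M: "twist_rep n A ds ds M Z" by (rule ex_twist_rep[OF par par Z])
  have "concentrated (zvec n) (twisted_det n ds Z) \<in> even_part n A"
    using component_at_even_part[OF graded_commutative_algebra_axioms, of "det M"] component_at_det[OF par M] by simp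
  then have "concentrated (zvec n) (twisted_det n ds Z) (zvec n) \<in> A (zvec n)"
    using zvec_even[of n] unfolding even_part_def by fastforce
  then show ?thesis by (simp add: concentrated_def)
qed

lemma mat_trace_component:
  assumes vs: "vectors n ds" and Z: "Z \<in> degree0 A ds ds"
  shows "mat_trace Z \<in> A (zvec n)"
  unfolding mat_trace_def
proof (rule component_sum)
  fix i assume "i \<in> {..<dim_row Z}"
  then have i: "i < length ds" using degree0_carrier[OF Z] by simp
  show "Z $$ (i, i) \<in> A (zvec n)"
    using degree0_entry[OF Z i i] vectors_nth[OF vs i] by (simp add: vec_add_self)
qed simp

lemma degree_zero_commute: "a \<in> A (zvec n) \<Longrightarrow> b \<in> A (zvec n) \<Longrightarrow> a * b = b * a"
  using graded_commute[of "zvec n" "zvec n" a b] by simp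

text \<open>The entries \<open>(i, j)\<close> of \<open>P\<close> and \<open>(j, i)\<close> of \<open>Q\<close> have the same degree, which is odd, so they
anticommute.\<close>
lemma supertrace_commute:
  assumes par: "parity_list n 0 ds" "parity_list n 1 es"
    and P: "P \<in> degree0 A ds es" and Q: "Q \<in> degree0 A es ds"
  shows "mat_trace (P * Q) = - mat_trace (Q * P)"
proof -
  note c = degree0_carrier[OF P] degree0_carrier[OF Q]
  have "Q $$ (j, i) * P $$ (i, j) = - (P $$ (i, j) * Q $$ (j, i))" if ij: "i < length ds" "j < length es" for i j
  proof -
    let ?\<gamma> = "ds ! i \<boxplus> es ! j"
    have len: "length (ds ! i) = n" "length (es ! j) = n" and sums: "sum_list (ds ! i) = 0" "sum_list (es ! j) = 1"
      using par ij by (auto simp: parity_list_def)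
    have "ip ?\<gamma> ?\<gamma> = 1" using len sums by (simp add: ip_self sum_list_vec_add)
    moreover have "Q $$ (j, i) \<in> A ?\<gamma>" "P $$ (i, j) \<in> A ?\<gamma>"
      using degree0_entry[OF Q ij(2,1)] degree0_entry[OF P ij] by (simp_all add: vec_add_commute)
    ultimately show ?thesis
      using graded_commute[of ?\<gamma> ?\<gamma> "P $$ (i, j)" "Q $$ (j, i)"] len by (simp add: sgn_pow_def)
  qed
  note * = this
  have "mat_trace (Q * P) = (\<Sum>j<length es. \<Sum>i<length ds. Q $$ (j, i) * P $$ (i, j))"
    using c by (simp add: mat_trace_def mult_mat_entry[OF c(2,1)] del: index_mult_mat(1))
  also have "\<dots> = (\<Sum>i<length ds. \<Sum>j<length es. Q $$ (j, i) * P $$ (i, j))"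
    by (rule sum.swap)
  also have "\<dots> = - (\<Sum>i<length ds. \<Sum>j<length es. P $$ (i, j) * Q $$ (j, i))"
    by (simp add: * sum_negf)
  also have "(\<Sum>i<length ds. \<Sum>j<length es. P $$ (i, j) * Q $$ (j, i)) = mat_trace (P * Q)"
    using c by (simp add: mat_trace_def mult_mat_entry[OF c] del: index_mult_mat(1))
  finally show ?thesis by simp
qed

end

lemma ring_inverse_eqI: "x * y = 1 \<Longrightarrow> y * x = 1 \<Longrightarrow> ring_inverse x = (y :: 'b::{real_algebra,monoid_mult})"
  unfolding ring_inverse_def by (rule the_equality) (auto, metis mult.assoc mult_1 mult_1_right)

lemma graded_trace_four_block:
  fixes Z11 :: "'b::real_vector mat"
  assumes n: "n \<ge> 1" and r: "length r = 2 ^ n"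
  defines "re \<equiv> take (2 ^ (n - 1)) r" and "ro \<equiv> drop (2 ^ (n - 1)) r"
  assumes Z: "Z11 \<in> carrier_mat (sum_list re) (sum_list re)" "Z12 \<in> carrier_mat (sum_list re) (sum_list ro)"
    "Z21 \<in> carrier_mat (sum_list ro) (sum_list re)" "Z22 \<in> carrier_mat (sum_list ro) (sum_list ro)"
  shows "graded_trace n r (four_block_mat Z11 Z12 Z21 Z22) = mat_trace Z11 - mat_trace Z22"
proof -
  have len: "length (evens n) = length re" "length (odds n) = length ro"
    using n r by (cases n; simp add: re_def ro_def length_evens length_odds)+
  have rr: "r = re @ ro" by (simp add: re_def ro_def)
  let ?ds = "index_degrees (evens n) re" and ?es = "index_degrees (odds n) ro"
  have ds: "index_degrees (gammas n) r = ?ds @ ?es"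
    unfolding gammas_def rr by (rule index_degrees_append[OF len(1)])
  note lens = length_index_degrees[OF len(1)] length_index_degrees[OF len(2)]
  have par: "parity_list n 0 ?ds" "parity_list n 1 ?es"
    by (intro parity_list_index_degrees parity_list_evens parity_list_odds)+
  have p: "sum_list (?ds ! x) = 0" if "x < sum_list re" for x
    using par(1) that lens by (auto simp: parity_list_def)
  have q: "sum_list (?es ! x) = 1" if "x < sum_list ro" for x
    using par(2) that lens by (auto simp: parity_list_def)
  have "sum_list r = sum_list re + sum_list ro" unfolding rr by simp
  then show ?thesis
    unfolding graded_trace_index_degrees[OF r] ds using Z
    by (simp add: sum_lessThan_add nth_append lens p q mat_trace_def sgn_pow_def sum_negf)
qed

section \<open>The Berezinian of an exponential\<close>

theorem theorem4:
  fixes n :: nat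
    and A :: "bit list \<Rightarrow> 'a::{real_algebra,monoid_mult} set"
    and r :: "nat list"
    and X :: "'a mat"
  assumes "n \<ge> 1"
    and "graded_commutative_algebra n A"
    and "length r = 2 ^ n"
    and "X \<in> M0 n A r"
  shows "graded_ber n (nilpoly_grading A) r (exp_mat (eps_mat X :: ('a, 'N::finite) nilpoly mat)) =
    exp_nil (graded_trace n r (eps_mat X :: ('a, 'N) nilpoly mat))"
proof -
  interpret graded_commutative_algebra n A by fact
  let ?B = "nilpoly_grading A :: bit list \<Rightarrow> ('a, 'N) nilpoly set"
  interpret N: graded_commutative_algebra n ?B
    by (rule graded_commutative_algebra_nilpoly)
  define re where "re = take (2 ^ (n - 1)) r"
  define ro where "ro = drop (2 ^ (n - 1)) r"
  define ds where "ds = index_degrees (evens n) re"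
  define es where "es = index_degrees (odds n) ro"
  have len: "length (evens n) = length re" "length (odds n) = length ro"
    using assms(1,3) by (cases n; simp add: re_def ro_def length_evens length_odds)+
  have lens: "length ds = sum_list re" "length es = sum_list ro"
    by (simp_all add: ds_def es_def length_index_degrees len)
  have r: "r = re @ ro" by (simp add: re_def ro_def)
  have par: "parity_list n 0 ds" "parity_list n 1 es"
    unfolding ds_def es_def by (intro parity_list_index_degrees parity_list_evens parity_list_odds)+
  note vs = par[THEN parity_list_vectors]
  have vss: "vectors n (ds @ es)" using vs by simp
  have "index_degrees (gammas n) r = ds @ es"
    unfolding gammas_def r ds_def es_def by (rule index_degrees_append[OF len(1)])
  then have X: "X \<in> degree0 A (ds @ es) (ds @ es)"
    using assms(3,4) by (simp add: M0_def graded_matrices_eq_degree0 length_gammas)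
  have sr: "sum_list r = length ds + length es" unfolding r lens by simp
  then have cX: "X \<in> carrier_mat (sum_list r) (sum_list r)" using degree0_carrier[OF X] by simp
  define Y where "Y = (eps_mat X :: ('a, 'N) nilpoly mat)"
  define E where "E = exp_mat Y"
  have Y0: "Y \<in> degree0 ?B (ds @ es) (ds @ es)" unfolding Y_def by (rule degree0_eps_mat[OF vss X])
  have E0: "E \<in> degree0 ?B (ds @ es) (ds @ es)" unfolding E_def Y_def by (rule degree0_exp_mat[OF vss X])
  obtain Y11 Y12 Y21 Y22 where sY: "split_block Y (length ds) (length ds) = (Y11, Y12, Y21, Y22)"
    by (metis surj_pair)
  obtain E11 E12 E21 E22 where sE: "split_block E (length ds) (length ds) = (E11, E12, E21, E22)"
    by (metis surj_pair)
  have "dim_row Y = length ds + length es" "dim_col Y = length ds + length es"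
    using degree0_carrier[OF Y0] by auto
  note bY = split_block[OF sY this]
  have "dim_row E = length ds + length es" "dim_col E = length ds + length es"
    using degree0_carrier[OF E0] by auto
  note bE = split_block[OF sE this]
  have Ys: "Y11 \<in> degree0 ?B ds ds" "Y12 \<in> degree0 ?B ds es" "Y21 \<in> degree0 ?B es ds" "Y22 \<in> degree0 ?B es es"
    using Y0 bY(1-4) unfolding bY(5) by (simp_all add: degree0_four_block_iff)
  have Es: "E11 \<in> degree0 ?B ds ds" "E12 \<in> degree0 ?B ds es" "E21 \<in> degree0 ?B es ds" "E22 \<in> degree0 ?B es es"
    using E0 bE(1-4) unfolding bE(5) by (simp_all add: degree0_four_block_iff)

  have uE: "ncoeff (E $$ (i, j)) 0 = (if i = j then 1 else 0)" if "i < length ds + length es" "j < length ds + length es" for i j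
    using unipotent_exp_mat[OF cX, where 'N = 'N] exp_mat_carrier[OF eps_mat_carrier[OF cX], where 'b = 'N] that
    unfolding E_def Y_def sr by (simp add: unipotent_iff)
  have u22: "unipotent E22"
    using uE[of "length ds + i" "length ds + j" for i j] bE(1-4) unfolding bE(5) unipotent_iff[OF bE(4)] by simp
  have u11: "ncoeff (E11 $$ (i, j)) 0 = (if i = j then 1 else 0)" if "i < length ds" "j < length ds" for i j
    using uE[of i j] that bE(1-4) unfolding bE(5) by simp
  have u21: "ncoeff (E21 $$ (i, j)) 0 = 0" if "i < length es" "j < length ds" for i j
    using uE[of "length ds + i" j] that bE(1-4) unfolding bE(5) by simp
  obtain V where V: "is_mat_inverse E22 V" and uV: "unipotent V"
    by (rule unipotent_invertible[OF bE(4) u22])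
  have V0: "V \<in> degree0 ?B es es" by (rule N.degree0_inverse[OF vs(2) Es(4) V])
  define F where "F = E12 * V"
  define S where "S = E11 - F * E21"
  have F0: "F \<in> degree0 ?B ds es" unfolding F_def by (rule N.degree0_mult[OF vs vs(2) Es(2) V0])
  have FE: "F * E21 \<in> degree0 ?B ds ds" by (rule N.degree0_mult[OF vs vs(1) F0 Es(3)])
  have S0: "S \<in> degree0 ?B ds ds" unfolding S_def by (rule N.degree0_diff[OF vs(1,1) Es(1) FE])
  have uS: "unipotent S"
  proof -
    have "ncoeff (S $$ (i, j)) 0 = (if i = j then 1 else 0)" if ij: "i < length ds" "j < length ds" for i j
    proof -
      have "ncoeff ((F * E21) $$ (i, j)) 0 = 0"
        unfolding mult_mat_entry[OF degree0_carrier[OF F0] bE(3) ij] by (simp add: ncoeff_mult_0 u21 ij)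
      then show ?thesis
        using ij u11[OF ij] degree0_carrier[OF FE] by (simp add: S_def del: index_mult_mat)
    qed
    then show ?thesis using degree0_carrier[OF S0] by (simp add: unipotent_iff)
  qed

  define g1 where "g1 = twisted_det n ds S"
  define g2 where "g2 = twisted_det n es E22"
  \<comment> \<open>By multiplicativity the determinant of \<open>V\<close> is the inverse of that of \<open>E22\<close>, so the quotient can be differentiated.\<close>
  define g2' where "g2' = twisted_det n es V"
  have VE: "E22 * V = 1\<^sub>m (length es)" "V * E22 = 1\<^sub>m (length es)"
    using V bE(4) by (auto simp: is_mat_inverse_def)
  have inv: "g2 * g2' = 1" "g2' * g2 = 1"
    unfolding g2_def g2'_def N.twisted_det_mult[OF par(2) Es(4) V0, symmetric] N.twisted_det_mult[OF par(2) V0 Es(4), symmetric] VE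
    by (rule twisted_det_one[OF vs(2)])+
  have "graded_det ?B (evens n) re S = g1"
    unfolding g1_def ds_def
    by (rule N.graded_det_eq_twisted_det[OF len(1) parity_list_evens])
      (use S0 uS lens degree0_carrier[OF S0] in \<open>simp_all add: unipotent_quasidet_defined flip: ds_def\<close>)
  moreover have "graded_det ?B (odds n) ro E22 = g2"
    unfolding g2_def es_def
    by (rule N.graded_det_eq_twisted_det[OF len(2) parity_list_odds])
      (use Es u22 lens bE(4) in \<open>simp_all add: unipotent_quasidet_defined flip: es_def\<close>)
  moreover have "Defs.mat_inverse E22 = V" by (rule mat_inverse_eqI[OF V bE(4)])
  ultimately have ber: "graded_ber n ?B r E = g1 * g2'"
    unfolding graded_ber_def Let_def re_def[symmetric] ro_def[symmetric] lens(1)[symmetric] sE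
    by (simp add: ring_inverse_eqI[OF inv] flip: F_def S_def)

  \<comment> \<open>The coefficients of the decoupled equations for \<open>S\<close> and \<open>E22\<close>.\<close>
  define U where "U = Y11 - F * Y21"
  define K where "K = Y21 * F + Y22"
  have FY: "F * Y21 \<in> degree0 ?B ds ds" by (rule N.degree0_mult[OF vs vs(1) F0 Ys(3)])
  have YF: "Y21 * F \<in> degree0 ?B es es" by (rule N.degree0_mult[OF vs(2,1,2) Ys(3) F0])
  have U0: "U \<in> degree0 ?B ds ds" unfolding U_def by (rule N.degree0_diff[OF vs(1,1) Ys(1) FY])
  have K0: "K \<in> degree0 ?B es es" unfolding K_def by (rule N.degree0_add[OF vs(2,2) YF Ys(4)])
  have "euler_mat E = Y * E" unfolding E_def Y_def by (rule euler_mat_exp_mat[OF cX])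
  then have ode: "euler_mat (four_block_mat E11 E12 E21 E22) = four_block_mat Y11 Y12 Y21 Y22 * four_block_mat E11 E12 E21 E22"
    by (simp only: bE(5)[symmetric] bY(5)[symmetric])
  have odes: "euler_mat S = U * S" "euler_mat E22 = K * E22"
    using schur_complement_ode[OF bE(1-4) bY(1-4) ode V] by (simp_all add: S_def U_def K_def F_def)
  have dg: "euler g1 = mat_trace U * g1" "euler g2 = mat_trace K * g2"
    unfolding g1_def g2_def
    by (rule liouville_twisted_det[OF par(1) S0 U0 odes(1)], rule liouville_twisted_det[OF par(2) Es(4) K0 odes(2)])
  have "0 = euler (g2 * g2')" by (simp add: inv)
  also have "\<dots> = mat_trace K * (g2 * g2') + g2 * euler g2'"
    by (simp only: euler_mult dg mult.assoc)
  finally have "g2 * euler g2' = - mat_trace K"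
    by (simp add: inv eq_neg_iff_add_eq_0 add.commute)
  then have "g2' * (g2 * euler g2') = - (g2' * mat_trace K)" by simp
  then have dg2': "euler g2' = - (g2' * mat_trace K)"
    by (simp add: inv flip: mult.assoc)
  have "g1 * g2' \<in> ?B (zvec n)"
    using N.component_mult[of "zvec n" "zvec n" g1 g2'] N.twisted_det_component[OF par(1) S0] N.twisted_det_component[OF par(2) V0]
    by (simp add: g1_def g2'_def)
  then have "g1 * g2' * mat_trace K = mat_trace K * (g1 * g2')"
    using N.mat_trace_component[OF vs(2) K0] by (rule N.degree_zero_commute)
  then have "euler (g1 * g2') = (mat_trace U - mat_trace K) * (g1 * g2')"
    by (simp add: euler_mult dg dg2' mult.assoc left_diff_distrib)
  also have "mat_trace U - mat_trace K = mat_trace Y11 - mat_trace Y22"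
    using mat_trace_diff[OF bY(1) degree0_carrier[OF FY]] mat_trace_add[OF degree0_carrier[OF YF] bY(4)]
      N.supertrace_commute[OF par F0 Ys(3)]
    by (simp add: U_def K_def)
  also have "\<dots> = graded_trace n r Y"
    unfolding bY(5)
    by (rule graded_trace_four_block[OF assms(1,3), symmetric]; fold re_def ro_def lens; rule bY)
  finally have ode_ber: "euler (g1 * g2') = graded_trace n r Y * (g1 * g2')" .
  have tr: "graded_trace n r Y = eps * nconst (graded_trace n r X)"
    unfolding Y_def by (rule graded_trace_eps_mat[OF cX assms(3)])
  have "g1 * g2' = exp_nil (graded_trace n r Y)"
  proof (rule nilpoly_ode_unique[OF ode_ber])
    show "euler (exp_nil (graded_trace n r Y)) = graded_trace n r Y * exp_nil (graded_trace n r Y)"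
      unfolding tr by (rule euler_exp_nil)
    show "ncoeff (graded_trace n r Y) 0 = 0"
      unfolding tr ncoeff_eps_nconst by simp
    have "ncoeff g1 0 = 1" "ncoeff g2' 0 = 1"
      unfolding g1_def g2'_def
      by (rule ncoeff_0_twisted_det_unipotent[OF vs(1) degree0_carrier[OF S0] uS],
          rule ncoeff_0_twisted_det_unipotent[OF vs(2) degree0_carrier[OF V0] uV])
    then show "ncoeff (g1 * g2') 0 = ncoeff (exp_nil (graded_trace n r Y)) 0"
      unfolding tr ncoeff_exp_nil using card_pos[where 'N = 'N] by (simp add: ncoeff_mult_0)
  qed
  then show ?thesis
    using ber by (simp add: E_def Y_def)
qed

end
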